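(* Let $\mathcal{L}\subseteq\{0,1\}^*$ be a language defined by a witness relation $R_\mathcal{L}$ computable in polynomial space: $x\in\mathcal{L}$ iff there exists $y\in\{0,1\}^{m(|x|)}$ with $R_\mathcal{L}(x,y)=1$, where $m(\cdot)$ is a polynomial. Then, for polynomially bounded weights, the min-weight search problem for $\mathcal{L}$ is Turing reducible to the weighted decision problem $\mathcal{L}_w$ via a catalytic logspace oracle machine; equivalently, the min-weight search problem for $\mathcal{L}$ is computable in $\mathsf{CL}^{\mathcal{L}_w}$.
   Context: For an input $x$ with $m=m(|x|)$ and a weight assignment $W:[m]\to\mathbb{N}$, the weight of $y\in\{0,1\}^m$ is $W(y)=\sum_{i:y_i=1}W(i)$. The weighted decision problem is the language $\mathcal{L}_w$ with $(x,W,w_0)\in\mathcal{L}_w$ iff there exists $y$ with $R_\mathcal{L}(x,y)=1$ and $W(y)\le w_0$. A weight function $W:[m]\to\{0,1,\dots,m^c\}$ for a constant $c>0$ independent of the input is called polynomially bounded. The min-weight search problem: given $x$ (and a polynomially bounded weight function $W$), output some $y^*\in\arg\min_{y:R_\mathcal{L}(x,y)=1}W(y)$ if $x\in\mathcal{L}$ (and reject otherwise). A catalytic Turing machine with workspace bound $s(n)$ and catalytic space bound $c(n)$ has a read-only input tape, a write-only left-to-right output tape, a read-write work tape of $s(n)$ cells and a read-write catalytic tape of $c(n)$ cells; it computes $f$ if for every input $x$ of length $n$ and every initial catalytic content $\tau\in\{0,1\}^{c(n)}$ it halts with $f(x)$ on the output tape and with the catalytic tape restored to $\tau$. $\mathsf{CL}$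 is the class of functions computable with $s(n)=O(\log n)$ and $c(n)=n^{O(1)}$. An oracle $\mathsf{CL}$ machine with oracle $A$ additionally has a query tape on which it writes a string $q$ moving the head only left to right, then enters a query state and moves to a yes/no state according to whether $q\in A$; the query tape is then reset. $\mathsf{CL}^A$ denotes the functions computed by such machines. *)

theory Defs
  imports
    Complex_Main
    "HOL-Library.Landau_Symbols"
    "HOL-Computational_Algebra.Polynomial"
begin

subsection \<open>Encodings\<close>

text \<open>
  A tuple of bit strings is encoded as a single bit string by writing each bit \<open>b\<close> as
  \<open>0b\<close> and closing each component with \<open>11\<close>. Numbers are written in binary, least
  significant bit first, without superfluous zeros.
\<close>

definition encode :: "bool list list \<Rightarrow> bool list" where
  "encode ss = concat (map (\<lambda>s. concat (map (\<lambda>b. [False, b]) s) @ [True, True]) ss)"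

fun binary :: "nat \<Rightarrow> bool list" where
  "binary n = (if n = 0 then [] else odd n # binary (n div 2))"

declare binary.simps [simp del]

lemma horner_sum_binary: "horner_sum of_bool (2::nat) (binary n) = n"
proof (induction n rule: binary.induct)
  case (1 n)
  then show ?case
    by (subst binary.simps) (auto simp: mod_2_eq_odd [symmetric])
qed

lemma inj_binary: "inj binary"
  by (metis horner_sum_binary injI)

lemma encode_Nil [simp]: "encode [] = []"
  by (simp add: encode_def)

lemma encode_Cons_Nil: "encode ([] # ss) = True # True # encode ss"
  by (simp add: encode_def)

lemma encode_Cons_Cons: "encode ((b # s) # ss) = False # b # encode (s # ss)"
  by (simp add: encode_def)

lemma encode_inject: "encode ss = encode ts \<longleftrightarrow> ss = ts"
proof
  assume "encode ss = encode ts"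
  then show "ss = ts"
  proof (induction "length (encode ss)" arbitrary: ss ts rule: less_induct)
    case less
    have Nil_iff: "encode us = [] \<longleftrightarrow> us = []" for us
      by (cases us) (auto simp: encode_def)
    show ?case
    proof (cases ss)
      case Nil
      then show ?thesis using less.prems Nil_iff by (metis encode_Nil)
    next
      case (Cons s ss')
      then obtain t ts' where ts: "ts = t # ts'"
        using less.prems Nil_iff by (metis encode_Nil list.exhaust)
      show ?thesis
      proof (cases s)
        case s: Nil
        with less.prems Cons ts have t: "t = []"
          by (cases t) (auto simp: encode_Cons_Nil encode_Cons_Cons)
        with less.prems Cons ts s have "encode ss' = encode ts'"
          by (simp add: encode_Cons_Nil)
        with less.hyps [of ss' ts'] Cons s have "ss' = ts'"
          by (simp add: encode_Cons_Nil)
        with Cons s ts t show ?thesis by simp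
      next
        case s: (Cons b s')
        with less.prems Cons ts obtain t' where t: "t = b # t'"
          by (cases t) (auto simp: encode_Cons_Nil encode_Cons_Cons)
        with less.prems Cons ts s have "encode (s' # ss') = encode (t' # ts')"
          by (simp add: encode_Cons_Cons)
        with less.hyps [of "s' # ss'" "t' # ts'"] Cons s have "s' # ss' = t' # ts'"
          by (simp add: encode_Cons_Cons)
        with Cons s ts t show ?thesis by simp
      qed
    qed
  qed
qed simp


subsection \<open>Tapes\<close>

datatype move = MoveL | Stay | MoveR

text \<open>Every tape has a left end, on which a left move has no effect.\<close>

fun shift :: "move \<Rightarrow> nat \<Rightarrow> nat" where
  "shift MoveL i = i - 1"
| "shift Stay i = i"
| "shift MoveR i = i + 1"

datatype insym = LeftMark | RightMark | Bit bool

text \<open>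
  The input tape carries \<open>x\<close> on cells \<open>1, \<dots>, |x|\<close>, between two end markers that the
  input head cannot cross.
\<close>

definition read_input :: "bool list \<Rightarrow> nat \<Rightarrow> insym" where
  "read_input x i =
     (if i = 0 then LeftMark else if i \<le> length x then Bit (x ! (i - 1)) else RightMark)"

definition shift_input :: "bool list \<Rightarrow> move \<Rightarrow> nat \<Rightarrow> nat" where
  "shift_input x d i = min (shift d i) (length x + 1)"


subsection \<open>Polynomial space\<close>

text \<open>
  States are the numbers below \<open>tm_states\<close>, work tape symbols the numbers below
  \<open>tm_symbols\<close>, and \<open>0\<close> is the blank. A transition yields the new state, the input move,
  the symbol written on the work tape and the work tape move.
\<close>

record tm =
  tm_states :: nat
  tm_symbols :: nat
  tm_start :: nat
  tm_accept :: nat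
  tm_reject :: nat
  tm_delta :: "nat \<Rightarrow> insym \<Rightarrow> nat \<Rightarrow> nat \<times> move \<times> nat \<times> move"

definition tm_wf :: "tm \<Rightarrow> bool" where
  "tm_wf M \<longleftrightarrow>
     0 < tm_symbols M \<and> tm_start M < tm_states M \<and>
     tm_accept M < tm_states M \<and> tm_reject M < tm_states M \<and> tm_accept M \<noteq> tm_reject M \<and>
     (\<forall>q a b. q < tm_states M \<longrightarrow> b < tm_symbols M \<longrightarrow>
        (case tm_delta M q a b of (q', d, b', e) \<Rightarrow> q' < tm_states M \<and> b' < tm_symbols M))"

record tm_config =
  tc_state :: nat
  tc_input_pos :: nat
  tc_work :: "nat list"
  tc_work_pos :: nat

definition tm_init :: "tm \<Rightarrow> nat \<Rightarrow> tm_config" where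
  "tm_init M s =
     \<lparr>tc_state = tm_start M, tc_input_pos = 0, tc_work = replicate s 0, tc_work_pos = 0\<rparr>"

definition tm_step :: "tm \<Rightarrow> bool list \<Rightarrow> tm_config \<Rightarrow> tm_config" where
  "tm_step M x C =
     (if tc_state C \<in> {tm_accept M, tm_reject M} then C
      else case tm_delta M (tc_state C) (read_input x (tc_input_pos C)) (tc_work C ! tc_work_pos C)
        of (q, d, b, e) \<Rightarrow>
          \<lparr>tc_state = q, tc_input_pos = shift_input x d (tc_input_pos C),
           tc_work = (tc_work C)[tc_work_pos C := b], tc_work_pos = shift e (tc_work_pos C)\<rparr>)"

definition tm_decides :: "tm \<Rightarrow> (nat \<Rightarrow> nat) \<Rightarrow> bool list set \<Rightarrow> bool" where
  "tm_decides M s A \<longleftrightarrow>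
     (\<forall>x. let C = (\<lambda>t. (tm_step M x ^^ t) (tm_init M (s (length x)))) in
        (\<forall>t. tc_work_pos (C t) < s (length x)) \<and>
        (\<exists>t. tc_state (C t) = (if x \<in> A then tm_accept M else tm_reject M)))"

definition polynomially_bounded :: "(nat \<Rightarrow> nat) \<Rightarrow> bool" where
  "polynomially_bounded s \<longleftrightarrow> (\<exists>k. (\<lambda>n. real (s n)) \<in> O(\<lambda>n. real n ^ k))"

definition logarithmically_bounded :: "(nat \<Rightarrow> nat) \<Rightarrow> bool" where
  "logarithmically_bounded s \<longleftrightarrow> (\<lambda>n. real (s n)) \<in> O(\<lambda>n. ln (real n))"

definition PSPACE :: "bool list set set" where
  "PSPACE = {A. \<exists>M s. tm_wf M \<and> polynomially_bounded s \<and> tm_decides M s A}"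


subsection \<open>Catalytic oracle machines\<close>

text \<open>
  The output and the query tape are write-only and written from left to right, so a
  transition appends at most one bit to either of them, and the tapes are represented by
  the strings written so far. Work symbols and states are coded by numbers as above.
\<close>

record action =
  act_state :: nat
  act_input_move :: move
  act_work_write :: nat
  act_work_move :: move
  act_cat_write :: bool
  act_cat_move :: move
  act_output :: "bool option"
  act_query :: "bool option"

record ctm =
  ctm_states :: nat
  ctm_symbols :: nat
  ctm_start :: nat
  ctm_accept :: nat
  ctm_reject :: nat
  ctm_query :: nat
  ctm_yes :: nat
  ctm_no :: nat
  ctm_delta :: "nat \<Rightarrow> insym \<Rightarrow> nat \<Rightarrow> bool \<Rightarrow> action"

definition ctm_wf :: "ctm \<Rightarrow> bool" where
  "ctm_wf M \<longleftrightarrow>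
     0 < ctm_symbols M \<and>
     {ctm_start M, ctm_accept M, ctm_reject M, ctm_query M, ctm_yes M, ctm_no M}
       \<subseteq> {..<ctm_states M} \<and>
     distinct [ctm_accept M, ctm_reject M, ctm_query M] \<and>
     (\<forall>q a b z. q < ctm_states M \<longrightarrow> b < ctm_symbols M \<longrightarrow>
        act_state (ctm_delta M q a b z) < ctm_states M \<and>
        act_work_write (ctm_delta M q a b z) < ctm_symbols M)"

record ctm_config =
  cc_state :: nat
  cc_input_pos :: nat
  cc_work :: "nat list"
  cc_work_pos :: nat
  cc_cat :: "bool list"
  cc_cat_pos :: nat
  cc_output :: "bool list"
  cc_query :: "bool list"

definition ctm_init :: "ctm \<Rightarrow> nat \<Rightarrow> bool list \<Rightarrow> ctm_config" where
  "ctm_init M s \<tau> =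
     \<lparr>cc_state = ctm_start M, cc_input_pos = 0, cc_work = replicate s 0, cc_work_pos = 0,
      cc_cat = \<tau>, cc_cat_pos = 0, cc_output = [], cc_query = []\<rparr>"

definition append_opt :: "bool list \<Rightarrow> bool option \<Rightarrow> bool list" where
  "append_opt w z = (case z of None \<Rightarrow> w | Some b \<Rightarrow> w @ [b])"

definition ctm_halted :: "ctm \<Rightarrow> ctm_config \<Rightarrow> bool" where
  "ctm_halted M C \<longleftrightarrow> cc_state C \<in> {ctm_accept M, ctm_reject M}"

definition ctm_step :: "bool list set \<Rightarrow> ctm \<Rightarrow> bool list \<Rightarrow> ctm_config \<Rightarrow> ctm_config" where
  "ctm_step A M x C =
     (if ctm_halted M C then C
      else if cc_state C = ctm_query M then
        C\<lparr>cc_state := (if cc_query C \<in> A then ctm_yes M else ctm_no M), cc_query := []\<rparr>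
      else
        let a = ctm_delta M (cc_state C) (read_input x (cc_input_pos C))
                  (cc_work C ! cc_work_pos C) (cc_cat C ! cc_cat_pos C)
        in \<lparr>cc_state = act_state a,
            cc_input_pos = shift_input x (act_input_move a) (cc_input_pos C),
            cc_work = (cc_work C)[cc_work_pos C := act_work_write a],
            cc_work_pos = shift (act_work_move a) (cc_work_pos C),
            cc_cat = (cc_cat C)[cc_cat_pos C := act_cat_write a],
            cc_cat_pos = shift (act_cat_move a) (cc_cat_pos C),
            cc_output = append_opt (cc_output C) (act_output a),
            cc_query = append_opt (cc_query C) (act_query a)\<rparr>)"

text \<open>\<open>None\<close> stands for rejection.\<close>

definition ctm_result :: "ctm \<Rightarrow> ctm_config \<Rightarrow> bool list option" where
  "ctm_result M C = (if cc_state C = ctm_accept M then Some (cc_output C) else None)"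

text \<open>
  A search problem assigns to every input the set of its admissible results; a function
  \<open>f\<close> is the search problem with \<open>{Some (f x)}\<close> as the admissible results for \<open>x\<close>. If
  there are several admissible results, the one produced may depend on \<open>\<tau>\<close>. The work and the catalytic tape have exactly \<open>s (length x)\<close> and \<open>c (length x)\<close> cells. The
  right ends of these tapes are not marked, and the machine must not leave them; so
  neither the value of \<open>s\<close> nor that of \<open>c\<close> can serve as advice.
\<close>

definition ctm_solves ::
  "bool list set \<Rightarrow> ctm \<Rightarrow> (nat \<Rightarrow> nat) \<Rightarrow> (nat \<Rightarrow> nat) \<Rightarrow>
   (bool list \<Rightarrow> bool list option set) \<Rightarrow> bool" where
  "ctm_solves A M s c S \<longleftrightarrow>
     (\<forall>x \<tau>. length \<tau> = c (length x) \<longrightarrow>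
        (let C = (\<lambda>t. (ctm_step A M x ^^ t) (ctm_init M (s (length x)) \<tau>)) in
           (\<forall>t. cc_work_pos (C t) < s (length x) \<and> cc_cat_pos (C t) < c (length x)) \<and>
           (\<exists>t. ctm_halted M (C t) \<and> cc_cat (C t) = \<tau> \<and> ctm_result M (C t) \<in> S x)))"

definition CL_oracle :: "bool list set \<Rightarrow> (bool list \<Rightarrow> bool list option set) set" where
  "CL_oracle A =
     {S. \<exists>M s c. ctm_wf M \<and> logarithmically_bounded s \<and> polynomially_bounded c \<and>
                 ctm_solves A M s c S}"


subsection \<open>Weighted decision and minimum-weight search\<close>

type_synonym witness_relation = "bool list \<Rightarrow> bool list \<Rightarrow> bool"

definition is_polynomial :: "(nat \<Rightarrow> nat) \<Rightarrow> bool" where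
  "is_polynomial m \<longleftrightarrow> (\<exists>p :: real poly. \<forall>n. real (m n) = poly p (real n))"

definition poly_space_computable :: "witness_relation \<Rightarrow> bool" where
  "poly_space_computable R \<longleftrightarrow> {encode [x, y] |x y. R x y} \<in> PSPACE"

definition is_witness :: "(nat \<Rightarrow> nat) \<Rightarrow> witness_relation \<Rightarrow> bool list \<Rightarrow> bool list \<Rightarrow> bool" where
  "is_witness m R x y \<longleftrightarrow> length y = m (length x) \<and> R x y"

text \<open>A weight assignment on \<open>[m]\<close> is a list of length \<open>m\<close>.\<close>

definition weight :: "nat list \<Rightarrow> bool list \<Rightarrow> nat" where
  "weight W y = (\<Sum>i | i < length W \<and> y ! i. W ! i)"

definition weighted_decision :: "(nat \<Rightarrow> nat) \<Rightarrow> witness_relation \<Rightarrow> bool list set" where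
  "weighted_decision m R =
     {encode (x # map binary W @ [binary w\<^sub>0]) |x W w\<^sub>0.
        length W = m (length x) \<and> (\<exists>y. is_witness m R x y \<and> weight W y \<le> w\<^sub>0)}"

text \<open>
  Instances are the pairs \<open>(x, W)\<close> with all weights at most \<open>m ^ c\<close>; on a string that does
  not encode an instance every result is admissible.
\<close>

definition min_weight_search ::
  "bool list set \<Rightarrow> (nat \<Rightarrow> nat) \<Rightarrow> witness_relation \<Rightarrow> nat \<Rightarrow> bool list \<Rightarrow> bool list option set"
where
  "min_weight_search L m R c inp =
     {r. \<forall>x W. inp = encode (x # map binary W) \<and> length W = m (length x) \<and>
               (\<forall>w\<in>set W. w \<le> m (length x) ^ c) \<longrightarrow>
           (if x \<in> L then \<exists>y. r = Some y \<and> is_arg_min (weight W) (is_witness m R x) y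
            else r = None)}"

end

theory Submission
  imports Defs "HOL-Real_Asymp.Real_Asymp"
begin

text \<open>
  Read a block of the catalytic tape as perturbations \<open>r\<^sub>j\<close> and use the query weights
  \<open>W\<^sub>j * 2 ^ p + r\<^sub>j + 1\<close>, whose minimum is found by trying all thresholds. Changing one
  perturbation by one shows whether some minimizer contains, and whether some avoids, the
  coordinate \<open>i\<close>. If no coordinate is ambiguous, the minimizer is unique and its bits can be
  output one by one. If \<open>i\<close> is ambiguous, then \<open>r\<^sub>i\<close> is determined by the other perturbations:
  it is the only value that makes \<open>i\<close> ambiguous. Hence the slot of \<open>r\<^sub>i\<close> can hold the number
  \<open>i\<close> and one free bit, and \<open>r\<^sub>i\<close> can be recovered later with the oracle. If none of \<open>m\<close>
  blocks isolates a minimizer, this frees \<open>m\<close> bits, which suffice for a greedy search: a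
  coordinate that some minimizer avoids is penalised by one, which forces all minimizers to
  avoid it. Weights of a query may exceed the bound on the weights of the instance, and a
  first query validates the input.

  Machines are obtained from counter programs. All values arising in a program built from
  bounded loops are polynomially bounded, so binary counters on the tracks of a logarithmic
  work tape suffice.
\<close>
subsection \<open>Counter programs\<close>

text \<open>The obstacle is memory: a greedy search must remember one decision per coordinate, while
  the work tape has logarithmic size and the output tape cannot be read back. This is why there are
  exactly as many blocks as coordinates. A perturbation can be recovered because the least perturbed
  weight of the witnesses avoiding i does not depend on it, while that of the witnesses containing i
  grows with it at slope one; the two agree for at most one value. A slot has \<open>wid x\<close>
  bits, where \<open>2 ^ (wid x - 1)\<close> exceeds the number of coordinates, so twice an index
  fits and leaves bit 0 free. Taking p twice as large keeps every sum of perturbations below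
  \<open>2 ^ p\<close>, so a perturbed minimizer also minimizes the original weight, while query
  weights stay polynomial and thresholds can be enumerated. The shift by one in the weights allows a
  perturbation to be lowered without leaving the naturals. A query is written bit by bit on a tape
  that asking resets, so whatever it depends on must be computable without the oracle; hence the two
  modes of computability.\<close>

datatype counter_op = Inc nat | Dec nat | InMove move | InIsnt insym | CatMove move | CatGet
  | CatSet bool | Put bool bool | Ask

record cstate =
  regs :: "nat \<Rightarrow> nat"
  ipos :: nat
  cat :: "bool list"
  cpos :: nat
  outp :: "bool list"
  qry :: "bool list"

text \<open>Each operation also yields a truth value, so one kind of instruction serves as action,
  branch and loop test. \<open>Dec\<close> fails on zero without changing anything, and
  \<open>InIsnt a\<close> holds away from \<open>a\<close>, so a loop over it scans the input up to
  \<open>a\<close>.\<close>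

fun op_sem :: "bool list set \<Rightarrow> bool list \<Rightarrow> counter_op \<Rightarrow> cstate \<Rightarrow> cstate \<times> bool" where
  "op_sem A x (Inc r) \<sigma> = (\<sigma>\<lparr>regs := (regs \<sigma>)(r := Suc (regs \<sigma> r))\<rparr>, True)"
| "op_sem A x (Dec r) \<sigma> =
     (if regs \<sigma> r = 0 then (\<sigma>, False) else (\<sigma>\<lparr>regs := (regs \<sigma>)(r := regs \<sigma> r - 1)\<rparr>, True))"
| "op_sem A x (InMove d) \<sigma> = (\<sigma>\<lparr>ipos := shift_input x d (ipos \<sigma>)\<rparr>, True)"
| "op_sem A x (InIsnt a) \<sigma> = (\<sigma>, read_input x (ipos \<sigma>) \<noteq> a)"
| "op_sem A x (CatMove d) \<sigma> = (\<sigma>\<lparr>cpos := shift d (cpos \<sigma>)\<rparr>, True)"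
| "op_sem A x CatGet \<sigma> = (\<sigma>, cat \<sigma> ! cpos \<sigma>)"
| "op_sem A x (CatSet b) \<sigma> = (\<sigma>\<lparr>cat := (cat \<sigma>)[cpos \<sigma> := b]\<rparr>, True)"
| "op_sem A x (Put t b) \<sigma> =
     (if t then \<sigma>\<lparr>outp := outp \<sigma> @ [b]\<rparr> else \<sigma>\<lparr>qry := qry \<sigma> @ [b]\<rparr>, True)"
| "op_sem A x Ask \<sigma> = (\<sigma>\<lparr>qry := []\<rparr>, qry \<sigma> \<in> A)"

definition inbounds :: "nat \<Rightarrow> cstate \<Rightarrow> bool" where
  "inbounds B \<sigma> \<longleftrightarrow> (\<forall>r. regs \<sigma> r < B) \<and> cpos \<sigma> < length (cat \<sigma>)"

datatype code = Do counter_op | Seq code code (infixr ";;" 60) | Cond counter_op code code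
  | Loop counter_op code

text \<open>\<open>inbounds\<close> is demanded after every single operation and not only at the
  end: the right ends of the tapes carry no marks, so a derivation must itself certify that no
  counter overflows and that the catalytic head never leaves its tape.\<close>

inductive bigstep :: "bool list set \<Rightarrow> bool list \<Rightarrow> nat \<Rightarrow> code \<Rightarrow> cstate \<Rightarrow> cstate \<Rightarrow> bool"
  for A x B where
  Do: "op_sem A x a \<sigma> = (\<sigma>', b) \<Longrightarrow> inbounds B \<sigma>' \<Longrightarrow> bigstep A x B (Do a) \<sigma> \<sigma>'"
| Seq: "bigstep A x B c \<sigma> \<sigma>' \<Longrightarrow> bigstep A x B c' \<sigma>' \<sigma>'' \<Longrightarrow> bigstep A x B (c ;; c') \<sigma> \<sigma>''"
| Cond: "op_sem A x a \<sigma> = (\<sigma>', b) \<Longrightarrow> inbounds B \<sigma>' \<Longrightarrow>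
    bigstep A x B (if b then c else c') \<sigma>' \<sigma>'' \<Longrightarrow> bigstep A x B (Cond a c c') \<sigma> \<sigma>''"
| Loop_end: "op_sem A x a \<sigma> = (\<sigma>', False) \<Longrightarrow> inbounds B \<sigma>' \<Longrightarrow> bigstep A x B (Loop a c) \<sigma> \<sigma>'"
| Loop_step: "op_sem A x a \<sigma> = (\<sigma>', True) \<Longrightarrow> inbounds B \<sigma>' \<Longrightarrow> bigstep A x B c \<sigma>' \<sigma>'' \<Longrightarrow>
    bigstep A x B (Loop a c) \<sigma>'' \<sigma>''' \<Longrightarrow> bigstep A x B (Loop a c) \<sigma> \<sigma>'''"

subsection \<open>Flat code\<close>

type_synonym flat_code = "(counter_op \<times> nat \<times> nat) list"

fun code_size :: "code \<Rightarrow> nat" where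
  "code_size (Do a) = 1"
| "code_size (c ;; c') = code_size c + code_size c'"
| "code_size (Cond a c c') = 1 + code_size c + code_size c'"
| "code_size (Loop a c) = 1 + code_size c"

text \<open>The code starts at address \<open>p\<close> and control goes to \<open>q\<close> when it
  is done; each instruction carries absolute targets for the outcomes true and false. A loop body
  gets the address of its own test as continuation.\<close>

fun flatten :: "code \<Rightarrow> nat \<Rightarrow> nat \<Rightarrow> flat_code" where
  "flatten (Do a) p q = [(a, q, q)]"
| "flatten (c ;; c') p q = flatten c p (p + code_size c) @ flatten c' (p + code_size c) q"
| "flatten (Cond a c c') p q =
     (a, p + 1, p + 1 + code_size c) # flatten c (p + 1) q @ flatten c' (p + 1 + code_size c) q"
| "flatten (Loop a c) p q = (a, p + 1, q) # flatten c (p + 1) p"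

lemma length_flatten [simp]: "length (flatten c p q) = code_size c"
  by (induction c arbitrary: p q) auto

lemma flatten_targets:
  "i \<in> set (flatten c p q) \<Longrightarrow> q \<le> N \<Longrightarrow> p + code_size c \<le> N \<Longrightarrow>
    fst (snd i) \<le> N \<and> snd (snd i) \<le> N"
proof (induction c arbitrary: p q)
  case (Seq c c')
  then show ?case by (auto dest!: Seq.IH)
next
  case (Cond a c c')
  then show ?case by (auto dest!: Cond.IH)
next
  case (Loop a c)
  then show ?case by (auto dest!: Loop.IH)
qed auto

inductive flat_run ::
  "bool list set \<Rightarrow> bool list \<Rightarrow> nat \<Rightarrow> flat_code \<Rightarrow> nat \<Rightarrow> cstate \<Rightarrow> nat \<Rightarrow> cstate \<Rightarrow> bool"
  for A x B P where
  flat_refl: "flat_run A x B P p \<sigma> p \<sigma>"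
| flat_step: "p < length P \<Longrightarrow> P ! p = (a, t, t') \<Longrightarrow> op_sem A x a \<sigma> = (\<sigma>', b) \<Longrightarrow> inbounds B \<sigma>' \<Longrightarrow>
    flat_run A x B P (if b then t else t') \<sigma>' q \<sigma>'' \<Longrightarrow> flat_run A x B P p \<sigma> q \<sigma>''"

lemma flat_run_trans:
  "flat_run A x B P p \<sigma> q \<sigma>' \<Longrightarrow> flat_run A x B P q \<sigma>' r \<sigma>'' \<Longrightarrow> flat_run A x B P p \<sigma> r \<sigma>''"
  by (induction rule: flat_run.induct) (auto intro: flat_run.flat_step)

definition located :: "flat_code \<Rightarrow> nat \<Rightarrow> flat_code \<Rightarrow> bool" where
  "located P p cs \<longleftrightarrow> (\<exists>ys zs. P = ys @ cs @ zs \<and> length ys = p)"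

lemma located_append:
  assumes "located P p (cs @ ds)"
  shows "located P p cs" and "located P (p + length cs) ds"
proof -
  obtain ys zs where "P = ys @ (cs @ ds) @ zs" and "length ys = p"
    using assms by (auto simp: located_def)
  then have "P = ys @ cs @ (ds @ zs)" "P = (ys @ cs) @ ds @ zs" "length (ys @ cs) = p + length cs"
    by simp_all
  with \<open>length ys = p\<close> show "located P p cs" "located P (p + length cs) ds"
    unfolding located_def by blast+
qed

lemma located_Cons:
  assumes "located P p (i # cs)"
  shows "p < length P" and "P ! p = i" and "located P (p + 1) cs"
proof -
  obtain ys zs where "P = ys @ (i # cs) @ zs" and "length ys = p"
    using assms by (auto simp: located_def)
  then show "p < length P" "P ! p = i" by auto
  show "located P (p + 1) cs"
    using located_append(2) [of P p "[i]" cs] assms by simp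
qed

lemma flat_run_flatten:
  assumes "bigstep A x B c \<sigma> \<sigma>'" and "located P p (flatten c p q)"
  shows "flat_run A x B P p \<sigma> q \<sigma>'"
  using assms
proof (induction arbitrary: p q rule: bigstep.induct)
  case (Do a \<sigma> \<sigma>' b)
  then show ?case
    using located_Cons [OF Do.prems [unfolded flatten.simps]]
    by (intro flat_run.flat_step [of p P a q q A x \<sigma> \<sigma>' b]) (auto intro: flat_run.flat_refl)
next
  case (Seq c \<sigma> \<sigma>' c' \<sigma>'')
  have "located P p (flatten c p (p + code_size c))"
    "located P (p + code_size c) (flatten c' (p + code_size c) q)"
    using located_append [of P p "flatten c p (p + code_size c)"] Seq.prems by simp_all
  then show ?case using Seq.IH flat_run_trans by blast
next
  case (Cond a \<sigma> \<sigma>' b c c' \<sigma>'')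
  have l: "p < length P" "P ! p = (a, p + 1, p + 1 + code_size c)"
    "located P (p + 1) (flatten c (p + 1) q)"
    "located P (p + 1 + code_size c) (flatten c' (p + 1 + code_size c) q)"
    using located_Cons [OF Cond.prems [unfolded flatten.simps]]
      located_append [of P "p + 1" "flatten c (p + 1) q"] by simp_all
  have "flat_run A x B P (if b then p + 1 else p + 1 + code_size c) \<sigma>' q \<sigma>''"
    using Cond.IH l by (cases b) auto
  then show ?case by (intro flat_run.flat_step [OF l(1,2) Cond.hyps(1,2)])
next
  case (Loop_end a \<sigma> \<sigma>' c)
  then show ?case
    using located_Cons [OF Loop_end.prems [unfolded flatten.simps]]
    by (intro flat_run.flat_step [of p P a "p + 1" q A x \<sigma> \<sigma>' False]) (auto intro: flat_run.flat_refl)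
next
  case (Loop_step a \<sigma> \<sigma>' c \<sigma>'' \<sigma>''')
  have l: "p < length P" "P ! p = (a, p + 1, q)" "located P (p + 1) (flatten c (p + 1) p)"
    using located_Cons [OF Loop_step.prems [unfolded flatten.simps]] by simp_all
  \<comment> \<open>The body runs up to its continuation \<open>p\<close>, which is the loop test
    again, so the two induction hypotheses chain there.\<close>
  have "flat_run A x B P (p + 1) \<sigma>' q \<sigma>'''"
    using Loop_step.IH(1) [OF l(3)] Loop_step.IH(2) [OF Loop_step.prems] by (rule flat_run_trans)
  then show ?case using l Loop_step.hyps 
    by (intro flat_run.flat_step [of p P a "p + 1" q A x \<sigma> \<sigma>' True]) auto
qed

subsection \<open>Binary counters\<close>

abbreviation bval :: "bool list \<Rightarrow> nat" where
  "bval \<equiv> horner_sum of_bool 2"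

fun bsucc :: "bool list \<Rightarrow> bool list" where
  "bsucc [] = [True]"
| "bsucc (False # ds) = True # ds"
| "bsucc (True # ds) = False # bsucc ds"

fun bpred :: "bool list \<Rightarrow> bool list" where
  "bpred [] = []"
| "bpred (True # ds) = False # ds"
| "bpred (False # ds) = True # bpred ds"

lemma bval_bsucc: "bval (bsucc ds) = Suc (bval ds)"
  by (induction ds rule: bsucc.induct) auto

lemma bval_bpred: "0 < bval ds \<Longrightarrow> bval (bpred ds) = bval ds - 1"
  by (induction ds rule: bpred.induct) auto

lemma length_bpred: "length (bpred ds) = length ds"
  by (induction ds rule: bpred.induct) auto

text \<open>A digit is appended only if all digits are ones. Then the value plus one equals 2 to the
  old length, and the bound on it forces that length below \<open>d\<close>.\<close>

lemma length_bsucc: "length ds \<le> d \<Longrightarrow> Suc (bval ds) < 2 ^ d \<Longrightarrow> length (bsucc ds) \<le> d"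
proof (induction ds arbitrary: d rule: bsucc.induct)
  case 1
  then show ?case by (cases d) auto
next
  case (3 ds)
  then obtain d' where "d = Suc d'" by (cases d) auto
  with 3 show ?case by auto
qed auto

lemma bval_eq_0: "bval ds = 0 \<Longrightarrow> ds = replicate (length ds) False"
  by (induction ds) auto

lemma replicate_update_last: "(replicate (Suc k) a @ ys)[k := b] = replicate k a @ b # ys"
  by (induction k) auto

subsection \<open>Simulation by a catalytic machine\<close>

text \<open>
  Work tape symbols are functions: component \<open>Suc r\<close> is the digit of counter \<open>r\<close> (\<open>0\<close> for
  blank, \<open>1\<close> and \<open>2\<close> for the binary digits), component \<open>0\<close> is nonzero on the leftmost cell
  only. There it also holds, shifted by \<open>2\<close>, the address of a pending query, since the
  machine has a single query state. A counter never gives cells back, so a zero counter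
  consists of zero digits.
\<close>

definition digit :: "bool list \<Rightarrow> nat \<Rightarrow> nat" where
  "digit ds i = (if i < length ds then if ds ! i then 2 else 1 else 0)"

definition cell :: "nat \<Rightarrow> (nat \<Rightarrow> bool list) \<Rightarrow> nat \<Rightarrow> nat \<Rightarrow> nat" where
  "cell f T i k = (case k of 0 \<Rightarrow> if i = 0 then f else 0 | Suc r \<Rightarrow> digit (T r) i)"

text \<open>The cap \<open>N + 3\<close> covers the digits up to 2 as well as a saved address
  \<open>p + 2\<close> with \<open>p < N\<close>. Vanishing above \<open>R\<close> makes the set
  finite.\<close>

definition symbols :: "nat \<Rightarrow> nat \<Rightarrow> (nat \<Rightarrow> nat) set" where
  "symbols N R = {g. \<forall>k. (k \<in> {..R} \<longrightarrow> g k \<in> {..N + 3}) \<and> (k \<notin> {..R} \<longrightarrow> g k = 0)}"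

lemma finite_symbols: "finite (symbols N R)"
  unfolding symbols_def by (rule finite_set_of_finite_funs) auto

lemma ex_encoding:
  assumes "finite S" and "z \<in> S"
  shows "\<exists>h. inj_on h S \<and> h z = (0::nat) \<and> h ` S \<subseteq> {..<card S}"
proof -
  obtain h0 where h0: "bij_betw h0 S {0..<card S}"
    using ex_bij_betw_finite_nat [OF assms(1)] by blast
  \<comment> \<open>The blank must be coded by 0, so the codes of \<open>z\<close> and of the
    element numbered 0 are exchanged.\<close>
  define h where "h = (\<lambda>g. if g = z then 0 else if h0 g = 0 then h0 z else h0 g)"
  have inj: "h0 g = h0 g' \<longleftrightarrow> g = g'" if "g \<in> S" "g' \<in> S" for g g'
    using h0 that by (auto simp: bij_betw_def inj_on_def)
  have lt: "h0 g < card S" if "g \<in> S" for g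
    using h0 that by (auto simp: bij_betw_def)
  have "inj_on h S"
    unfolding inj_on_def h_def using inj assms(2) by (auto split: if_splits) metis+
  moreover have "h ` S \<subseteq> {..<card S}"
    using lt assms(2) by (auto simp: h_def intro: gr_implies_not_zero dest: lt)
  moreover have "h z = 0" by (simp add: h_def)
  ultimately show ?thesis by blast
qed

definition go :: "((nat \<Rightarrow> nat) \<Rightarrow> nat) \<Rightarrow> (nat \<Rightarrow> nat) \<Rightarrow> bool \<Rightarrow> nat \<Rightarrow> action" where
  "go enc g z q =
     \<lparr>act_state = q, act_input_move = Stay, act_work_write = enc g, act_work_move = Stay,
      act_cat_write = z, act_cat_move = Stay, act_output = None, act_query = None\<rparr>"

text \<open>State \<open>4 * p + ph\<close> executes the instruction at address \<open>p\<close> in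
  phase \<open>ph\<close>. Phase 0 walks right along the carry or borrow, and phase 1 returns to the
  marked cell after success. A borrow that reaches a blank shows that the counter was zero; phase 2
  then returns while resetting the digits, all of which phase 0 had turned to ones.\<close>

fun op_action ::
  "((nat \<Rightarrow> nat) \<Rightarrow> nat) \<Rightarrow> nat \<Rightarrow> nat \<Rightarrow> nat \<Rightarrow> nat \<Rightarrow> nat \<Rightarrow> insym \<Rightarrow> (nat \<Rightarrow> nat) \<Rightarrow> bool \<Rightarrow>
   counter_op \<Rightarrow> action" where
  "op_action enc N p ph t t' a g z (Inc r) =
     (if ph = 0 then
        if g (Suc r) = 2 then (go enc (g(Suc r := 1)) z (4 * p))\<lparr>act_work_move := MoveR\<rparr>
        else go enc (g(Suc r := 2)) z (4 * p + 1)
      else if g 0 = 0 then (go enc g z (4 * p + 1))\<lparr>act_work_move := MoveL\<rparr>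
      else go enc g z (4 * t))"
| "op_action enc N p ph t t' a g z (Dec r) =
     (if ph = 0 then
        if g (Suc r) = 2 then go enc (g(Suc r := 1)) z (4 * p + 1)
        else if g (Suc r) = 1 then (go enc (g(Suc r := 2)) z (4 * p))\<lparr>act_work_move := MoveR\<rparr>
        else if g 0 = 0 then (go enc g z (4 * p + 2))\<lparr>act_work_move := MoveL\<rparr>
        else go enc g z (4 * t')
      else if ph = 1 then
        if g 0 = 0 then (go enc g z (4 * p + 1))\<lparr>act_work_move := MoveL\<rparr>
        else go enc g z (4 * t)
      else
        if g 0 = 0 then (go enc (g(Suc r := 1)) z (4 * p + 2))\<lparr>act_work_move := MoveL\<rparr>
        else go enc (g(Suc r := 1)) z (4 * t'))"
| "op_action enc N p ph t t' a g z (InMove d) = (go enc g z (4 * t))\<lparr>act_input_move := d\<rparr>"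
| "op_action enc N p ph t t' a g z (InIsnt a') = go enc g z (4 * (if a \<noteq> a' then t else t'))"
| "op_action enc N p ph t t' a g z (CatMove d) = (go enc g z (4 * t))\<lparr>act_cat_move := d\<rparr>"
| "op_action enc N p ph t t' a g z CatGet = go enc g z (4 * (if z then t else t'))"
| "op_action enc N p ph t t' a g z (CatSet b) = go enc g b (4 * t)"
| "op_action enc N p ph t t' a g z (Put u b) =
     (if u then (go enc g z (4 * t))\<lparr>act_output := Some b\<rparr>
      else (go enc g z (4 * t))\<lparr>act_query := Some b\<rparr>)"
| "op_action enc N p ph t t' a g z Ask = go enc (g(0 := p + 2)) z (4 * N + 1)"

text \<open>With N the code length, state \<open>4 * N + 5\<close> writes the left mark at the
  start. States \<open>4 * N + 2\<close> and \<open>4 * N + 3\<close> receive the answer to a query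
  and jump to a target of the instruction whose address was saved in component 0. The exit addresses
  N and N + 1 become the states \<open>4 * N\<close> and \<open>4 * N + 4\<close>, which
  \<open>machine\<close> declares accepting and rejecting.\<close>

definition raw_action ::
  "((nat \<Rightarrow> nat) \<Rightarrow> nat) \<Rightarrow> flat_code \<Rightarrow> nat \<Rightarrow> insym \<Rightarrow> (nat \<Rightarrow> nat) \<Rightarrow> bool \<Rightarrow> action" where
  "raw_action enc P q a g z =
     (if q = 4 * length P + 5 then go enc (g(0 := 1)) z 0
      else if q = 4 * length P + 2 then go enc (g(0 := 1)) z (4 * fst (snd (P ! (g 0 - 2))))
      else if q = 4 * length P + 3 then go enc (g(0 := 1)) z (4 * snd (snd (P ! (g 0 - 2))))
      else case P ! (q div 4) of (c, t, t') \<Rightarrow>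
        op_action enc (length P) (q div 4) (q mod 4) t t' a g z c)"

text \<open>The case distinction makes the machine well-formed whatever the code is.\<close>

definition machine :: "((nat \<Rightarrow> nat) \<Rightarrow> nat) \<Rightarrow> (nat \<Rightarrow> nat) set \<Rightarrow> flat_code \<Rightarrow> ctm" where
  "machine enc S P =
     \<lparr>ctm_states = 4 * length P + 8, ctm_symbols = card S, ctm_start = 4 * length P + 5,
      ctm_accept = 4 * length P, ctm_reject = 4 * length P + 4, ctm_query = 4 * length P + 1,
      ctm_yes = 4 * length P + 2, ctm_no = 4 * length P + 3,
      ctm_delta = (\<lambda>q a b z. let u = raw_action enc P q a (inv_into S enc b) z in
        if act_state u < 4 * length P + 8 \<and> act_work_write u < card S then u
        else u\<lparr>act_state := 0, act_work_write := 0\<rparr>)\<rparr>"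

lemma machine_wf: "0 < card S \<Longrightarrow> ctm_wf (machine enc S P)"
  by (auto simp: ctm_wf_def machine_def Let_def)

text \<open>Targets may go up to \<open>Suc (length P)\<close> because the two addresses behind the
  code are the accepting and the rejecting exit. Counters will have at most \<open>d\<close> digits;
  the work tape is longer, since the end of a counter is recognised by reading a blank.\<close>

locale simulation =
  fixes A :: "bool list set" and x :: "bool list" and P :: flat_code and R s d cl :: nat
    and enc :: "(nat \<Rightarrow> nat) \<Rightarrow> nat" and S :: "(nat \<Rightarrow> nat) set"
  assumes S_eq: "S = symbols (length P) R"
    and enc_inj: "inj_on enc S"
    and enc_lt: "\<And>g. g \<in> S \<Longrightarrow> enc g < card S"
    and enc_zero: "enc (\<lambda>_. 0) = 0"
    and counters: "\<And>p r. p < length P \<Longrightarrow> fst (P ! p) \<in> {Inc r, Dec r} \<Longrightarrow> r < R"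
    and targets: "\<And>p. p < length P \<Longrightarrow>
      fst (snd (P ! p)) \<le> Suc (length P) \<and> snd (snd (P ! p)) \<le> Suc (length P)"
    and s_eq: "s = d + 2"
begin

abbreviation "N \<equiv> length P"
abbreviation "M \<equiv> machine enc S P"
abbreviation "step \<equiv> ctm_step A M x"

section \<open>Tape contents and machine configurations\<close>

definition tape :: "nat \<Rightarrow> (nat \<Rightarrow> bool list) \<Rightarrow> nat list" where
  "tape f T = map (\<lambda>i. enc (cell f T i)) [0..<s]"

definition conf :: "nat \<Rightarrow> nat \<Rightarrow> (nat \<Rightarrow> bool list) \<Rightarrow> nat \<Rightarrow> cstate \<Rightarrow> ctm_config" where
  "conf q i T f \<sigma> =
     \<lparr>cc_state = q, cc_input_pos = ipos \<sigma>, cc_work = tape f T, cc_work_pos = i,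
      cc_cat = cat \<sigma>, cc_cat_pos = cpos \<sigma>, cc_output = outp \<sigma>, cc_query = qry \<sigma>\<rparr>"

definition safe :: "ctm_config \<Rightarrow> bool" where
  "safe C \<longleftrightarrow> cc_work_pos C < s \<and> cc_cat_pos C < cl"

text \<open>Safety is recorded at every configuration, the last one included, because
  \<open>ctm_solves\<close> restricts the heads at all times.\<close>

inductive run :: "ctm_config \<Rightarrow> ctm_config \<Rightarrow> bool" where
  run_refl: "safe C \<Longrightarrow> run C C"
| run_step: "safe C \<Longrightarrow> run (step C) C' \<Longrightarrow> run C C'"

lemma run_trans: "run C C' \<Longrightarrow> run C' C'' \<Longrightarrow> run C C''"
  by (induction rule: run.induct) (auto intro: run_step)

lemma run_iterate: "run C C' \<Longrightarrow> \<exists>n. (step ^^ n) C = C' \<and> (\<forall>u\<le>n. safe ((step ^^ u) C))"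
proof (induction rule: run.induct)
  case (run_refl C)
  then show ?case by (intro exI [of _ 0]) auto
next
  case (run_step C C')
  then obtain n where n: "(step ^^ n) (step C) = C'" "\<forall>u\<le>n. safe ((step ^^ u) (step C))"
    by blast
  have "safe ((step ^^ u) C)" if "u \<le> Suc n" for u
    using that run_step.hyps n(2) by (cases u) (auto simp: funpow_Suc_right simp del: funpow.simps)
  with n(1) show ?case by (intro exI [of _ "Suc n"]) (auto simp: funpow_Suc_right simp del: funpow.simps)
qed

text \<open>Tracks beyond \<open>R\<close> must stay blank; otherwise a cell could leave the finite
  set \<open>S\<close> of encodable symbols.\<close>

definition fits :: "(nat \<Rightarrow> bool list) \<Rightarrow> bool" where
  "fits T \<longleftrightarrow> (\<forall>r. R \<le> r \<longrightarrow> T r = [])"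

lemma fits_update: "fits T \<Longrightarrow> r < R \<Longrightarrow> fits (T(r := ds))"
  by (simp add: fits_def)

lemma cell_in: "f \<le> N + 3 \<Longrightarrow> fits T \<Longrightarrow> cell f T i \<in> S"
  by (auto simp: fits_def S_eq symbols_def cell_def digit_def split: nat.split)

lemma upd_in: "g \<in> S \<Longrightarrow> k \<le> R \<Longrightarrow> v \<le> N + 3 \<Longrightarrow> g(k := v) \<in> S"
  by (auto simp: S_eq symbols_def)

lemma cell_0: "cell f T i 0 = (if i = 0 then f else 0)"
  by (simp add: cell_def)

lemma cell_Suc: "cell f T i (Suc r) = digit (T r) i"
  by (simp add: cell_def)

lemma tape_same: "(tape f T)[i := enc (cell f T i)] = tape f T"
  by (cases "i < s") (auto simp: tape_def list_update_same_conv list_update_beyond)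

lemma tape_mark: "(tape f T)[0 := enc ((cell f T 0)(0 := f'))] = tape f' T"
proof -
  have "(cell f T 0)(0 := f') = cell f' T 0"
    by (auto simp: cell_def split: nat.split)
  moreover have "cell f T i = cell f' T i" if "i \<noteq> 0" for i
    using that by (intro ext) (auto simp: cell_def split: nat.split)
  ultimately show ?thesis
    unfolding tape_def by (cases "0 < s") (auto simp: nth_list_update intro!: nth_equalityI)
qed

lemma tape_digit:
  assumes "\<And>j. j \<noteq> i \<Longrightarrow> digit ds j = digit (T r) j"
  shows "(tape f T)[i := enc ((cell f T i)(Suc r := digit ds i))] = tape f (T(r := ds))"
proof -
  have "(cell f T i)(Suc r := digit ds i) = cell f (T(r := ds)) i"
    by (auto simp: cell_def split: nat.split)
  moreover have "cell f T j = cell f (T(r := ds)) j" if "j \<noteq> i" for j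
    using assms [OF that] by (intro ext) (auto simp: cell_def split: nat.split)
  ultimately show ?thesis
    by (cases "i < s") (auto simp: tape_def nth_list_update list_update_beyond intro!: nth_equalityI)
qed

lemma tape_update:
  "i < length (T r) \<Longrightarrow>
     (tape f T)[i := enc ((cell f T i)(Suc r := Suc (of_bool b)))] = tape f (T(r := (T r)[i := b]))"
  using tape_digit [of i "(T r)[i := b]" T r f] by (cases b) (auto simp: digit_def numeral_2_eq_2)

lemma tape_extend:
  "(tape f T)[length (T r) := enc ((cell f T (length (T r)))(Suc r := Suc (of_bool b)))] =
     tape f (T(r := T r @ [b]))"
  using tape_digit [of "length (T r)" "T r @ [b]" T r f]
  by (cases b) (auto simp: digit_def nth_append numeral_2_eq_2)

text \<open>The last two hypotheses exclude the fallback branch of \<open>machine\<close>; the three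
  conditions on \<open>q\<close> exclude the halting states and the query state, where the
  transition table is not consulted.\<close>

lemma step_conf:
  assumes "i < s" "f \<le> N + 3" "fits T"
    and "q \<noteq> 4 * N" "q \<noteq> 4 * N + 4" "q \<noteq> 4 * N + 1"
    and "raw_action enc P q (read_input x (ipos \<sigma>)) (cell f T i) (cat \<sigma> ! cpos \<sigma>) = u"
    and "act_state u < 4 * N + 8" "act_work_write u < card S"
  shows "step (conf q i T f \<sigma>) =
    \<lparr>cc_state = act_state u, cc_input_pos = shift_input x (act_input_move u) (ipos \<sigma>),
     cc_work = (tape f T)[i := act_work_write u], cc_work_pos = shift (act_work_move u) i,
     cc_cat = (cat \<sigma>)[cpos \<sigma> := act_cat_write u], cc_cat_pos = shift (act_cat_move u) (cpos \<sigma>),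
     cc_output = append_opt (outp \<sigma>) (act_output u), cc_query = append_opt (qry \<sigma>) (act_query u)\<rparr>"
proof -
  have "inv_into S enc (tape f T ! i) = cell f T i"
    using assms(1) cell_in [OF assms(2,3)] enc_inj by (simp add: tape_def)
  then have "ctm_delta M q (read_input x (ipos \<sigma>)) (tape f T ! i) (cat \<sigma> ! cpos \<sigma>) = u"
    using assms(7-9) by (simp add: machine_def Let_def)
  then show ?thesis
    using assms(4-6) by (simp add: ctm_step_def ctm_halted_def conf_def machine_def Let_def)
qed

lemma shift_input_Stay: "ipos \<sigma> \<le> Suc (length x) \<Longrightarrow> shift_input x Stay (ipos \<sigma>) = ipos \<sigma>"
  by (simp add: shift_input_def)

definition represents :: "(nat \<Rightarrow> bool list) \<Rightarrow> cstate \<Rightarrow> bool" where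
  "represents T \<sigma> \<longleftrightarrow> fits T \<and> (\<forall>r. length (T r) \<le> d \<and> (r < R \<longrightarrow> bval (T r) = regs \<sigma> r)) \<and>
     ipos \<sigma> \<le> Suc (length x) \<and> length (cat \<sigma>) = cl \<and> cpos \<sigma> < cl"

lemma safe_conf: "i < s \<Longrightarrow> cpos \<sigma> < cl \<Longrightarrow> safe (conf q i T f \<sigma>)"
  by (simp add: safe_def conf_def)

section \<open>Increment and decrement on the binary tracks\<close>

context
  fixes p t t' r :: nat and \<sigma> :: cstate
  assumes p: "p < N" and r: "r < R"
    and inv: "ipos \<sigma> \<le> Suc (length x)" "cpos \<sigma> < cl"
    and t: "t \<le> Suc N" "t' \<le> Suc N"
begin

lemma raw_phase:
  assumes "ph < 4"
  shows "raw_action enc P (4 * p + ph) a g z =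
    op_action enc N p ph (fst (snd (P ! p))) (snd (snd (P ! p))) a g z (fst (P ! p))"
proof -
  have "(4 * p + ph) div 4 = p" "(4 * p + ph) mod 4 = ph" using assms by auto
  then show ?thesis using p assms by (auto simp: raw_action_def split: prod.split)
qed

lemma work_step:
  assumes "P ! p = (c, t, t')" "ph < 4" "i < s" "fits T"
    and "\<And>a z. op_action enc N p ph t t' a (cell 1 T i) z c = (go enc g z q)\<lparr>act_work_move := mv\<rparr>"
    and "g \<in> S" "q < 4 * N + 8" "(tape 1 T)[i := enc g] = tape 1 T'"
    and "run (conf q (shift mv i) T' 1 \<sigma>) C"
  shows "run (conf (4 * p + ph) i T 1 \<sigma>) C"
proof (rule run_step)
  show "safe (conf (4 * p + ph) i T 1 \<sigma>)" using assms inv by (intro safe_conf)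
  have "step (conf (4 * p + ph) i T 1 \<sigma>) = conf q (shift mv i) T' 1 \<sigma>"
    by (subst step_conf [OF assms(3) _ assms(4) _ _ _ raw_phase [OF assms(2)]])
       (use p assms enc_lt inv in \<open>auto simp: go_def conf_def shift_input_Stay append_opt_def\<close>)
  with assms(9) show "run (step (conf (4 * p + ph) i T 1 \<sigma>)) C" by simp
qed

lemmas work_step_0 = work_step [where ph = 0, unfolded add_0_right]

lemma return_left:
  assumes "P ! p = (c, t, t')" "c \<in> {Inc r, Dec r}" "i < s" "fits T"
  shows "run (conf (4 * p + 1) i T 1 \<sigma>) (conf (4 * t) 0 T 1 \<sigma>)"
  using assms(3)
proof (induction i)
  case 0
  show ?case
    by (rule work_step [OF assms(1) _ 0 assms(4), where g = "cell 1 T 0" and mv = Stay and q = "4 * t" and T' = T])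
       (use assms(2) 0 t cell_in [OF _ assms(4)] inv in
         \<open>auto simp: cell_0 tape_same go_def intro!: run_refl safe_conf\<close>)
next
  case (Suc i)
  show ?case
    by (rule work_step [OF assms(1) _ Suc.prems assms(4), where g = "cell 1 T (Suc i)" and mv = MoveL and q = "4 * p + 1" and T' = T])
       (use Suc assms(2) p cell_in [OF _ assms(4)] in \<open>auto simp: cell_0 tape_same go_def\<close>)
qed

text \<open>The assumption on \<open>T r\<close> describes the repair halfway: the digits up to the
  head are still ones from the failed borrow, and the \<open>l\<close> digits to the right of it are
  zeros again.\<close>

lemma return_left_zero:
  assumes "P ! p = (Dec r, t, t')" "i < s" "fits T"
    and "T r = replicate (Suc i) True @ replicate l False"
  shows "run (conf (4 * p + 2) i T 1 \<sigma>) (conf (4 * t') 0 (T(r := replicate (Suc i + l) False)) 1 \<sigma>)"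
  using assms(2-)
proof (induction i arbitrary: T l)
  case 0
  have T': "T(r := replicate (Suc 0 + l) False) = T(r := (T r)[0 := False])"
    using 0 by simp
  have "run (conf (4 * p + 2) 0 T 1 \<sigma>) (conf (4 * t') 0 (T(r := replicate (Suc 0 + l) False)) 1 \<sigma>)" unfolding T'
    by (rule work_step [OF assms(1) _ 0(1,2), where g = "(cell 1 T 0)(Suc r := 1)" and mv = Stay and q = "4 * t'"
          and T' = "T(r := (T r)[0 := False])"])
       (use 0 t r cell_in [OF _ 0(2)] inv tape_update [of 0 T r 1 False] in
         \<open>auto simp: cell_0 go_def intro!: upd_in fits_update run_refl safe_conf\<close>)
  then show ?case .
next
  case (Suc i)
  define T' where "T' = T(r := (T r)[Suc i := False])"
  have Tr: "T' r = replicate (Suc i) True @ replicate (Suc l) False"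
    using replicate_update_last [of "Suc i" True "replicate l False" False] Suc.prems(3)
    by (simp add: T'_def)
  have IH: "run (conf (4 * p + 2) i T' 1 \<sigma>) (conf (4 * t') 0 (T'(r := replicate (Suc i + Suc l) False)) 1 \<sigma>)"
    by (rule Suc.IH [of T' "Suc l", OF _ _ Tr]) (use Suc.prems r in \<open>simp_all add: T'_def fits_def\<close>)
  then have IH: "run (conf (4 * p + 2) i T' 1 \<sigma>) (conf (4 * t') 0 (T(r := replicate (Suc (Suc i) + l) False)) 1 \<sigma>)"
    by (simp add: T'_def)
  have "run (conf (4 * p + 2) (Suc i) T 1 \<sigma>) (conf (4 * t') 0 (T(r := replicate (Suc (Suc i) + l) False)) 1 \<sigma>)"
    by (rule work_step [OF assms(1) _ Suc.prems(1,2), where g = "(cell 1 T (Suc i))(Suc r := 1)" and mv = MoveL and q = "4 * p + 2" and T' = T'])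
       (use Suc.prems p r IH cell_in [OF _ Suc.prems(2)] tape_update [of "Suc i" T r 1 False] in
         \<open>auto simp: cell_0 go_def T'_def intro!: upd_in fits_update\<close>)
  then show ?case .
qed

text \<open>The carry has passed \<open>pre\<close> and the head stands behind it. The recursion of
  \<open>bsucc\<close> is the movement of the head; its base case writes a new digit into the blank
  cell behind the counter, which exists by the length assumption.\<close>

lemma run_Inc:
  assumes "P ! p = (Inc r, t, t')" "fits T" "T r = pre @ ds" "length (T r) < s"
  shows "run (conf (4 * p) (length pre) T 1 \<sigma>) (conf (4 * t) 0 (T(r := pre @ bsucc ds)) 1 \<sigma>)"
  using assms(2-)
proof (induction ds arbitrary: pre T rule: bsucc.induct)
  case 1
  have ret: "run (conf (4 * p + 1) (length pre) (T(r := pre @ [True])) 1 \<sigma>) (conf (4 * t) 0 (T(r := pre @ [True])) 1 \<sigma>)"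
    by (rule return_left [OF assms(1)]) (use 1 r in \<open>auto intro!: fits_update\<close>)
  have "run (conf (4 * p) (length pre) T 1 \<sigma>) (conf (4 * t) 0 (T(r := pre @ bsucc [])) 1 \<sigma>)"
    by (rule work_step_0 [OF assms(1), where g = "(cell 1 T (length pre))(Suc r := 2)" and mv = Stay and q = "4 * p + 1"
          and T' = "T(r := pre @ [True])"])
       (use 1 ret p r cell_in [OF _ 1(1)] tape_extend [of 1 T r True] in
         \<open>auto simp: cell_Suc digit_def go_def numeral_2_eq_2 intro!: upd_in fits_update\<close>)
  then show ?case .
next
  case (2 ds)
  have ret: "run (conf (4 * p + 1) (length pre) (T(r := pre @ True # ds)) 1 \<sigma>) (conf (4 * t) 0 (T(r := pre @ True # ds)) 1 \<sigma>)"
    by (rule return_left [OF assms(1)]) (use 2 r in \<open>auto intro!: fits_update\<close>)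
  have "run (conf (4 * p) (length pre) T 1 \<sigma>) (conf (4 * t) 0 (T(r := pre @ bsucc (False # ds))) 1 \<sigma>)"
    by (rule work_step_0 [OF assms(1), where g = "(cell 1 T (length pre))(Suc r := 2)" and mv = Stay and q = "4 * p + 1"
          and T' = "T(r := pre @ True # ds)"])
       (use 2 ret p r cell_in [OF _ 2(1)] tape_update [of "length pre" T r 1 True] in
         \<open>auto simp: cell_Suc digit_def go_def numeral_2_eq_2 intro!: upd_in fits_update\<close>)
  then show ?case .
next
  case (3 ds)
  have ret: "run (conf (4 * p) (length (pre @ [False])) (T(r := pre @ False # ds)) 1 \<sigma>)
      (conf (4 * t) 0 ((T(r := pre @ False # ds))(r := (pre @ [False]) @ bsucc ds)) 1 \<sigma>)"
    by (rule 3(1)) (use 3(2-) r in \<open>auto simp: fits_def\<close>)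
  have "run (conf (4 * p) (length pre) T 1 \<sigma>) (conf (4 * t) 0 (T(r := pre @ bsucc (True # ds))) 1 \<sigma>)"
    by (rule work_step_0 [OF assms(1), where g = "(cell 1 T (length pre))(Suc r := 1)" and mv = MoveR and q = "4 * p"
          and T' = "T(r := pre @ False # ds)"])
       (use 3(2-) ret p r cell_in [OF _ 3(2)] tape_update [of "length pre" T r 1 False] in
         \<open>auto simp: cell_Suc digit_def go_def numeral_2_eq_2 intro!: upd_in fits_update\<close>)
  then show ?case .
qed

lemma run_Dec_pos:
  assumes "P ! p = (Dec r, t, t')" "fits T" "T r = pre @ ds" "length (T r) < s"
    and "0 < bval ds"
  shows "run (conf (4 * p) (length pre) T 1 \<sigma>) (conf (4 * t) 0 (T(r := pre @ bpred ds)) 1 \<sigma>)"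
  using assms(2-)
proof (induction ds arbitrary: pre T rule: bpred.induct)
  case 1
  then show ?case by simp
next
  case (2 ds)
  have ret: "run (conf (4 * p + 1) (length pre) (T(r := pre @ False # ds)) 1 \<sigma>) (conf (4 * t) 0 (T(r := pre @ False # ds)) 1 \<sigma>)"
    by (rule return_left [OF assms(1)]) (use 2 r in \<open>auto intro!: fits_update\<close>)
  have "run (conf (4 * p) (length pre) T 1 \<sigma>) (conf (4 * t) 0 (T(r := pre @ bpred (True # ds))) 1 \<sigma>)"
    by (rule work_step_0 [OF assms(1), where g = "(cell 1 T (length pre))(Suc r := 1)" and mv = Stay and q = "4 * p + 1"
          and T' = "T(r := pre @ False # ds)"])
       (use 2 ret p r cell_in [OF _ 2(1)] tape_update [of "length pre" T r 1 False] in
         \<open>auto simp: cell_Suc digit_def go_def numeral_2_eq_2 intro!: upd_in fits_update\<close>)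
  then show ?case .
next
  case (3 ds)
  have ret: "run (conf (4 * p) (length (pre @ [True])) (T(r := pre @ True # ds)) 1 \<sigma>)
      (conf (4 * t) 0 ((T(r := pre @ True # ds))(r := (pre @ [True]) @ bpred ds)) 1 \<sigma>)"
    by (rule 3(1)) (use 3(2-) r in \<open>auto simp: fits_def\<close>)
  have "run (conf (4 * p) (length pre) T 1 \<sigma>) (conf (4 * t) 0 (T(r := pre @ bpred (False # ds))) 1 \<sigma>)"
    by (rule work_step_0 [OF assms(1), where g = "(cell 1 T (length pre))(Suc r := 2)" and mv = MoveR and q = "4 * p"
          and T' = "T(r := pre @ True # ds)"])
       (use 3(2-) ret p r cell_in [OF _ 3(2)] tape_update [of "length pre" T r 1 True] in
         \<open>auto simp: cell_Suc digit_def go_def numeral_2_eq_2 intro!: upd_in fits_update\<close>)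
  then show ?case .
qed

text \<open>The borrow has turned the first \<open>i\<close> zeros into ones and has
  \<open>l\<close> zeros ahead. Behind the last digit the head reads a blank and turns back to
  repair them.\<close>

lemma run_Dec_zero:
  assumes "P ! p = (Dec r, t, t')" "fits T"
    and "T r = replicate i True @ replicate l False" "i + l < s"
  shows "run (conf (4 * p) i T 1 \<sigma>) (conf (4 * t') 0 (T(r := replicate (i + l) False)) 1 \<sigma>)"
  using assms(2-)
proof (induction l arbitrary: i T)
  case 0
  show ?case
  proof (cases i)
    \<comment> \<open>A counter without digits: the head is already on the marked cell and nothing
      needs repair.\<close>
    case i: 0
    then have "T(r := []) = T" using 0 by auto
    then show ?thesis unfolding i
      by (intro work_step_0 [OF assms(1), where g = "cell 1 T 0" and mv = Stay and q = "4 * t'" and T' = T])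
         (use 0 i p t inv cell_in [OF _ 0(1)] in
           \<open>auto simp: cell_0 cell_Suc digit_def go_def tape_same intro!: run_refl safe_conf\<close>)
  next
    case (Suc j)
    have ret: "run (conf (4 * p + 2) j T 1 \<sigma>) (conf (4 * t') 0 (T(r := replicate (Suc j + 0) False)) 1 \<sigma>)"
      by (rule return_left_zero [OF assms(1)]) (use 0 Suc in auto)
    have "run (conf (4 * p) (Suc j) T 1 \<sigma>) (conf (4 * t') 0 (T(r := replicate (Suc j + 0) False)) 1 \<sigma>)"
      by (rule work_step_0 [OF assms(1), where g = "cell 1 T (Suc j)" and mv = MoveL and q = "4 * p + 2" and T' = T])
         (use 0 Suc ret p cell_in [OF _ 0(1)] in \<open>auto simp: cell_0 cell_Suc digit_def go_def tape_same\<close>)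
    then show ?thesis unfolding Suc .
  qed
next
  case (Suc l)
  have Tr: "(T r)[i := True] = replicate (Suc i) True @ replicate l False"
    using Suc.prems(2) by (simp add: list_update_append replicate_app_Cons_same)
  have ret: "run (conf (4 * p) (Suc i) (T(r := (T r)[i := True])) 1 \<sigma>)
      (conf (4 * t') 0 ((T(r := (T r)[i := True]))(r := replicate (Suc i + l) False)) 1 \<sigma>)"
    by (rule Suc.IH) (use Suc.prems r Tr in \<open>auto simp: fits_def\<close>)
  have "run (conf (4 * p) i T 1 \<sigma>) (conf (4 * t') 0 (T(r := replicate (i + Suc l) False)) 1 \<sigma>)"
    by (rule work_step_0 [OF assms(1), where g = "(cell 1 T i)(Suc r := 2)" and mv = MoveR and q = "4 * p"
          and T' = "T(r := (T r)[i := True])"])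
       (use Suc.prems ret p r cell_in [OF _ Suc.prems(1)] tape_update [of i T r 1 True] in
         \<open>auto simp: cell_Suc digit_def go_def numeral_2_eq_2 nth_append intro!: upd_in fits_update\<close>)
  then show ?case .
qed

end

section \<open>Simulation of operations and of whole runs\<close>

lemma sim_step:
  assumes "p < N" "P ! p = (c, t, t')" "represents T \<sigma>"
    and "op_action enc N p 0 t t' (read_input x (ipos \<sigma>)) (cell 1 T 0) (cat \<sigma> ! cpos \<sigma>) c = u"
    and "act_work_write u = enc (cell 1 T 0)" "act_work_move u = Stay" "act_state u < 4 * N + 8"
    and "represents T \<sigma>'"
    and "\<lparr>cc_state = act_state u, cc_input_pos = shift_input x (act_input_move u) (ipos \<sigma>),
     cc_work = tape 1 T, cc_work_pos = 0,
     cc_cat = (cat \<sigma>)[cpos \<sigma> := act_cat_write u], cc_cat_pos = shift (act_cat_move u) (cpos \<sigma>),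
     cc_output = append_opt (outp \<sigma>) (act_output u), cc_query = append_opt (qry \<sigma>) (act_query u)\<rparr>
     = conf q 0 T 1 \<sigma>'"
  shows "run (conf (4 * p) 0 T 1 \<sigma>) (conf q 0 T 1 \<sigma>')"
proof -
  have T: "fits T" "cpos \<sigma> < cl" "cpos \<sigma>' < cl" using assms by (auto simp: represents_def)
  have s: "0 < s" by (simp add: s_eq)
  have raw: "raw_action enc P (4 * p) (read_input x (ipos \<sigma>)) (cell 1 T 0) (cat \<sigma> ! cpos \<sigma>) = u"
    unfolding assms(4) [symmetric] using assms(1,2) by (simp add: raw_action_def)
  have w: "act_work_write u < card S"
    unfolding assms(5) by (rule enc_lt, rule cell_in) (simp_all add: T)
  have "step (conf (4 * p) 0 T 1 \<sigma>) = conf q 0 T 1 \<sigma>'"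
    unfolding assms(9) [symmetric]
    by (subst step_conf [OF s _ T(1) _ _ _ raw assms(7) w])
       (use assms(1) in \<open>simp_all add: assms(5,6) tape_same del: One_nat_def\<close>)
  then show ?thesis using T s by (metis run_step run_refl safe_conf)
qed

text \<open>Three machine steps: the address is saved in the mark, the query state moves on to yes
  or no, and the answer state reads the address back, restores the mark and jumps.\<close>

lemma sim_Ask:
  assumes "p < N" "P ! p = (Ask, t, t')" "represents T \<sigma>"
  shows "run (conf (4 * p) 0 T 1 \<sigma>)
    (conf (4 * (if qry \<sigma> \<in> A then t else t')) 0 T 1 (\<sigma>\<lparr>qry := []\<rparr>))"
proof -
  have T: "fits T" "cpos \<sigma> < cl" "ipos \<sigma> \<le> Suc (length x)" using assms by (auto simp: represents_def)
  have s: "0 < s" by (simp add: s_eq)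
  have t: "t \<le> Suc N" "t' \<le> Suc N" using targets [OF assms(1)] assms(2) by auto
  let ?q = "if qry \<sigma> \<in> A then 4 * N + 2 else 4 * N + 3"
  have 1: "step (conf (4 * p) 0 T 1 \<sigma>) = conf (4 * N + 1) 0 T (p + 2) \<sigma>"
    by (subst step_conf [OF s _ T(1), of 1 "4 * p" \<sigma> "go enc ((cell 1 T 0)(0 := p + 2)) (cat \<sigma> ! cpos \<sigma>) (4 * N + 1)"])
       (use assms(1,2) enc_lt [OF upd_in [OF cell_in [OF _ T(1)]]] T tape_mark [of 1 T "p + 2"] in
         \<open>auto simp: raw_action_def go_def conf_def shift_input_Stay append_opt_def\<close>)
  have 2: "step (conf (4 * N + 1) 0 T (p + 2) \<sigma>) = conf ?q 0 T (p + 2) (\<sigma>\<lparr>qry := []\<rparr>)"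
    by (simp add: ctm_step_def ctm_halted_def conf_def machine_def)
  have 3: "step (conf ?q 0 T (p + 2) (\<sigma>\<lparr>qry := []\<rparr>)) =
      conf (4 * (if qry \<sigma> \<in> A then t else t')) 0 T 1 (\<sigma>\<lparr>qry := []\<rparr>)"
    by (subst step_conf [OF s _ T(1), of "p + 2" ?q "\<sigma>\<lparr>qry := []\<rparr>"
          "go enc ((cell (p + 2) T 0)(0 := 1)) (cat \<sigma> ! cpos \<sigma>) (4 * (if qry \<sigma> \<in> A then t else t'))"])
       (use assms(1,2) t enc_lt [OF upd_in [OF cell_in [OF _ T(1)]]] T tape_mark [of "p + 2" T 1] in
         \<open>auto simp: raw_action_def go_def conf_def shift_input_def append_opt_def cell_0\<close>)
  show ?thesis
    by (rule run_step, simp add: safe_conf s T, subst 1, rule run_step, simp add: safe_conf s T,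
        subst 2, rule run_step, simp add: safe_conf s T, subst 3, rule run_refl, simp add: safe_conf s T)
qed

lemma op_sem_represents:
  assumes "op_sem A x c \<sigma> = (\<sigma>', b)" "inbounds B \<sigma>'" "represents T \<sigma>"
  shows "ipos \<sigma>' \<le> Suc (length x)" "length (cat \<sigma>') = cl" "cpos \<sigma>' < cl"
  using assms by (cases c; auto simp: represents_def inbounds_def shift_input_def split: if_splits)+

text \<open>Only counter operations change the tracks. The bound \<open>2 ^ d\<close> on the new
  counter values is what keeps the digit strings within \<open>d\<close> cells.\<close>

lemma sim_op:
  assumes "p < N" "P ! p = (c, t, t')" "op_sem A x c \<sigma> = (\<sigma>', b)" "represents T \<sigma>"
    and "inbounds (2 ^ d) \<sigma>'"
  shows "\<exists>T'. represents T' \<sigma>' \<and>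
    run (conf (4 * p) 0 T 1 \<sigma>) (conf (4 * (if b then t else t')) 0 T' 1 \<sigma>')"
proof -
  have T: "fits T" "cpos \<sigma> < cl" "ipos \<sigma> \<le> Suc (length x)" using assms by (auto simp: represents_def)
  have t: "t \<le> Suc N" "t' \<le> Suc N" using targets [OF assms(1)] assms(2) by auto
  note keep = op_sem_represents [OF assms(3,5,4)]
  show ?thesis
  proof (cases "\<exists>r. c \<in> {Inc r, Dec r}")
    case False
    then have "regs \<sigma>' = regs \<sigma>" using assms(3) by (cases c) auto
    then have rep: "represents T \<sigma>'" using assms(4) keep by (simp add: represents_def)
    have "run (conf (4 * p) 0 T 1 \<sigma>) (conf (4 * (if b then t else t')) 0 T 1 \<sigma>')"
    proof (cases "c = Ask")
      case True
      then have "\<sigma>' = \<sigma>\<lparr>qry := []\<rparr>" "b \<longleftrightarrow> qry \<sigma> \<in> A" using assms(3) by auto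
      then show ?thesis using sim_Ask [of p t t' T \<sigma>] assms(1,2,4) True by simp
    next
      case nask: False
      show ?thesis
      proof (rule sim_step [OF assms(1,2,4) refl _ _ _ rep])
        let ?u = "op_action enc N p 0 t t' (read_input x (ipos \<sigma>)) (cell 1 T 0) (cat \<sigma> ! cpos \<sigma>) c"
        show "act_work_write ?u = enc (cell 1 T 0)" "act_work_move ?u = Stay" "act_state ?u < 4 * N + 8"
          using False nask t by (cases c; simp add: go_def)+
        show "\<lparr>cc_state = act_state ?u, cc_input_pos = shift_input x (act_input_move ?u) (ipos \<sigma>),
          cc_work = tape 1 T, cc_work_pos = 0,
          cc_cat = (cat \<sigma>)[cpos \<sigma> := act_cat_write ?u],
          cc_cat_pos = shift (act_cat_move ?u) (cpos \<sigma>),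
          cc_output = append_opt (outp \<sigma>) (act_output ?u),
          cc_query = append_opt (qry \<sigma>) (act_query ?u)\<rparr>
          = conf (4 * (if b then t else t')) 0 T 1 \<sigma>'"
          using False nask assms(3) T(3)
          by (cases c) (auto simp: go_def conf_def shift_input_Stay append_opt_def)
      qed
    qed
    with rep show ?thesis by blast
  next
    case True
    then obtain r where r: "c \<in> {Inc r, Dec r}" by blast
    have rR: "r < R" using counters [OF assms(1), of r] r assms(2) by auto
    have len: "length (T r) \<le> d" "bval (T r) = regs \<sigma> r" using assms(4) rR by (auto simp: represents_def)
    have upd: "represents (T(r := ds)) \<sigma>'"
      if "length ds \<le> d" "bval ds = regs \<sigma>' r" "\<And>r'. r' \<noteq> r \<Longrightarrow> regs \<sigma>' r' = regs \<sigma> r'" for ds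
      using that assms(4) keep rR by (auto simp: represents_def fits_def)
    consider "c = Inc r" | "c = Dec r" "0 < regs \<sigma> r" | "c = Dec r" "regs \<sigma> r = 0" using r by auto
    then show ?thesis
    proof cases
      case 1
      have \<sigma>': "\<sigma>' = \<sigma>\<lparr>regs := (regs \<sigma>)(r := Suc (regs \<sigma> r))\<rparr>" "b" using 1 assms(3) by auto
      have "Suc (bval (T r)) < 2 ^ d"
      proof -
        have "regs \<sigma>' r < 2 ^ d" using assms(5) by (simp add: inbounds_def)
        then show ?thesis using len(2) by (simp add: \<sigma>'(1))
      qed
      then have "represents (T(r := bsucc (T r))) \<sigma>'"
        using len by (intro upd) (auto simp: length_bsucc bval_bsucc \<sigma>')
      moreover have "run (conf (4 * p) 0 T 1 \<sigma>) (conf (4 * t) 0 (T(r := bsucc (T r))) 1 \<sigma>)"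
        by (rule run_Inc [OF assms(1) rR T(3,2) t, where pre = "[]", unfolded list.size(3) append_Nil]) (use 1 assms(2) T len s_eq in auto)
      moreover have "conf (4 * t) 0 T' 1 \<sigma> = conf (4 * (if b then t else t')) 0 T' 1 \<sigma>'" for T'
        by (simp add: \<sigma>' conf_def)
      ultimately show ?thesis by metis
    next
      case 2
      have \<sigma>': "\<sigma>' = \<sigma>\<lparr>regs := (regs \<sigma>)(r := regs \<sigma> r - 1)\<rparr>" "b" using 2 assms(3) by auto
      have "represents (T(r := bpred (T r))) \<sigma>'"
        using len 2 by (intro upd) (auto simp: length_bpred bval_bpred \<sigma>')
      moreover have "run (conf (4 * p) 0 T 1 \<sigma>) (conf (4 * t) 0 (T(r := bpred (T r))) 1 \<sigma>)"
        by (rule run_Dec_pos [OF assms(1) rR T(3,2) t, where pre = "[]", unfolded list.size(3) append_Nil]) (use 2 assms(2) T len s_eq in auto)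
      moreover have "conf (4 * t) 0 T' 1 \<sigma> = conf (4 * (if b then t else t')) 0 T' 1 \<sigma>'" for T'
        by (simp add: \<sigma>' conf_def)
      ultimately show ?thesis by metis
    next
      case 3
      have \<sigma>': "\<sigma>' = \<sigma>" "\<not> b" using 3 assms(3) by auto
      have Tr: "T r = replicate (length (T r)) False" using bval_eq_0 len 3 by simp
      have "run (conf (4 * p) 0 T 1 \<sigma>) (conf (4 * t') 0 (T(r := replicate (0 + length (T r)) False)) 1 \<sigma>)"
        by (rule run_Dec_zero [OF assms(1) rR T(3,2) t]) (use 3 assms(2) T len s_eq Tr in auto)
      moreover have "T(r := replicate (0 + length (T r)) False) = T" using Tr by simp
      ultimately show ?thesis using \<sigma>' assms(4) by auto
    qed
  qed
qed

lemma sim_flat_run: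
  assumes "flat_run A x (2 ^ d) P p \<sigma> q \<sigma>'" "represents T \<sigma>"
  shows "\<exists>T'. represents T' \<sigma>' \<and> run (conf (4 * p) 0 T 1 \<sigma>) (conf (4 * q) 0 T' 1 \<sigma>')"
  using assms
proof (induction arbitrary: T rule: flat_run.induct)
  case (flat_refl p \<sigma>)
  have "safe (conf (4 * p) 0 T 1 \<sigma>)"
    by (rule safe_conf) (use flat_refl in \<open>simp_all add: represents_def s_eq\<close>)
  with flat_refl show ?case by (blast intro: run_refl)
next
  case (flat_step p a t t' \<sigma> \<sigma>' b q \<sigma>'')
  obtain T' where T': "represents T' \<sigma>'"
    "run (conf (4 * p) 0 T 1 \<sigma>) (conf (4 * (if b then t else t')) 0 T' 1 \<sigma>')"
    using sim_op [OF flat_step.hyps(1-3) flat_step.prems flat_step.hyps(4)] by blast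
  obtain T'' where "represents T'' \<sigma>''"
    "run (conf (4 * (if b then t else t')) 0 T' 1 \<sigma>') (conf (4 * q) 0 T'' 1 \<sigma>'')"
    using flat_step.IH [OF T'(1)] by blast
  with T'(2) run_trans show ?case by blast
qed

lemma sim_init:
  assumes "length \<tau> = cl" "0 < cl"
  defines "\<sigma> \<equiv> \<lparr>regs = (\<lambda>_. 0), ipos = 0, cat = \<tau>, cpos = 0, outp = [], qry = []\<rparr>"
  shows "represents (\<lambda>_. []) \<sigma>" "run (ctm_init M s \<tau>) (conf 0 0 (\<lambda>_. []) 1 \<sigma>)"
proof -
  show rep: "represents (\<lambda>_. []) \<sigma>" using assms by (simp add: represents_def fits_def)
  have T: "fits (\<lambda>_. [])" by (simp add: fits_def)
  have s: "0 < s" by (simp add: s_eq)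
  have "cell 0 (\<lambda>_. []) i = (\<lambda>_. 0)" for i by (intro ext) (simp add: cell_def digit_def split: nat.split)
  then have "tape 0 (\<lambda>_. []) = replicate s 0"
    by (intro nth_equalityI) (auto simp: tape_def enc_zero)
  then have init: "ctm_init M s \<tau> = conf (4 * N + 5) 0 (\<lambda>_. []) 0 \<sigma>"
    by (simp add: ctm_init_def conf_def machine_def \<sigma>_def)
  have "step (conf (4 * N + 5) 0 (\<lambda>_. []) 0 \<sigma>) = conf 0 0 (\<lambda>_. []) 1 \<sigma>"
    by (subst step_conf [OF s _ T, of 0 "4 * N + 5" \<sigma> "go enc ((cell 0 (\<lambda>_. []) 0)(0 := 1)) (cat \<sigma> ! cpos \<sigma>) 0"])
       (use enc_lt [OF upd_in [OF cell_in [OF _ T]]] tape_mark [of 0 "\<lambda>_. []" 1] in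
         \<open>auto simp: raw_action_def go_def conf_def shift_input_def append_opt_def \<sigma>_def\<close>)
  then show "run (ctm_init M s \<tau>) (conf 0 0 (\<lambda>_. []) 1 \<sigma>)"
    unfolding init using safe_conf [OF s] rep by (metis run_step run_refl represents_def)
qed

end

subsection \<open>Functions computable with counters\<close>

abbreviation skip :: code where
  "skip \<equiv> Do (InMove Stay)"

text \<open>The contract between subprograms: heads at the left end and scratch registers zero.
  \<open>B \<le> length (cat \<sigma>)\<close> makes every counter value a legal position of the
  catalytic head, and \<open>length x + 2 \<le> K\<close> makes K at least 2, so that products of
  bounds dominate sums. The flag \<open>a\<close> stands for permission to ask the oracle, which
  requires an empty query tape.\<close>

definition ready ::
  "bool \<Rightarrow> (nat \<Rightarrow> nat) \<Rightarrow> nat \<Rightarrow> nat \<Rightarrow> nat \<Rightarrow> bool list \<Rightarrow> cstate \<Rightarrow> bool" where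
  "ready a vm k K B x \<sigma> \<longleftrightarrow>
     length x + 2 \<le> K \<and> K < B \<and> (\<forall>i. vm i < k \<and> regs \<sigma> (vm i) \<le> K) \<and> (\<forall>r. regs \<sigma> r < B) \<and>
     (\<forall>r\<ge>k. regs \<sigma> r = 0) \<and> B \<le> length (cat \<sigma>) \<and> ipos \<sigma> = 0 \<and> cpos \<sigma> = 0 \<and> (a \<longrightarrow> qry \<sigma> = [])"

text \<open>
  The function \<open>f\<close> takes the input, the catalytic tape and an environment \<open>\<rho>\<close>; the value of
  variable \<open>i\<close> is found in register \<open>vm i\<close>, and the registers from \<open>k\<close> on are free. If the
  variables are at most \<open>K\<close>, then all counters stay below every bound exceeding \<open>K ^ D\<close>, so
  polynomial bounds never have to be tracked by hand. Evaluations with \<open>a = False\<close> do not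
  disturb the query tape.
\<close>

definition computes ::
  "bool list set \<Rightarrow> bool \<Rightarrow> (bool list \<Rightarrow> bool list \<Rightarrow> (nat \<Rightarrow> nat) \<Rightarrow> nat) \<Rightarrow> (nat \<Rightarrow> nat) \<Rightarrow> nat \<Rightarrow>
   code \<Rightarrow> nat \<Rightarrow> bool" where
  "computes A a f vm k c D \<longleftrightarrow> 0 < D \<and>
     (\<forall>x \<sigma> K B. ready a vm k K B x \<sigma> \<longrightarrow> K ^ D < B \<longrightarrow>
        f x (cat \<sigma>) (regs \<sigma> \<circ> vm) \<le> K ^ D \<and>
        bigstep A x B c \<sigma> (\<sigma>\<lparr>regs := (regs \<sigma>)(k := f x (cat \<sigma>) (regs \<sigma> \<circ> vm))\<rparr>))"

text \<open>Quantifying over all placements \<open>vm\<close> and \<open>k\<close> allows a program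
  to be inserted above whatever registers are in use. Code and exponent may depend on the placement,
  but not on the input.\<close>

definition computable ::
  "bool list set \<Rightarrow> bool \<Rightarrow> (bool list \<Rightarrow> bool list \<Rightarrow> (nat \<Rightarrow> nat) \<Rightarrow> nat) \<Rightarrow> bool" where
  "computable A a f \<longleftrightarrow> (\<forall>vm k. (\<forall>i. vm i < k) \<longrightarrow> (\<exists>c D. computes A a f vm k c D))"

lemma computableI:
  assumes "\<And>vm k. \<forall>i. vm i < k \<Longrightarrow> \<exists>c D. computes A a f vm k c D"
  shows "computable A a f"
  using assms by (simp add: computable_def)

lemma computableE:
  assumes "computable A a f" "\<forall>i. vm i < k"
  obtains c D where "computes A a f vm k c D"
  using assms by (meson computable_def)

lemma computes_pos: "computes A a f vm k c D \<Longrightarrow> 0 < D"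
  unfolding computes_def by blast

lemma computesD:
  assumes "computes A a f vm k c D" "ready a vm k K B x \<sigma>" "K ^ D < B"
    and "v = f x (cat \<sigma>) (regs \<sigma> \<circ> vm)" "\<sigma>' = \<sigma>\<lparr>regs := (regs \<sigma>)(k := v)\<rparr>"
  shows "v \<le> K ^ D" "bigstep A x B c \<sigma> \<sigma>'"
  using assms unfolding computes_def by blast+

lemma ready_inbounds: "ready a vm k K B x \<sigma> \<Longrightarrow> inbounds B \<sigma>"
  unfolding ready_def inbounds_def by fastforce

lemma ready_push:
  assumes "ready a vm k K B x \<sigma>" "v < B" "k \<le> k'"
  shows "ready a vm (Suc k') K B x (\<sigma>\<lparr>regs := (regs \<sigma>)(k' := v)\<rparr>)"
proof -
  have "vm i < k" for i using assms(1) by (simp add: ready_def)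
  then have "vm i < Suc k'" "vm i \<noteq> k'" for i
    using assms(3) by (meson le_less_trans less_Suc_eq_le less_imp_le order.strict_trans2, metis leD assms(3))
  then show ?thesis using assms by (auto simp: ready_def)
qed

lemma power_mono_bound: "K ^ D < B \<Longrightarrow> D' \<le> D \<Longrightarrow> 0 < K \<Longrightarrow> K ^ D' < (B::nat)"
  by (rule le_less_trans [OF power_increasing]) auto

text \<open>Two numbers that are at least 2 have a sum bounded by their product.\<close>

lemma add_le_power: "(v::nat) \<le> K ^ D \<Longrightarrow> w \<le> K ^ E \<Longrightarrow> 2 \<le> K \<Longrightarrow> 0 < D \<Longrightarrow> 0 < E \<Longrightarrow> v + w \<le> K ^ (D + E)"
proof -
  assume a: "v \<le> K ^ D" "w \<le> K ^ E" "2 \<le> K" "0 < D" "0 < E"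
  have "2 \<le> K ^ D" "2 \<le> K ^ E" using a self_le_power [of K D] self_le_power [of K E] by auto
  then have "K ^ D + K ^ E \<le> K ^ D * K ^ E"
    by (auto simp: algebra_simps dest!: le_Suc_ex)
  then show ?thesis using a by (simp add: power_add)
qed

lemma cstate_regs_eqI: "(\<And>r. f r = g r) \<Longrightarrow> \<sigma>\<lparr>regs := f\<rparr> = \<sigma>\<lparr>regs := g\<rparr>"
  by presburger

lemma cstate_regs_idI: "(\<And>r. f r = regs \<sigma> r) \<Longrightarrow> \<sigma>\<lparr>regs := f\<rparr> = \<sigma>"
proof -
  assume "\<And>r. f r = regs \<sigma> r"
  then have "f = regs \<sigma>" by (rule ext)
  then show ?thesis by simp
qed

text \<open>\<open>S j\<close> is the state before the test of round \<open>j\<close>; the body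
  starts with the counter already decremented. The induction is on the number of rounds still to
  come, since \<open>bigstep.Loop_step\<close> peels off the first one.\<close>

lemma bigstep_Loop_Dec:
  assumes "\<And>j. j \<le> n \<Longrightarrow> regs (S j) r = n - j" "\<And>j. j \<le> n \<Longrightarrow> inbounds B (S j)"
    and "\<And>j. j < n \<Longrightarrow> bigstep A x B c ((S j)\<lparr>regs := (regs (S j))(r := n - Suc j)\<rparr>) (S (Suc j))"
    and "\<sigma> = S 0" "\<sigma>' = S n"
  shows "bigstep A x B (Loop (Dec r) c) \<sigma> \<sigma>'"
proof -
  have "bigstep A x B (Loop (Dec r) c) (S (n - i)) (S n)" if "i \<le> n" for i
    using that
  proof (induction i)
    case 0
    then show ?case using assms(1,2) [of n] by (auto intro!: bigstep.Loop_end)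
  next
    case (Suc i)
    let ?j = "n - Suc i"
    have j: "?j < n" "Suc ?j = n - i" using Suc.prems by auto
    have r: "regs (S ?j) r = Suc i" using assms(1) [of ?j] Suc.prems by auto
    show ?case
    proof (rule bigstep.Loop_step)
      show "op_sem A x (Dec r) (S ?j) = ((S ?j)\<lparr>regs := (regs (S ?j))(r := i)\<rparr>, True)"
        using r by simp
      show "inbounds B ((S ?j)\<lparr>regs := (regs (S ?j))(r := i)\<rparr>)"
        using assms(2) [of ?j] r unfolding inbounds_def by (simp, metis Suc_lessD)
      have "n - Suc ?j = i" using Suc.prems by auto
      then show "bigstep A x B c ((S ?j)\<lparr>regs := (regs (S ?j))(r := i)\<rparr>) (S (n - i))"
        using assms(3) [OF j(1)] j(2) by simp
      show "bigstep A x B (Loop (Dec r) c) (S (n - i)) (S n)" using Suc by simp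
    qed
  qed
  from this [of n] assms(4,5) show ?thesis by simp
qed

lemma inbounds_update:
  "inbounds B \<sigma> \<Longrightarrow> v < B \<Longrightarrow> inbounds B (\<sigma>\<lparr>regs := (regs \<sigma>)(r := v)\<rparr>)"
  by (simp add: inbounds_def)

lemma bigstep_Inc:
  "inbounds B \<sigma> \<Longrightarrow> Suc (regs \<sigma> r) < B \<Longrightarrow> \<sigma>' = \<sigma>\<lparr>regs := (regs \<sigma>)(r := Suc (regs \<sigma> r))\<rparr> \<Longrightarrow>
     bigstep A x B (Do (Inc r)) \<sigma> \<sigma>'"
  by (auto intro!: bigstep.Do inbounds_update)

lemma bigstep_skip: "inbounds B \<sigma> \<Longrightarrow> ipos \<sigma> = 0 \<Longrightarrow> bigstep A x B skip \<sigma> \<sigma>"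
  by (rule bigstep.Do) (auto simp: shift_input_def)

lemma bigstep_move:
  assumes "inbounds B \<sigma>" "r \<noteq> s" "regs \<sigma> s + regs \<sigma> r < B"
    and "\<sigma>' = \<sigma>\<lparr>regs := (regs \<sigma>)(r := 0, s := regs \<sigma> s + regs \<sigma> r)\<rparr>"
  shows "bigstep A x B (Loop (Dec r) (Do (Inc s))) \<sigma> \<sigma>'"
proof (rule bigstep_Loop_Dec [where S = "\<lambda>j. \<sigma>\<lparr>regs := (regs \<sigma>)(r := regs \<sigma> r - j, s := regs \<sigma> s + j)\<rparr>"])
  fix j assume "j < regs \<sigma> r"
  then show "bigstep A x B (Do (Inc s))
     ((\<sigma>\<lparr>regs := (regs \<sigma>)(r := regs \<sigma> r - j, s := regs \<sigma> s + j)\<rparr>)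
      \<lparr>regs := (regs (\<sigma>\<lparr>regs := (regs \<sigma>)(r := regs \<sigma> r - j, s := regs \<sigma> s + j)\<rparr>))(r := regs \<sigma> r - Suc j)\<rparr>)
     (\<sigma>\<lparr>regs := (regs \<sigma>)(r := regs \<sigma> r - Suc j, s := regs \<sigma> s + Suc j)\<rparr>)"
    using assms by (intro bigstep_Inc) (auto simp: inbounds_def less_imp_diff_less intro!: cstate_regs_eqI)
qed (use assms in \<open>auto simp: inbounds_def less_imp_diff_less\<close>)

lemma bigstep_clear:
  assumes "inbounds B \<sigma>" "ipos \<sigma> = 0" "\<sigma>' = \<sigma>\<lparr>regs := (regs \<sigma>)(r := 0)\<rparr>"
  shows "bigstep A x B (Loop (Dec r) skip) \<sigma> \<sigma>'"
proof -
  have lt: "inbounds B (\<sigma>\<lparr>regs := (regs \<sigma>)(r := regs \<sigma> r - j)\<rparr>)" for j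
    using assms(1) by (simp add: inbounds_def less_imp_diff_less)
  show ?thesis
  proof (rule bigstep_Loop_Dec [where S = "\<lambda>j. \<sigma>\<lparr>regs := (regs \<sigma>)(r := regs \<sigma> r - j)\<rparr>"])
  fix j assume "j < regs \<sigma> r"
  then show "bigstep A x B skip
     ((\<sigma>\<lparr>regs := (regs \<sigma>)(r := regs \<sigma> r - j)\<rparr>)
      \<lparr>regs := (regs (\<sigma>\<lparr>regs := (regs \<sigma>)(r := regs \<sigma> r - j)\<rparr>))(r := regs \<sigma> r - Suc j)\<rparr>)
     (\<sigma>\<lparr>regs := (regs \<sigma>)(r := regs \<sigma> r - Suc j)\<rparr>)"
    using assms(2) lt bigstep_skip [of B "\<sigma>\<lparr>regs := (regs \<sigma>)(r := regs \<sigma> r - Suc j)\<rparr>" A x]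
    by simp
  qed (use assms lt in simp_all)
qed

lemma upd_comp_vm:
  fixes vm :: "nat \<Rightarrow> nat"
  assumes "\<forall>i. vm i < k" "k \<le> r"
  shows "\<rho>(r := v) \<circ> vm = \<rho> \<circ> vm"
proof (rule ext)
  fix i
  have "vm i \<noteq> r" using assms(1) [rule_format, of i] assms(2) by simp
  then show "(\<rho>(r := v) \<circ> vm) i = (\<rho> \<circ> vm) i" by simp
qed

text \<open>Renaming variables needs no new code: it is absorbed into the placement
  \<open>vm\<close>.\<close>

lemma computable_rename: "computable A a f \<Longrightarrow> computable A a (\<lambda>x c \<rho>. f x c (\<lambda>i. \<rho> (h i)))"
proof (rule computableI)
  fix vm :: "nat \<Rightarrow> nat" and k assume f: "computable A a f" and vm: "\<forall>i. vm i < k"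
  obtain c D where c: "computes A a f (\<lambda>i. vm (h i)) k c D"
    using computableE [OF f, of "\<lambda>i. vm (h i)" k] vm by blast
  have "ready a (\<lambda>i. vm (h i)) k K B x \<sigma>" if "ready a vm k K B x \<sigma>" for K B x \<sigma>
    using that by (auto simp: ready_def)
  with c have "computes A a (\<lambda>x c \<rho>. f x c (\<lambda>i. \<rho> (h i))) vm k c D"
    unfolding computes_def comp_def by blast
  then show "\<exists>c D. computes A a (\<lambda>x c \<rho>. f x c (\<lambda>i. \<rho> (h i))) vm k c D" by blast
qed

lemma computable_Suc:
  assumes "computable A a f"
  shows "computable A a (\<lambda>x c \<rho>. Suc (f x c \<rho>))"
proof (rule computableI)
  fix vm :: "nat \<Rightarrow> nat" and k assume vm: "\<forall>i. vm i < k"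
  obtain c D where c: "computes A a f vm k c D" using computableE [OF assms vm] by blast
  have "computes A a (\<lambda>x c \<rho>. Suc (f x c \<rho>)) vm k (c ;; Do (Inc k)) (D + 1)"
    unfolding computes_def
  proof (intro conjI allI impI)
    fix x \<sigma> K B assume r: "ready a vm k K B x \<sigma>" and K: "K ^ (D + 1) < B"
    have K2: "2 \<le> K" using r by (simp add: ready_def)
    have K': "K ^ D < B" using power_mono_bound [OF K, of D] K2 by simp
    note f = computesD [OF c r K' refl refl]
    show le: "Suc (f x (cat \<sigma>) (regs \<sigma> \<circ> vm)) \<le> K ^ (D + 1)"
      using add_le_power [OF f(1), of 1 1] K2 computes_pos [OF c] by simp
    show "bigstep A x B (c ;; Do (Inc k)) \<sigma> (\<sigma>\<lparr>regs := (regs \<sigma>)(k := Suc (f x (cat \<sigma>) (regs \<sigma> \<circ> vm)))\<rparr>)"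
      by (rule bigstep.Seq [OF f(2)], rule bigstep_Inc)
         (use le_less_trans [OF le K] ready_inbounds [OF r] in \<open>simp_all add: inbounds_update\<close>)
  qed simp
  then show "\<exists>c D. computes A a (\<lambda>x c \<rho>. Suc (f x c \<rho>)) vm k c D" by blast
qed

lemma computable_const: "computable A a (\<lambda>x c \<rho>. n)"
proof (induction n)
  case 0
  show ?case
  proof (rule computableI)
    fix vm :: "nat \<Rightarrow> nat" and k assume vm: "\<forall>i. vm i < k"
    have "computes A a (\<lambda>x c \<rho>. 0) vm k skip 1"
      unfolding computes_def
    proof (intro conjI allI impI)
      fix x \<sigma> K B assume r: "ready a vm k K B x \<sigma>"
      then have "\<sigma>\<lparr>regs := (regs \<sigma>)(k := 0)\<rparr> = \<sigma>" by (auto simp: ready_def fun_upd_idem)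
      then show "bigstep A x B skip \<sigma> (\<sigma>\<lparr>regs := (regs \<sigma>)(k := 0)\<rparr>)"
        using bigstep_skip ready_inbounds [OF r] r by (simp add: ready_def)
    qed simp_all
    then show "\<exists>c D. computes A a (\<lambda>x c \<rho>. 0) vm k c D" by blast
  qed
qed (rule computable_Suc)

lemma computable_var: "computable A a (\<lambda>x c \<rho>. \<rho> i)"
proof (rule computableI)
  fix vm :: "nat \<Rightarrow> nat" and k assume vm: "\<forall>i. vm i < k"
  let ?v = "vm i"
  \<comment> \<open>Reading a counter destroys it, so it is poured into two registers at once and
    then refilled from the second.\<close>
  let ?c1 = "Loop (Dec ?v) (Do (Inc k) ;; Do (Inc (Suc k)))" and ?c2 = "Loop (Dec (Suc k)) (Do (Inc ?v))"
  have ne: "?v \<noteq> k" "?v \<noteq> Suc k" using vm [rule_format, of i] by auto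
  have "computes A a (\<lambda>x c \<rho>. \<rho> i) vm k (?c1 ;; ?c2) 1"
    unfolding computes_def
  proof (intro conjI allI impI)
    fix x \<sigma> K B assume r: "ready a vm k K B x \<sigma>" and K: "K ^ 1 < B"
    let ?n = "regs \<sigma> ?v"
    have n: "?n \<le> K" "regs \<sigma> k = 0" "regs \<sigma> (Suc k) = 0" "inbounds B \<sigma>" "K < B"
      using r ready_inbounds [OF r] by (auto simp: ready_def)
    show "(regs \<sigma> \<circ> vm) i \<le> K ^ 1" using n by simp
    define S where "S j = \<sigma>\<lparr>regs := (regs \<sigma>)(?v := ?n - j, k := j, Suc k := j)\<rparr>" for j
    have 1: "bigstep A x B ?c1 \<sigma> (S ?n)"
    proof (rule bigstep_Loop_Dec [where S = S])
      fix j assume j: "j < ?n"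
      let ?m = "\<sigma>\<lparr>regs := (regs \<sigma>)(?v := ?n - Suc j, k := Suc j, Suc k := j)\<rparr>"
      have "bigstep A x B (Do (Inc k)) ((S j)\<lparr>regs := (regs (S j))(?v := ?n - Suc j)\<rparr>) ?m"
        by (rule bigstep_Inc) (use ne n j in \<open>auto simp: S_def inbounds_def intro!: cstate_regs_eqI\<close>)
      moreover have "bigstep A x B (Do (Inc (Suc k))) ?m (S (Suc j))"
        by (rule bigstep_Inc) (use ne n j in \<open>auto simp: S_def inbounds_def intro!: cstate_regs_eqI\<close>)
      ultimately show "bigstep A x B (Do (Inc k) ;; Do (Inc (Suc k)))
          ((S j)\<lparr>regs := (regs (S j))(?v := ?n - Suc j)\<rparr>) (S (Suc j))"
        by (rule bigstep.Seq)
    qed (use ne n in \<open>auto simp: S_def inbounds_def intro!: cstate_regs_idI [symmetric]\<close>)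
    have 2: "bigstep A x B ?c2 (S ?n) (\<sigma>\<lparr>regs := (regs \<sigma>)(k := (regs \<sigma> \<circ> vm) i)\<rparr>)"
      by (rule bigstep_move) (use ne n in \<open>auto simp: S_def inbounds_def intro!: cstate_regs_eqI\<close>)
    show "bigstep A x B (?c1 ;; ?c2) \<sigma> (\<sigma>\<lparr>regs := (regs \<sigma>)(k := (regs \<sigma> \<circ> vm) i)\<rparr>)"
      using 1 2 by (rule bigstep.Seq)
  qed simp
  then show "\<exists>c D. computes A a (\<lambda>x c \<rho>. \<rho> i) vm k c D" by blast
qed

definition computes_pair ::
  "bool list set \<Rightarrow> bool \<Rightarrow> (bool list \<Rightarrow> bool list \<Rightarrow> (nat \<Rightarrow> nat) \<Rightarrow> nat) \<Rightarrow>
   (bool list \<Rightarrow> bool list \<Rightarrow> (nat \<Rightarrow> nat) \<Rightarrow> nat) \<Rightarrow> (nat \<Rightarrow> nat) \<Rightarrow> nat \<Rightarrow> code \<Rightarrow> nat \<Rightarrow> bool" where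
  "computes_pair A a f g vm k c D \<longleftrightarrow> 0 < D \<and>
     (\<forall>x \<sigma> K B v w. ready a vm k K B x \<sigma> \<longrightarrow> K ^ D < B \<longrightarrow>
        v = f x (cat \<sigma>) (regs \<sigma> \<circ> vm) \<longrightarrow> w = g x (cat \<sigma>) (regs \<sigma> \<circ> vm) \<longrightarrow>
        v + w \<le> K ^ D \<and> bigstep A x B c \<sigma> (\<sigma>\<lparr>regs := (regs \<sigma>)(k := v, Suc k := w)\<rparr>))"

lemma computes_pairD:
  assumes "computes_pair A a f g vm k c D" "ready a vm k K B x \<sigma>" "K ^ D < B"
    and "v = f x (cat \<sigma>) (regs \<sigma> \<circ> vm)" "w = g x (cat \<sigma>) (regs \<sigma> \<circ> vm)"
  shows "v + w \<le> K ^ D" "bigstep A x B c \<sigma> (\<sigma>\<lparr>regs := (regs \<sigma>)(k := v, Suc k := w)\<rparr>)"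
  using assms unfolding computes_pair_def by blast+

lemma computes_pairE:
  assumes f: "computable A a f" and g: "computable A a g" and vm: "\<forall>i. vm i < k"
  obtains c D where "computes_pair A a f g vm k c D"
proof -
  obtain c D where c: "computes A a f vm k c D" using computableE [OF f vm] by blast
  obtain c' E where c': "computes A a g vm (Suc k) c' E"
    using computableE [OF g, of vm "Suc k"] vm by (metis less_SucI)
  note pos = computes_pos [OF c] computes_pos [OF c']
  have "computes_pair A a f g vm k (c ;; c') (D + E)"
    unfolding computes_pair_def
  proof (intro conjI allI impI)
    fix x \<sigma> K B v w
    assume r: "ready a vm k K B x \<sigma>" and K: "K ^ (D + E) < B"
      and v: "v = f x (cat \<sigma>) (regs \<sigma> \<circ> vm)" and w: "w = g x (cat \<sigma>) (regs \<sigma> \<circ> vm)"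
    have K2: "2 \<le> K" using r by (simp add: ready_def)
    have K': "K ^ D < B" "K ^ E < B" using power_mono_bound [OF K] K2 by simp_all
    note f = computesD [OF c r K'(1) v refl]
    let ?\<sigma> = "\<sigma>\<lparr>regs := (regs \<sigma>)(k := v)\<rparr>"
    have r': "ready a vm (Suc k) K B x ?\<sigma>" using ready_push [OF r] f(1) K' by simp
    have w': "w = g x (cat ?\<sigma>) (regs ?\<sigma> \<circ> vm)" using upd_comp_vm [OF vm, of k "regs \<sigma>" v] w by simp
    note g = computesD [OF c' r' K'(2) w' refl]
    show "v + w \<le> K ^ (D + E)" by (rule add_le_power [OF f(1) g(1) K2 pos])
    show "bigstep A x B (c ;; c') \<sigma> (\<sigma>\<lparr>regs := (regs \<sigma>)(k := v, Suc k := w)\<rparr>)"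
      using bigstep.Seq [OF f(2) g(2)] by simp
  qed (use pos in simp)
  then show ?thesis by (rule that)
qed

lemma computable_add:
  assumes "computable A a f" "computable A a g"
  shows "computable A a (\<lambda>x c \<rho>. f x c \<rho> + g x c \<rho>)"
proof (rule computableI)
  fix vm :: "nat \<Rightarrow> nat" and k assume vm: "\<forall>i. vm i < k"
  obtain c D where c: "computes_pair A a f g vm k c D"
    using computes_pairE [OF assms vm] by blast
  then have pos: "0 < D" unfolding computes_pair_def by blast
  have "computes A a (\<lambda>x c \<rho>. f x c \<rho> + g x c \<rho>) vm k (c ;; Loop (Dec (Suc k)) (Do (Inc k))) D"
    unfolding computes_def
  proof (intro conjI allI impI)
    fix x \<sigma> K B assume r: "ready a vm k K B x \<sigma>" and K: "K ^ D < B"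
    note p = computes_pairD [OF c r K refl refl]
    show "f x (cat \<sigma>) (regs \<sigma> \<circ> vm) + g x (cat \<sigma>) (regs \<sigma> \<circ> vm) \<le> K ^ D" using p(1) by simp
    have z: "regs \<sigma> (Suc k) = 0" using r by (simp add: ready_def)
    show "bigstep A x B (c ;; Loop (Dec (Suc k)) (Do (Inc k))) \<sigma>
        (\<sigma>\<lparr>regs := (regs \<sigma>)(k := f x (cat \<sigma>) (regs \<sigma> \<circ> vm) + g x (cat \<sigma>) (regs \<sigma> \<circ> vm))\<rparr>)"
      by (rule bigstep.Seq [OF p(2)], rule bigstep_move)
         (use le_less_trans [OF p(1) K] z ready_inbounds [OF r] in \<open>auto simp: inbounds_def intro!: cstate_regs_eqI\<close>)
  qed (use pos in simp)
  then show "\<exists>c D. computes A a (\<lambda>x c \<rho>. f x c \<rho> + g x c \<rho>) vm k c D" by blast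
qed

text \<open>\<open>Dec\<close> on zero does nothing, so one decrement for every unit of the second
  value gives truncated subtraction.\<close>

lemma computable_diff:
  assumes "computable A a f" "computable A a g"
  shows "computable A a (\<lambda>x c \<rho>. f x c \<rho> - g x c \<rho>)"
proof (rule computableI)
  fix vm :: "nat \<Rightarrow> nat" and k assume vm: "\<forall>i. vm i < k"
  obtain c D where c: "computes_pair A a f g vm k c D"
    using computes_pairE [OF assms vm] by blast
  then have pos: "0 < D" unfolding computes_pair_def by blast
  have "computes A a (\<lambda>x c \<rho>. f x c \<rho> - g x c \<rho>) vm k (c ;; Loop (Dec (Suc k)) (Do (Dec k))) D"
    unfolding computes_def
  proof (intro conjI allI impI)
    fix x \<sigma> K B assume r: "ready a vm k K B x \<sigma>" and K: "K ^ D < B"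
    let ?f = "f x (cat \<sigma>) (regs \<sigma> \<circ> vm)" and ?g = "g x (cat \<sigma>) (regs \<sigma> \<circ> vm)"
    note p = computes_pairD [OF c r K refl refl]
    show "?f - ?g \<le> K ^ D" using p(1) by simp
    have z: "regs \<sigma> (Suc k) = 0" using r by (simp add: ready_def)
    have lt: "?f < B" "?g < B" using p(1) K by auto
    note ib = ready_inbounds [OF r]
    define S where "S j = \<sigma>\<lparr>regs := (regs \<sigma>)(k := ?f - j, Suc k := ?g - j)\<rparr>" for j
    have "bigstep A x B (Loop (Dec (Suc k)) (Do (Dec k))) (S 0) (S ?g)"
    proof (rule bigstep_Loop_Dec [where S = S])
      fix j assume "j < ?g"
      let ?\<sigma> = "(S j)\<lparr>regs := (regs (S j))(Suc k := ?g - Suc j)\<rparr>"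
      have "fst (op_sem A x (Dec k) ?\<sigma>) = S (Suc j)"
        by (auto simp: S_def intro!: cstate_regs_eqI)
      moreover have "inbounds B (S (Suc j))"
        using lt ib by (auto simp: S_def inbounds_def)
      ultimately show "bigstep A x B (Do (Dec k)) ?\<sigma> (S (Suc j))"
        by (metis bigstep.Do prod.collapse)
    qed (use lt ib in \<open>auto simp: S_def inbounds_def\<close>)
    moreover have "S ?g = \<sigma>\<lparr>regs := (regs \<sigma>)(k := ?f - ?g)\<rparr>"
      using z by (auto simp: S_def intro!: cstate_regs_eqI)
    ultimately show "bigstep A x B (c ;; Loop (Dec (Suc k)) (Do (Dec k))) \<sigma> (\<sigma>\<lparr>regs := (regs \<sigma>)(k := ?f - ?g)\<rparr>)"
      using p(2) bigstep.Seq by (simp add: S_def)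
  qed (use pos in simp)
  then show "\<exists>c D. computes A a (\<lambda>x c \<rho>. f x c \<rho> - g x c \<rho>) vm k c D" by blast
qed

lemma ready_weaken:
  assumes "ready a vm k K B x \<sigma>" "K \<le> K'" "K' < B" "\<forall>i. vm' i < k' \<and> regs \<sigma>' (vm' i) \<le> K'"
    and "\<forall>r. regs \<sigma>' r < B" "\<forall>r\<ge>k'. regs \<sigma>' r = 0" "length (cat \<sigma>') = length (cat \<sigma>)"
    and "ipos \<sigma>' = 0" "cpos \<sigma>' = 0" "a' \<longrightarrow> qry \<sigma>' = []"
  shows "ready a' vm' k' K' B x \<sigma>'"
  using assms by (auto simp: ready_def)

lemma ready_le: "ready a vm k K B x \<sigma> \<Longrightarrow> k \<le> k' \<Longrightarrow> ready a vm k' K B x \<sigma>"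
  unfolding ready_def by (meson le_trans less_le_trans)

lemma comp_case_nat: "(\<rho> \<circ> case_nat r vm) 0 = \<rho> r" "(\<lambda>i. (\<rho> \<circ> case_nat r vm) (Suc i)) = \<rho> \<circ> vm"
  by (simp_all add: comp_def)

lemma case_nat_less:
  fixes vm :: "nat \<Rightarrow> nat"
  assumes "\<forall>i. vm i < k" "k \<le> r" "r < k'"
  shows "\<forall>i. case_nat r vm i < k'"
proof
  fix i show "case_nat r vm i < k'"
    using assms by (cases i) (auto intro: less_trans less_le_trans)
qed

text \<open>The loop from which products, bounded quantifiers, bounded search and division are
  built. The summation index is variable 0 of the body and the other variables are shifted by one.
  With at most \<open>K ^ D\<close> terms, each at most \<open>(K ^ D) ^ E\<close>, the sum is at
  most \<open>K ^ (D * (E + 1))\<close>.\<close>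

lemma computable_sum:
  assumes n: "computable A a n" and F: "computable A a (\<lambda>x c \<rho>. F x c (\<lambda>i. \<rho> (Suc i)) (\<rho> 0))"
  shows "computable A a (\<lambda>x c \<rho>. \<Sum>v<n x c \<rho>. F x c \<rho> v)"
proof (rule computableI)
  fix vm :: "nat \<Rightarrow> nat" and k assume vm: "\<forall>i. vm i < k"
  define vm' where "vm' = case_nat (k + 2) vm"
  have vm1: "\<forall>i. vm i < Suc k" using vm less_SucI by blast
  have vm3: "\<forall>i. vm' i < k + 3"
    unfolding vm'_def using vm by (rule case_nat_less) auto
  obtain c1 D where c1: "computes A a n vm (Suc k) c1 D" using computableE [OF n vm1] by blast
  obtain c2 E where c2: "computes A a (\<lambda>x c \<rho>. F x c (\<lambda>i. \<rho> (Suc i)) (\<rho> 0)) vm' (k + 3) c2 E"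
    using computableE [OF F vm3] by blast
  let ?body = "c2 ;; Loop (Dec (k + 3)) (Do (Inc k)) ;; Do (Inc (k + 2))"
  let ?code = "c1 ;; Loop (Dec (Suc k)) ?body ;; Loop (Dec (k + 2)) skip"
  have "computes A a (\<lambda>x c \<rho>. \<Sum>v<n x c \<rho>. F x c \<rho> v) vm k ?code (D * (E + 1))"
    unfolding computes_def
  proof (intro conjI allI impI)
    fix x \<sigma> K B assume r: "ready a vm k K B x \<sigma>" and K: "K ^ (D * (E + 1)) < B"
    define N where "N = n x (cat \<sigma>) (regs \<sigma> \<circ> vm)"
    define f where "f = F x (cat \<sigma>) (regs \<sigma> \<circ> vm)"
    \<comment> \<open>The index may reach \<open>K ^ D\<close>, so the body is run with this larger
      bound on its variables.\<close>
    define K1 where "K1 = K ^ D"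
    have K2: "2 \<le> K" using r by (simp add: ready_def)
    have KE: "K1 ^ (E + 1) < B" using K by (simp add: K1_def power_mult [symmetric] power_add [symmetric])
    have K1: "K \<le> K1" using K2 computes_pos [OF c1] self_le_power [of K D] by (simp add: K1_def)
    have K1E: "K1 ^ E < B" "K1 ^ 1 < B" using power_mono_bound [OF KE, of E] power_mono_bound [OF KE, of 1] K1 K2 by simp_all
    have vmr: "regs \<sigma> (vm i) \<le> K1" for i using r K1 unfolding ready_def by (meson le_trans)
    have r0: "regs \<sigma> q < B" "k \<le> q \<Longrightarrow> regs \<sigma> q = 0" "ipos \<sigma> = 0" "cpos \<sigma> = 0" for q
      using r by (auto simp: ready_def)
    have ib: "inbounds B \<sigma>" by (rule ready_inbounds [OF r])
    \<comment> \<open>Register \<open>k\<close> accumulates the sum, \<open>k + 1\<close> counts the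
      remaining rounds, \<open>k + 2\<close> holds the index and \<open>k + 3\<close> receives the
      next term.\<close>
    define S where "S b i j = \<sigma>\<lparr>regs := (regs \<sigma>)(k := \<Sum>v<j. f v, k + 1 := N - i, k + 2 := j, k + 3 := b)\<rparr>" for b i j
    have D: "N \<le> K1" "bigstep A x B c1 \<sigma> (\<sigma>\<lparr>regs := (regs \<sigma>)(Suc k := N)\<rparr>)"
      using computesD [OF c1 ready_le [OF r] _ N_def refl] K1E(2) by (simp_all add: K1_def)
    have S0: "\<sigma>\<lparr>regs := (regs \<sigma>)(Suc k := N)\<rparr> = S 0 0 0"
      using r0(2) by (auto simp: S_def intro!: cstate_regs_eqI)
    have ready': "ready a vm' (k + 3) K1 B x (S 0 i j)" if "(\<Sum>v<j. f v) < B" "j \<le> N" for i j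
    proof (rule ready_weaken [OF r K1])
      show "\<forall>i'. vm' i' < k + 3 \<and> regs (S 0 i j) (vm' i') \<le> K1"
      proof
        fix i'
        show "vm' i' < k + 3 \<and> regs (S 0 i j) (vm' i') \<le> K1"
        proof (cases i')
          case 0
          then show ?thesis using D that by (simp add: S_def vm'_def)
        next
          case (Suc l)
          have "vm l < k" using vm by blast
          then show ?thesis using Suc vmr [of l] by (simp add: S_def vm'_def)
        qed
      qed
    qed (use that r0 K1E D r in \<open>auto simp: S_def ready_def\<close>)
    have vmS: "regs (S b i j) \<circ> vm = regs \<sigma> \<circ> vm" for b i j
    proof (rule ext)
      fix i' have "vm i' < k" using vm by blast
      then show "(regs (S b i j) \<circ> vm) i' = (regs \<sigma> \<circ> vm) i'" by (simp add: S_def)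
    qed
    have vj: "f j = F x (cat (S b i j)) (\<lambda>l. (regs (S b i j) \<circ> vm') (Suc l)) ((regs (S b i j) \<circ> vm') 0)" for b i j
      unfolding vm'_def comp_case_nat vmS by (simp add: S_def f_def)
    \<comment> \<open>The bound on the next term presupposes that the partial sum fits below B,
      hence the induction.\<close>
    have sum: "(\<Sum>v<j. f v) \<le> j * K1 ^ E" if "j \<le> N" for j
      using that
    proof (induction j)
      case (Suc j)
      have lt: "(\<Sum>v<j. f v) < B"
      proof -
        have "(\<Sum>v<j. f v) \<le> j * K1 ^ E" using Suc by simp
        also have "\<dots> \<le> K1 * K1 ^ E" using Suc.prems D(1) by (intro mult_right_mono) auto
        finally show ?thesis using KE by simp
      qed
      have "f j \<le> K1 ^ E"
        by (rule computesD(1) [OF c2 ready' [of j j] K1E(1) vj refl]) (use lt Suc.prems in simp_all)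
      then show ?case using Suc by simp
    qed simp
    have sumB: "(\<Sum>v<j. f v) \<le> K1 ^ (E + 1)" if "j \<le> N" for j
    proof -
      have "(\<Sum>v<j. f v) \<le> j * K1 ^ E" using sum that by simp
      also have "\<dots> \<le> K1 * K1 ^ E" using that D(1) by (intro mult_right_mono) auto
      finally show ?thesis by simp
    qed
    have total: "(\<Sum>v<N. f v) \<le> K ^ (D * (E + 1))" using sumB [of N] unfolding K1_def power_mult by simp
    then show "(\<Sum>v<n x (cat \<sigma>) (regs \<sigma> \<circ> vm). F x (cat \<sigma>) (regs \<sigma> \<circ> vm) v) \<le> K ^ (D * (E + 1))"
      by (simp add: N_def f_def)
    have ibS: "inbounds B (S b i j)" if "j \<le> N" "b < B" for b i j
      using ib that D(1) le_less_trans [OF sumB [OF that(1)] KE] K1E(2) by (simp add: S_def inbounds_def less_imp_diff_less)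
    have loop: "bigstep A x B (Loop (Dec (Suc k)) ?body) (S 0 0 0) (S 0 N N)"
    proof (rule bigstep_Loop_Dec [where S = "\<lambda>j. S 0 j j" and n = N])
      fix j assume j: "j < N"
      have s1: "(\<Sum>v<j. f v) < B" "(\<Sum>v<Suc j. f v) < B"
        using le_less_trans [OF sumB KE] j by (meson Suc_leI less_imp_le)+
      have e0: "(S 0 j j)\<lparr>regs := (regs (S 0 j j))(Suc k := N - Suc j)\<rparr> = S 0 (Suc j) j"
        by (auto simp: S_def intro!: cstate_regs_eqI)
      note b1 = computesD [OF c2 ready' [where i = "Suc j", OF s1(1) less_imp_le [OF j]] K1E(1) vj refl]
      have e1: "(S 0 (Suc j) j)\<lparr>regs := (regs (S 0 (Suc j) j))(k + 3 := f j)\<rparr> = S (f j) (Suc j) j"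
        by (auto simp: S_def intro!: cstate_regs_eqI)
      let ?m = "\<sigma>\<lparr>regs := (regs \<sigma>)(k := \<Sum>v<Suc j. f v, k + 1 := N - Suc j, k + 2 := j, k + 3 := 0)\<rparr>"
      have fB: "f j < B" using b1(1) j K1E(1) by simp
      have b2: "bigstep A x B (Loop (Dec (k + 3)) (Do (Inc k))) (S (f j) (Suc j) j) ?m"
        by (rule bigstep_move)
           (use s1 ibS fB j in \<open>auto simp: S_def intro!: cstate_regs_eqI\<close>)
      have b3: "bigstep A x B (Do (Inc (k + 2))) ?m (S 0 (Suc j) (Suc j))"
        by (rule bigstep_Inc)
           (use s1 ib j D(1) K1E in \<open>auto simp: S_def inbounds_def intro!: cstate_regs_eqI\<close>)
      show "bigstep A x B ?body ((S 0 j j)\<lparr>regs := (regs (S 0 j j))(Suc k := N - Suc j)\<rparr>) (S 0 (Suc j) (Suc j))"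
        unfolding e0
        by (rule bigstep.Seq [OF _ bigstep.Seq [OF b2 b3]]) (use b1(2) in \<open>simp only: e1\<close>)
    qed (simp add: S_def, rule ibS, assumption, use r0(1) [of 0] in simp, rule refl, rule refl)
    have fin: "bigstep A x B (Loop (Dec (k + 2)) skip) (S 0 N N) (\<sigma>\<lparr>regs := (regs \<sigma>)(k := \<Sum>v<N. f v)\<rparr>)"
      by (rule bigstep_clear)
         (use r0 ibS [of N 0 N] ib in \<open>auto simp: S_def intro!: cstate_regs_eqI\<close>)
    show "bigstep A x B ?code \<sigma> (\<sigma>\<lparr>regs := (regs \<sigma>)(k :=
        \<Sum>v<n x (cat \<sigma>) (regs \<sigma> \<circ> vm). F x (cat \<sigma>) (regs \<sigma> \<circ> vm) v)\<rparr>)"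
      using bigstep.Seq [OF D(2) [unfolded S0] bigstep.Seq [OF loop fin]] by (simp add: N_def f_def)
  qed (use computes_pos [OF c1] in simp)
  then show "\<exists>c D. computes A a (\<lambda>x c \<rho>. \<Sum>v<n x c \<rho>. F x c \<rho> v) vm k c D" by blast
qed

definition input_bit :: "bool list \<Rightarrow> nat \<Rightarrow> bool" where
  "input_bit x p \<longleftrightarrow> p < length x \<and> x ! p"

lemma of_bool_le_power: "2 \<le> K \<Longrightarrow> of_bool b \<le> (K::nat) ^ D"
  using one_le_power [of K D] by (cases b) auto

lemma bigstep_Put:
  "inbounds B \<sigma> \<Longrightarrow> \<sigma>' = (if t then \<sigma>\<lparr>outp := outp \<sigma> @ [b]\<rparr> else \<sigma>\<lparr>qry := qry \<sigma> @ [b]\<rparr>) \<Longrightarrow>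
     bigstep A x B (Do (Put t b)) \<sigma> \<sigma>'"
  by (rule bigstep.Do) (auto simp: inbounds_def)

text \<open>The computed position is below B and hence on the tape. The head walks there while a
  second counter records the distance for the way back.\<close>

lemma computable_cat:
  assumes "computable A a f"
  shows "computable A a (\<lambda>x c \<rho>. of_bool (c ! f x c \<rho>))"
proof (rule computableI)
  fix vm :: "nat \<Rightarrow> nat" and k assume vm: "\<forall>i. vm i < k"
  obtain c D where c: "computes A a f vm k c D" using computableE [OF assms vm] by blast
  let ?l1 = "Loop (Dec k) (Do (Inc (Suc k)) ;; Do (CatMove MoveR))"
  let ?l2 = "Loop (Dec (Suc k)) (Do (CatMove MoveL))"
  let ?code = "c ;; ?l1 ;; Cond CatGet (Do (Inc k)) skip ;; ?l2"
  have "computes A a (\<lambda>x c \<rho>. of_bool (c ! f x c \<rho>)) vm k ?code D"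
    unfolding computes_def
  proof (intro conjI allI impI)
    fix x \<sigma> K B assume r: "ready a vm k K B x \<sigma>" and K: "K ^ D < B"
    define v where "v = f x (cat \<sigma>) (regs \<sigma> \<circ> vm)"
    have K2: "2 \<le> K" "K < B" using r by (simp_all add: ready_def)
    show "of_bool (cat \<sigma> ! f x (cat \<sigma>) (regs \<sigma> \<circ> vm)) \<le> K ^ D" using K2 by (rule_tac of_bool_le_power)
    note f = computesD [OF c r K v_def refl]
    have ib: "inbounds B \<sigma>" by (rule ready_inbounds [OF r])
    have r0: "regs \<sigma> k = 0" "regs \<sigma> (Suc k) = 0" "cpos \<sigma> = 0" "ipos \<sigma> = 0" "v < length (cat \<sigma>)" "v < B"
      using r K f(1) by (auto simp: ready_def)
    define S where "S b j p = \<sigma>\<lparr>regs := (regs \<sigma>)(k := b, Suc k := j), cpos := p\<rparr>" for b j p :: nat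
    have ibS: "inbounds B (S b j p)" if "b < B" "j < B" "p < length (cat \<sigma>)" for b j p
      using that ib by (simp add: S_def inbounds_def)
    have S0: "\<sigma>\<lparr>regs := (regs \<sigma>)(k := v)\<rparr> = S v 0 0"
      using r0 by (auto simp: S_def intro!: cstate.equality)
    have l1: "bigstep A x B ?l1 (S v 0 0) (S 0 v v)"
    proof (rule bigstep_Loop_Dec [where S = "\<lambda>j. S (v - j) j j" and n = v])
      fix j assume j: "j < v"
      have "bigstep A x B (Do (Inc (Suc k))) ((S (v - j) j j)\<lparr>regs := (regs (S (v - j) j j))(k := v - Suc j)\<rparr>) (S (v - Suc j) (Suc j) j)"
        by (rule bigstep_Inc) (use j r0 ib in \<open>auto simp: S_def inbounds_def intro!: cstate.equality\<close>)
      moreover have "bigstep A x B (Do (CatMove MoveR)) (S (v - Suc j) (Suc j) j) (S (v - Suc j) (Suc j) (Suc j))"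
        by (rule bigstep.Do) (use j r0 ib in \<open>auto simp: S_def inbounds_def\<close>)
      ultimately show "bigstep A x B (Do (Inc (Suc k)) ;; Do (CatMove MoveR))
          ((S (v - j) j j)\<lparr>regs := (regs (S (v - j) j j))(k := v - Suc j)\<rparr>) (S (v - Suc j) (Suc j) (Suc j))"
        by (rule bigstep.Seq)
    qed (use ibS r0 in \<open>auto simp: S_def\<close>)
    let ?b = "of_bool (cat \<sigma> ! v) :: nat"
    have br: "bigstep A x B (Cond CatGet (Do (Inc k)) skip) (S 0 v v) (S ?b v v)"
    proof (rule bigstep.Cond [where b = "cat \<sigma> ! v"])
      show "bigstep A x B (if cat \<sigma> ! v then Do (Inc k) else skip) (S 0 v v) (S ?b v v)"
      proof (cases "cat \<sigma> ! v")
        case True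
        then show ?thesis
          using r0 ibS [of 0 v v] K2 by (auto simp: S_def intro!: bigstep_Inc cstate.equality)
      next
        case False
        then show ?thesis
          using r0 ibS [of 0 v v] bigstep_skip [of B "S 0 v v"] by (simp add: S_def)
      qed
    qed (use ibS [of 0 v v] r0 in \<open>auto simp: S_def\<close>)
    have bB: "?b < B" using K2 by (cases "cat \<sigma> ! v") auto
    have l2: "bigstep A x B ?l2 (S ?b v v) (S ?b 0 0)"
    proof (rule bigstep_Loop_Dec [where S = "\<lambda>j. S ?b (v - j) (v - j)" and n = v])
      fix j assume j: "j < v"
      show "bigstep A x B (Do (CatMove MoveL)) ((S ?b (v - j) (v - j))\<lparr>regs := (regs (S ?b (v - j) (v - j)))(Suc k := v - Suc j)\<rparr>)
          (S ?b (v - Suc j) (v - Suc j))"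
        by (rule bigstep.Do) (use j r0 ibS [of ?b "v - Suc j" "v - Suc j"] bB in \<open>auto simp: S_def intro!: cstate.equality\<close>)
    qed (use ibS r0 bB in \<open>auto simp: S_def\<close>)
    have "S ?b 0 0 = \<sigma>\<lparr>regs := (regs \<sigma>)(k := ?b)\<rparr>"
      using r0 by (auto simp: S_def intro!: cstate.equality)
    then show "bigstep A x B ?code \<sigma> (\<sigma>\<lparr>regs := (regs \<sigma>)(k := of_bool (cat \<sigma> ! f x (cat \<sigma>) (regs \<sigma> \<circ> vm)))\<rparr>)"
      using bigstep.Seq [OF f(2) [unfolded S0] bigstep.Seq [OF l1 bigstep.Seq [OF br l2]]] by (simp add: v_def)
  qed (rule computes_pos [OF c])
  then show "\<exists>c D. computes A a (\<lambda>x c \<rho>. of_bool (c ! f x c \<rho>)) vm k c D" by blast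
qed

lemma bigstep_InMove:
  "inbounds B \<sigma> \<Longrightarrow> \<sigma>' = \<sigma>\<lparr>ipos := shift_input x d (ipos \<sigma>)\<rparr> \<Longrightarrow> bigstep A x B (Do (InMove d)) \<sigma> \<sigma>'"
  by (rule bigstep.Do) (auto simp: inbounds_def)

lemma computable_input_bit:
  assumes "computable A a f"
  shows "computable A a (\<lambda>x c \<rho>. of_bool (input_bit x (f x c \<rho>)))"
proof (rule computableI)
  fix vm :: "nat \<Rightarrow> nat" and k assume vm: "\<forall>i. vm i < k"
  obtain c D where c: "computes A a f vm k c D" using computableE [OF assms vm] by blast
  let ?l1 = "Loop (Dec k) (Do (Inc (Suc k)) ;; Do (InMove MoveR))"
  let ?l2 = "Loop (Dec (Suc k)) (Do (InMove MoveL))"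
  let ?cond = "Cond (InIsnt (Bit True)) skip (Do (Inc k))"
  let ?code = "c ;; ?l1 ;; Do (InMove MoveR) ;; ?cond ;; Do (InMove MoveL) ;; ?l2"
  have "computes A a (\<lambda>x c \<rho>. of_bool (input_bit x (f x c \<rho>))) vm k ?code D"
    unfolding computes_def
  proof (intro conjI allI impI)
    fix x \<sigma> K B assume r: "ready a vm k K B x \<sigma>" and K: "K ^ D < B"
    define v where "v = f x (cat \<sigma>) (regs \<sigma> \<circ> vm)"
    define n where "n = length x"
    have K2: "2 \<le> K" "K < B" using r by (simp_all add: ready_def)
    show "of_bool (input_bit x (f x (cat \<sigma>) (regs \<sigma> \<circ> vm))) \<le> K ^ D" using K2 by (rule_tac of_bool_le_power)
    note f = computesD [OF c r K v_def refl]
    have ib: "inbounds B \<sigma>" by (rule ready_inbounds [OF r])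
    have r0: "regs \<sigma> k = 0" "regs \<sigma> (Suc k) = 0" "ipos \<sigma> = 0" "v < B"
      using r K f(1) by (auto simp: ready_def)
    define S where "S b j p = \<sigma>\<lparr>regs := (regs \<sigma>)(k := b, Suc k := j), ipos := p\<rparr>" for b j p :: nat
    have ibS: "inbounds B (S b j p)" if "b < B" "j < B" for b j p
      using that ib by (simp add: S_def inbounds_def)
    have S0: "\<sigma>\<lparr>regs := (regs \<sigma>)(k := v)\<rparr> = S v 0 0"
      using r0 by (auto simp: S_def intro!: cstate.equality)
    \<comment> \<open>The head stops at the right marker while the counter goes on, so its position
      after \<open>j\<close> moves is \<open>min j (n + 1)\<close>.\<close>
    have l1: "bigstep A x B ?l1 (S v 0 0) (S 0 v (min v (n + 1)))"
    proof (rule bigstep_Loop_Dec [where S = "\<lambda>j. S (v - j) j (min j (n + 1))" and n = v])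
      fix j assume j: "j < v"
      let ?\<sigma> = "(S (v - j) j (min j (n + 1)))\<lparr>regs := (regs (S (v - j) j (min j (n + 1))))(k := v - Suc j)\<rparr>"
      have "bigstep A x B (Do (Inc (Suc k))) ?\<sigma> (S (v - Suc j) (Suc j) (min j (n + 1)))"
        by (rule bigstep_Inc) (use j r0 ib in \<open>auto simp: S_def inbounds_def intro!: cstate.equality\<close>)
      moreover have "bigstep A x B (Do (InMove MoveR)) (S (v - Suc j) (Suc j) (min j (n + 1))) (S (v - Suc j) (Suc j) (min (Suc j) (n + 1)))"
        by (rule bigstep_InMove) (use j r0 ibS [of "v - Suc j" "Suc j"] in \<open>auto simp: S_def shift_input_def n_def\<close>)
      ultimately show "bigstep A x B (Do (Inc (Suc k)) ;; Do (InMove MoveR)) ?\<sigma> (S (v - Suc j) (Suc j) (min (Suc j) (n + 1)))"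
        by (rule bigstep.Seq)
    qed (use ibS r0 in \<open>auto simp: S_def\<close>)
    let ?p = "min (v + 1) (n + 1)"
    have mv: "bigstep A x B (Do (InMove MoveR)) (S 0 v (min v (n + 1))) (S 0 v ?p)"
      by (rule bigstep_InMove) (use r0 ibS [of 0 v] in \<open>auto simp: S_def shift_input_def n_def\<close>)
    have bit: "read_input x ?p = Bit True \<longleftrightarrow> input_bit x v"
      by (auto simp: read_input_def input_bit_def n_def min_def)
    let ?b = "of_bool (input_bit x v) :: nat"
    have br: "bigstep A x B ?cond (S 0 v ?p) (S ?b v ?p)"
    proof (rule bigstep.Cond [where b = "\<not> input_bit x v"])
      show "op_sem A x (InIsnt (Bit True)) (S 0 v ?p) = (S 0 v ?p, \<not> input_bit x v)"
        using bit by (simp add: S_def)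
      show "bigstep A x B (if \<not> input_bit x v then skip else Do (Inc k)) (S 0 v ?p) (S ?b v ?p)"
      proof (cases "input_bit x v")
        case True
        then show ?thesis
          using r0 ibS [of 0 v] K2 by (auto simp: S_def intro!: bigstep_Inc cstate.equality)
      next
        case False
        then show ?thesis
          using r0 ibS [of 0 v ?p] by (auto simp: S_def shift_input_def n_def intro!: bigstep_InMove)
      qed
    qed (use ibS [of 0 v] r0 in auto)
    have bB: "?b < B" using K2 by (cases "input_bit x v") auto
    have mv': "bigstep A x B (Do (InMove MoveL)) (S ?b v ?p) (S ?b v (min v n))"
      by (rule bigstep_InMove) (use r0 bB ibS [of ?b v] in \<open>auto simp: S_def shift_input_def n_def\<close>)
    \<comment> \<open>From \<open>min v n\<close>, a total of \<open>v\<close> left moves reaches 0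
      in any case, since a left move at the left end has no effect.\<close>
    have l2: "bigstep A x B ?l2 (S ?b v (min v n)) (S ?b 0 0)"
    proof (rule bigstep_Loop_Dec [where S = "\<lambda>j. S ?b (v - j) (min v n - j)" and n = v])
      fix j assume j: "j < v"
      show "bigstep A x B (Do (InMove MoveL)) ((S ?b (v - j) (min v n - j))\<lparr>regs := (regs (S ?b (v - j) (min v n - j)))(Suc k := v - Suc j)\<rparr>)
          (S ?b (v - Suc j) (min v n - Suc j))"
        by (rule bigstep_InMove)
           (use j r0 ib bB in \<open>auto simp: S_def inbounds_def shift_input_def n_def intro!: cstate.equality\<close>)
    qed (use ibS r0 bB in \<open>auto simp: S_def\<close>)
    have "S ?b 0 0 = \<sigma>\<lparr>regs := (regs \<sigma>)(k := ?b)\<rparr>"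
      using r0 by (auto simp: S_def intro!: cstate.equality)
    then show "bigstep A x B ?code \<sigma> (\<sigma>\<lparr>regs := (regs \<sigma>)(k := of_bool (input_bit x (f x (cat \<sigma>) (regs \<sigma> \<circ> vm))))\<rparr>)"
      using bigstep.Seq [OF f(2) [unfolded S0] bigstep.Seq [OF l1 bigstep.Seq [OF mv bigstep.Seq [OF br bigstep.Seq [OF mv' l2]]]]]
      by (simp add: v_def)
  qed (rule computes_pos [OF c])
  then show "\<exists>c D. computes A a (\<lambda>x c \<rho>. of_bool (input_bit x (f x c \<rho>))) vm k c D" by blast
qed

lemma bigstep_Loop_InIsnt:
  assumes "\<And>j. j < n \<Longrightarrow> read_input x (ipos (S j)) \<noteq> a" "read_input x (ipos (S n)) = a"
    and "\<And>j. j \<le> n \<Longrightarrow> inbounds B (S j)" "\<And>j. j < n \<Longrightarrow> bigstep A x B c (S j) (S (Suc j))"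
  shows "bigstep A x B (Loop (InIsnt a) c) (S 0) (S n)"
proof -
  have "bigstep A x B (Loop (InIsnt a) c) (S (n - i)) (S n)" if "i \<le> n" for i
    using that
  proof (induction i)
    case 0
    then show ?case using assms(2,3) by (auto intro!: bigstep.Loop_end)
  next
    case (Suc i)
    have j: "n - Suc i < n" "Suc (n - Suc i) = n - i" using Suc.prems by auto
    show ?case
      by (rule bigstep.Loop_step [where \<sigma>' = "S (n - Suc i)" and \<sigma>'' = "S (n - i)"])
         (use assms(1) [OF j(1)] assms(3) [of "n - Suc i"] assms(4) [OF j(1)] j Suc in auto)
  qed
  from this [of n] show ?thesis by simp
qed

lemma computable_length: "computable A a (\<lambda>x c \<rho>. length x)"
proof (rule computableI)
  fix vm :: "nat \<Rightarrow> nat" and k assume vm: "\<forall>i. vm i < k"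
  let ?l1 = "Loop (InIsnt RightMark) (Do (Inc k) ;; Do (InMove MoveR))"
  let ?l2 = "Loop (InIsnt LeftMark) (Do (InMove MoveL))"
  let ?code = "Do (InMove MoveR) ;; ?l1 ;; ?l2"
  have "computes A a (\<lambda>x c \<rho>. length x) vm k ?code 1"
    unfolding computes_def
  proof (intro conjI allI impI)
    fix x \<sigma> K B assume r: "ready a vm k K B x \<sigma>" and K: "K ^ 1 < B"
    define n where "n = length x"
    show "length x \<le> K ^ 1" using r by (simp add: ready_def)
    have ib: "inbounds B \<sigma>" by (rule ready_inbounds [OF r])
    have r0: "regs \<sigma> k = 0" "ipos \<sigma> = 0" "n < B"
      using r K by (auto simp: ready_def n_def)
    define S where "S j p = \<sigma>\<lparr>regs := (regs \<sigma>)(k := j), ipos := p\<rparr>" for j p :: nat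
    have ibS: "inbounds B (S j p)" if "j < B" for j p
      using that ib by (simp add: S_def inbounds_def)
    have S0: "\<sigma> = S 0 0" using r0 by (auto simp: S_def intro!: cstate.equality)
    have mv: "bigstep A x B (Do (InMove MoveR)) (S 0 0) (S 0 (Suc 0))"
      by (rule bigstep_InMove) (use r0 ibS [of 0] in \<open>auto simp: S_def shift_input_def\<close>)
    have l1: "bigstep A x B ?l1 (S 0 (Suc 0)) (S n (Suc n))"
    proof (rule bigstep_Loop_InIsnt [where S = "\<lambda>j. S j (Suc j)" and n = n])
      fix j assume j: "j < n"
      have "bigstep A x B (Do (Inc k)) (S j (Suc j)) (S (Suc j) (Suc j))"
        by (rule bigstep_Inc) (use j r0 ib in \<open>auto simp: S_def inbounds_def\<close>)
      moreover have "bigstep A x B (Do (InMove MoveR)) (S (Suc j) (Suc j)) (S (Suc j) (Suc (Suc j)))"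
        by (rule bigstep_InMove) (use j r0 ibS [of "Suc j"] in \<open>auto simp: S_def shift_input_def n_def\<close>)
      ultimately show "bigstep A x B (Do (Inc k) ;; Do (InMove MoveR)) (S j (Suc j)) (S (Suc j) (Suc (Suc j)))"
        by (rule bigstep.Seq)
    qed (use ibS r0 in \<open>auto simp: S_def read_input_def n_def\<close>)
    have l2: "bigstep A x B ?l2 (S n (Suc n - 0)) (S n (Suc n - Suc n))"
    proof (rule bigstep_Loop_InIsnt [where S = "\<lambda>j. S n (Suc n - j)" and n = "Suc n"])
      fix j assume j: "j < Suc n"
      show "bigstep A x B (Do (InMove MoveL)) (S n (Suc n - j)) (S n (Suc n - Suc j))"
        by (rule bigstep_InMove) (use j r0 ibS [of n] in \<open>auto simp: S_def shift_input_def n_def\<close>)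
    qed (use ibS r0 in \<open>auto simp: S_def read_input_def n_def\<close>)
    have "S n 0 = \<sigma>\<lparr>regs := (regs \<sigma>)(k := n)\<rparr>"
      using r0 by (auto simp: S_def intro!: cstate.equality)
    then show "bigstep A x B ?code \<sigma> (\<sigma>\<lparr>regs := (regs \<sigma>)(k := length x)\<rparr>)"
      using bigstep.Seq [OF mv bigstep.Seq [OF l1 l2 [unfolded diff_self_eq_0 minus_nat.diff_0]]] S0 by (simp add: n_def)
  qed simp
  then show "\<exists>c D. computes A a (\<lambda>x c \<rho>. length x) vm k c D" by blast
qed

subsection \<open>Procedures\<close>

definition put :: "bool \<Rightarrow> bool list \<Rightarrow> cstate \<Rightarrow> cstate" where
  "put t w \<sigma> = (if t then \<sigma>\<lparr>outp := outp \<sigma> @ w\<rparr> else \<sigma>\<lparr>qry := qry \<sigma> @ w\<rparr>)"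

lemma put_simps [simp]:
  "regs (put t w \<sigma>) = regs \<sigma>" "ipos (put t w \<sigma>) = ipos \<sigma>" "cat (put t w \<sigma>) = cat \<sigma>"
  "cpos (put t w \<sigma>) = cpos \<sigma>" "put t w' (put t w \<sigma>) = put t (w @ w') \<sigma>" "put t [] \<sigma> = \<sigma>"
  "(put t w \<sigma>)\<lparr>regs := \<rho>\<rparr> = put t w (\<sigma>\<lparr>regs := \<rho>\<rparr>)" "(put t w \<sigma>)\<lparr>cat := c\<rparr> = put t w (\<sigma>\<lparr>cat := c\<rparr>)"
  by (simp_all add: put_def)

lemma qry_put: "t \<Longrightarrow> qry (put t w \<sigma>) = qry \<sigma>"
  by (simp add: put_def)

text \<open>
  A procedure maps the catalytic tape to a new one and writes a word, on the output tape if
  \<open>t\<close> holds and on the query tape otherwise.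
\<close>

definition performs ::
  "bool list set \<Rightarrow> bool \<Rightarrow> (bool list \<Rightarrow> bool list \<Rightarrow> (nat \<Rightarrow> nat) \<Rightarrow> bool list \<times> bool list) \<Rightarrow>
   (nat \<Rightarrow> nat) \<Rightarrow> nat \<Rightarrow> code \<Rightarrow> nat \<Rightarrow> bool" where
  "performs A t F vm k c D \<longleftrightarrow> 0 < D \<and>
     (\<forall>x \<sigma> K B. ready t vm k K B x \<sigma> \<longrightarrow> K ^ D < B \<longrightarrow>
        bigstep A x B c \<sigma> (put t (snd (F x (cat \<sigma>) (regs \<sigma> \<circ> vm)))
          (\<sigma>\<lparr>cat := fst (F x (cat \<sigma>) (regs \<sigma> \<circ> vm))\<rparr>)))"

text \<open>Preservation of the tape length is part of the notion because \<open>ready\<close> must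
  hold again for whatever runs next.\<close>

definition procedure ::
  "bool list set \<Rightarrow> bool \<Rightarrow> (bool list \<Rightarrow> bool list \<Rightarrow> (nat \<Rightarrow> nat) \<Rightarrow> bool list \<times> bool list) \<Rightarrow> bool" where
  "procedure A t F \<longleftrightarrow> (\<forall>x c \<rho>. length (fst (F x c \<rho>)) = length c) \<and>
     (\<forall>vm k. (\<forall>i. vm i < k) \<longrightarrow> (\<exists>c D. performs A t F vm k c D))"

lemma procedure_length: "procedure A t F \<Longrightarrow> length (fst (F x c \<rho>)) = length c"
  by (simp add: procedure_def)

lemma procedureE:
  assumes "procedure A t F" "\<forall>i. vm i < k"
  obtains c D where "performs A t F vm k c D"
  using assms unfolding procedure_def by meson

lemma performs_pos: "performs A t F vm k c D \<Longrightarrow> 0 < D"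
  unfolding performs_def by blast

lemma performsD:
  assumes "performs A t F vm k c D" "ready t vm k K B x \<sigma>" "K ^ D < B"
    and "F x (cat \<sigma>) (regs \<sigma> \<circ> vm) = (c', w)" "\<sigma>' = put t w (\<sigma>\<lparr>cat := c'\<rparr>)"
  shows "bigstep A x B c \<sigma> \<sigma>'"
  using assms unfolding performs_def by (metis fst_conv snd_conv)

lemma procedure_emit:
  assumes P: "computable A t (\<lambda>x c \<rho>. of_bool (P x c \<rho>))"
  shows "procedure A t (\<lambda>x c \<rho>. (c, [P x c \<rho>]))"
  unfolding procedure_def
proof (intro conjI allI impI)
  fix vm :: "nat \<Rightarrow> nat" and k assume vm: "\<forall>i. vm i < k"
  obtain c D where c: "computes A t (\<lambda>x c \<rho>. of_bool (P x c \<rho>)) vm k c D"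
    using computableE [OF P vm] by blast
  have "performs A t (\<lambda>x c \<rho>. (c, [P x c \<rho>])) vm k (c ;; Cond (Dec k) (Do (Put t True)) (Do (Put t False))) D"
    unfolding performs_def
  proof (intro conjI allI impI)
    fix x \<sigma> K B assume r: "ready t vm k K B x \<sigma>" and K: "K ^ D < B"
    define b where "b = P x (cat \<sigma>) (regs \<sigma> \<circ> vm)"
    have r0: "regs \<sigma> k = 0" "1 < B" using r by (auto simp: ready_def)
    have e: "bigstep A x B c \<sigma> (\<sigma>\<lparr>regs := (regs \<sigma>)(k := of_bool b)\<rparr>)"
      by (rule computesD(2) [OF c r K refl]) (simp add: b_def)
    have "bigstep A x B (Cond (Dec k) (Do (Put t True)) (Do (Put t False)))
        (\<sigma>\<lparr>regs := (regs \<sigma>)(k := of_bool b)\<rparr>) (put t [b] \<sigma>)"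
    proof (rule bigstep.Cond [where b = b and \<sigma>' = \<sigma>])
      show "op_sem A x (Dec k) (\<sigma>\<lparr>regs := (regs \<sigma>)(k := of_bool b)\<rparr>) = (\<sigma>, b)"
        using r0 by (cases b) (auto intro!: cstate_regs_idI)
      show "bigstep A x B (if b then Do (Put t True) else Do (Put t False)) \<sigma> (put t [b] \<sigma>)"
        using ready_inbounds [OF r] by (cases b) (auto simp: put_def intro!: bigstep_Put)
    qed (rule ready_inbounds [OF r])
    with e show "bigstep A x B (c ;; Cond (Dec k) (Do (Put t True)) (Do (Put t False))) \<sigma>
        (put t (snd (cat \<sigma>, [P x (cat \<sigma>) (regs \<sigma> \<circ> vm)])) (\<sigma>\<lparr>cat := fst (cat \<sigma>, [P x (cat \<sigma>) (regs \<sigma> \<circ> vm)])\<rparr>))"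
      by (simp add: b_def bigstep.Seq)
  qed (rule computes_pos [OF c])
  then show "\<exists>c D. performs A t (\<lambda>x c \<rho>. (c, [P x c \<rho>])) vm k c D" by blast
qed simp

lemma procedure_write:
  assumes "computable A t f" "computable A t (\<lambda>x c \<rho>. of_bool (P x c \<rho>))"
  shows "procedure A t (\<lambda>x c \<rho>. (c[f x c \<rho> := P x c \<rho>], []))"
  unfolding procedure_def
proof (intro conjI allI impI)
  fix vm :: "nat \<Rightarrow> nat" and k assume vm: "\<forall>i. vm i < k"
  obtain c D where c: "computes_pair A t f (\<lambda>x c \<rho>. of_bool (P x c \<rho>)) vm k c D"
    using computes_pairE [OF assms vm] by blast
  let ?l1 = "Loop (Dec k) (Do (Inc (k + 2)) ;; Do (CatMove MoveR))"
  let ?l2 = "Loop (Dec (k + 2)) (Do (CatMove MoveL))"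
  let ?cond = "Cond (Dec (Suc k)) (Do (CatSet True)) (Do (CatSet False))"
  let ?code = "c ;; ?l1 ;; ?cond ;; ?l2"
  have "performs A t (\<lambda>x c \<rho>. (c[f x c \<rho> := P x c \<rho>], [])) vm k ?code D"
    unfolding performs_def
  proof (intro conjI allI impI)
    show "0 < D" using c unfolding computes_pair_def by blast
    fix x \<sigma> K B assume r: "ready t vm k K B x \<sigma>" and K: "K ^ D < B"
    define v where "v = f x (cat \<sigma>) (regs \<sigma> \<circ> vm)"
    define b where "b = P x (cat \<sigma>) (regs \<sigma> \<circ> vm)"
    define e :: nat where "e = of_bool b"
    have e_def': "e = of_bool (P x (cat \<sigma>) (regs \<sigma> \<circ> vm))" by (simp add: e_def b_def)
    note p = computes_pairD [OF c r K v_def e_def']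
    have ib: "inbounds B \<sigma>" by (rule ready_inbounds [OF r])
    have r0: "regs \<sigma> k = 0" "regs \<sigma> (Suc k) = 0" "regs \<sigma> (k + 2) = 0" "cpos \<sigma> = 0" "v < length (cat \<sigma>)" "v < B" "e < B" "0 < B"
      using r K p(1) by (auto simp: ready_def)
    define S where "S i l j q cs = \<sigma>\<lparr>regs := (regs \<sigma>)(k := i, Suc k := l, k + 2 := j), cpos := q, cat := cs\<rparr>"
      for i l j q :: nat and cs
    have ibS: "inbounds B (S i l j q cs)" if "i < B" "l < B" "j < B" "q < length cs" for i l j q cs
      using that ib by (simp add: S_def inbounds_def)
    have S0: "\<sigma>\<lparr>regs := (regs \<sigma>)(k := v, Suc k := e)\<rparr> = S v e 0 0 (cat \<sigma>)"
      using r0 by (auto simp: S_def intro!: cstate.equality)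
    have l1: "bigstep A x B ?l1 (S v e 0 0 (cat \<sigma>)) (S 0 e v v (cat \<sigma>))"
    proof (rule bigstep_Loop_Dec [where S = "\<lambda>j. S (v - j) e j j (cat \<sigma>)" and n = v])
      fix j assume j: "j < v"
      let ?\<sigma> = "(S (v - j) e j j (cat \<sigma>))\<lparr>regs := (regs (S (v - j) e j j (cat \<sigma>)))(k := v - Suc j)\<rparr>"
      have "bigstep A x B (Do (Inc (k + 2))) ?\<sigma> (S (v - Suc j) e (Suc j) j (cat \<sigma>))"
        by (rule bigstep_Inc) (use j r0 ib in \<open>auto simp: S_def inbounds_def intro!: cstate.equality\<close>)
      moreover have "bigstep A x B (Do (CatMove MoveR)) (S (v - Suc j) e (Suc j) j (cat \<sigma>)) (S (v - Suc j) e (Suc j) (Suc j) (cat \<sigma>))"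
        by (rule bigstep.Do) (use j r0 ib in \<open>auto simp: S_def inbounds_def\<close>)
      ultimately show "bigstep A x B (Do (Inc (k + 2)) ;; Do (CatMove MoveR)) ?\<sigma> (S (v - Suc j) e (Suc j) (Suc j) (cat \<sigma>))"
        by (rule bigstep.Seq)
    qed (use ib r0 in \<open>auto simp: S_def inbounds_def less_imp_diff_less\<close>)
    let ?cs = "(cat \<sigma>)[v := b]"
    have br: "bigstep A x B ?cond (S 0 e v v (cat \<sigma>)) (S 0 0 v v ?cs)"
    proof (rule bigstep.Cond [where b = b and \<sigma>' = "S 0 0 v v (cat \<sigma>)"])
      show "op_sem A x (Dec (Suc k)) (S 0 e v v (cat \<sigma>)) = (S 0 0 v v (cat \<sigma>), b)"
        by (cases b) (auto simp: S_def e_def intro!: cstate.equality)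
      show "bigstep A x B (if b then Do (CatSet True) else Do (CatSet False)) (S 0 0 v v (cat \<sigma>)) (S 0 0 v v ?cs)"
        using r0 ibS [of 0 0 v v ?cs] by (cases b) (auto simp: S_def intro!: bigstep.Do)
    qed (use ibS r0 in auto)
    have l2: "bigstep A x B ?l2 (S 0 0 v v ?cs) (S 0 0 0 0 ?cs)"
    proof (rule bigstep_Loop_Dec [where S = "\<lambda>j. S 0 0 (v - j) (v - j) ?cs" and n = v])
      fix j assume j: "j < v"
      show "bigstep A x B (Do (CatMove MoveL)) ((S 0 0 (v - j) (v - j) ?cs)\<lparr>regs := (regs (S 0 0 (v - j) (v - j) ?cs))(k + 2 := v - Suc j)\<rparr>)
          (S 0 0 (v - Suc j) (v - Suc j) ?cs)"
        by (rule bigstep.Do) (use j r0 ibS [of 0 0 "v - Suc j" "v - Suc j" ?cs] in \<open>auto simp: S_def intro!: cstate.equality\<close>)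
    qed (use ibS r0 in \<open>auto simp: S_def\<close>)
    have "S 0 0 0 0 ?cs = \<sigma>\<lparr>cat := ?cs\<rparr>"
      using r0 by (auto simp: S_def intro!: cstate.equality)
    then show "bigstep A x B ?code \<sigma> (put t (snd ((cat \<sigma>)[f x (cat \<sigma>) (regs \<sigma> \<circ> vm) := P x (cat \<sigma>) (regs \<sigma> \<circ> vm)], []))
        (\<sigma>\<lparr>cat := fst ((cat \<sigma>)[f x (cat \<sigma>) (regs \<sigma> \<circ> vm) := P x (cat \<sigma>) (regs \<sigma> \<circ> vm)], [])\<rparr>))"
      using bigstep.Seq [OF p(2) [unfolded S0] bigstep.Seq [OF l1 bigstep.Seq [OF br l2]]] by (simp add: v_def b_def)
  qed
  then show "\<exists>c D. performs A t (\<lambda>x c \<rho>. (c[f x c \<rho> := P x c \<rho>], [])) vm k c D" by blast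
qed simp

definition seq_proc where
  "seq_proc F G x c \<rho> =
     (let (c1, w1) = F x c \<rho>; (c2, w2) = G x c1 \<rho> in (c2, w1 @ w2))"

text \<open>Here \<open>t\<close> acts in its double role: a procedure writing output leaves the
  query tape empty and may consult the oracle in between, whereas one writing a query must do
  without it.\<close>

lemma ready_put:
  assumes "ready t vm k K B x \<sigma>" "length c = length (cat \<sigma>)"
  shows "ready t vm k K B x (put t w (\<sigma>\<lparr>cat := c\<rparr>))"
  using assms by (auto simp: ready_def qry_put)

lemma procedure_seq:
  assumes F: "procedure A t F" and G: "procedure A t G"
  shows "procedure A t (seq_proc F G)"
  unfolding procedure_def
proof (intro conjI allI impI)
  show "length (fst (seq_proc F G x c \<rho>)) = length c" for x c \<rho>
    using procedure_length [OF F, of x c \<rho>] procedure_length [OF G, of x "fst (F x c \<rho>)" \<rho>]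
    by (auto simp: seq_proc_def split: prod.split)
next
  fix vm :: "nat \<Rightarrow> nat" and k assume vm: "\<forall>i. vm i < k"
  obtain c D where c: "performs A t F vm k c D" using procedureE [OF F vm] by blast
  obtain c' E where c': "performs A t G vm k c' E" using procedureE [OF G vm] by blast
  have "performs A t (seq_proc F G) vm k (c ;; c') (D + E)"
    unfolding performs_def
  proof (intro conjI allI impI)
    show "0 < D + E" using performs_pos [OF c] by simp
    fix x \<sigma> K B assume r: "ready t vm k K B x \<sigma>" and K: "K ^ (D + E) < B"
    have "2 \<le> K" using r by (simp add: ready_def)
    then have K': "K ^ D < B" "K ^ E < B" using power_mono_bound [OF K, of D] power_mono_bound [OF K, of E] by auto
    obtain c1 w1 where F1: "F x (cat \<sigma>) (regs \<sigma> \<circ> vm) = (c1, w1)" by fastforce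
    obtain c2 w2 where G1: "G x c1 (regs \<sigma> \<circ> vm) = (c2, w2)" by fastforce
    have l: "length c1 = length (cat \<sigma>)" using procedure_length [OF F] F1 by (metis fst_conv)
    note b1 = performsD [OF c r K'(1) F1 refl]
    have b2: "bigstep A x B c' (put t w1 (\<sigma>\<lparr>cat := c1\<rparr>)) (put t (w1 @ w2) (\<sigma>\<lparr>cat := c2\<rparr>))"
      by (rule performsD [OF c' ready_put [OF r l] K'(2)]) (simp_all add: G1)
    show "bigstep A x B (c ;; c') \<sigma> (put t (snd (seq_proc F G x (cat \<sigma>) (regs \<sigma> \<circ> vm)))
        (\<sigma>\<lparr>cat := fst (seq_proc F G x (cat \<sigma>) (regs \<sigma> \<circ> vm))\<rparr>))"
      using bigstep.Seq [OF b1 b2] by (simp add: seq_proc_def F1 G1)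
  qed
  then show "\<exists>c D. performs A t (seq_proc F G) vm k c D" by blast
qed

lemma procedure_if:
  assumes P: "computable A t (\<lambda>x c \<rho>. of_bool (P x c \<rho>))" and F: "procedure A t F" and G: "procedure A t G"
  shows "procedure A t (\<lambda>x c \<rho>. if P x c \<rho> then F x c \<rho> else G x c \<rho>)"
  unfolding procedure_def
proof (intro conjI allI impI)
  fix vm :: "nat \<Rightarrow> nat" and k assume vm: "\<forall>i. vm i < k"
  obtain e C where e: "computes A t (\<lambda>x c \<rho>. of_bool (P x c \<rho>)) vm k e C"
    using computableE [OF P vm] by blast
  obtain c D where c: "performs A t F vm k c D" using procedureE [OF F vm] by blast
  obtain c' E where c': "performs A t G vm k c' E" using procedureE [OF G vm] by blast
  have "performs A t (\<lambda>x c \<rho>. if P x c \<rho> then F x c \<rho> else G x c \<rho>) vm k (e ;; Cond (Dec k) c c') (C + D + E)"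
    unfolding performs_def
  proof (intro conjI allI impI)
    show "0 < C + D + E" using performs_pos [OF c] by simp
    fix x \<sigma> K B assume r: "ready t vm k K B x \<sigma>" and K: "K ^ (C + D + E) < B"
    have K2: "2 \<le> K" using r by (simp add: ready_def)
    have K': "K ^ C < B" "K ^ D < B" "K ^ E < B"
      using power_mono_bound [OF K, of C] power_mono_bound [OF K, of D] power_mono_bound [OF K, of E] K2 by auto
    define b where "b = P x (cat \<sigma>) (regs \<sigma> \<circ> vm)"
    define X where "X = (if b then F x (cat \<sigma>) (regs \<sigma> \<circ> vm) else G x (cat \<sigma>) (regs \<sigma> \<circ> vm))"
    have r0: "regs \<sigma> k = 0" using r by (auto simp: ready_def)
    have b1: "bigstep A x B e \<sigma> (\<sigma>\<lparr>regs := (regs \<sigma>)(k := of_bool b)\<rparr>)"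
      by (rule computesD(2) [OF e r K'(1) refl]) (simp add: b_def)
    have b2: "bigstep A x B (Cond (Dec k) c c') (\<sigma>\<lparr>regs := (regs \<sigma>)(k := of_bool b)\<rparr>) (put t (snd X) (\<sigma>\<lparr>cat := fst X\<rparr>))"
    proof (rule bigstep.Cond [where b = b and \<sigma>' = \<sigma>])
      show "op_sem A x (Dec k) (\<sigma>\<lparr>regs := (regs \<sigma>)(k := of_bool b)\<rparr>) = (\<sigma>, b)"
        using r0 by (cases b) (auto intro!: cstate_regs_idI)
      show "bigstep A x B (if b then c else c') \<sigma> (put t (snd X) (\<sigma>\<lparr>cat := fst X\<rparr>))"
        using performsD [OF c r K'(2) prod.collapse [symmetric] refl] performsD [OF c' r K'(3) prod.collapse [symmetric] refl]
        by (cases b) (simp_all add: X_def)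
    qed (rule ready_inbounds [OF r])
    show "bigstep A x B (e ;; Cond (Dec k) c c') \<sigma>
        (put t (snd (if P x (cat \<sigma>) (regs \<sigma> \<circ> vm) then F x (cat \<sigma>) (regs \<sigma> \<circ> vm) else G x (cat \<sigma>) (regs \<sigma> \<circ> vm)))
        (\<sigma>\<lparr>cat := fst (if P x (cat \<sigma>) (regs \<sigma> \<circ> vm) then F x (cat \<sigma>) (regs \<sigma> \<circ> vm) else G x (cat \<sigma>) (regs \<sigma> \<circ> vm))\<rparr>))"
      using bigstep.Seq [OF b1 b2] unfolding X_def b_def .
  qed
  then show "\<exists>c D. performs A t (\<lambda>x c \<rho>. if P x c \<rho> then F x c \<rho> else G x c \<rho>) vm k c D" by blast
qed (use procedure_length [OF F] procedure_length [OF G] in simp)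

text \<open>\<open>e\<close> is evaluated once, on the tape as it is before \<open>F\<close> changes
  it. Its value stays in a register as variable 0 of \<open>F\<close> and is cleared
  afterwards.\<close>

lemma procedure_let:
  assumes e: "computable A t e" and F: "procedure A t (\<lambda>x c \<rho>. F x c (\<lambda>i. \<rho> (Suc i)) (\<rho> 0))"
  shows "procedure A t (\<lambda>x c \<rho>. F x c \<rho> (e x c \<rho>))"
  unfolding procedure_def
proof (intro conjI allI impI)
  show "length (fst (F x c \<rho> (e x c \<rho>))) = length c" for x c \<rho>
    using procedure_length [OF F, of x c "case_nat (e x c \<rho>) \<rho>"] by simp
next
  fix vm :: "nat \<Rightarrow> nat" and k assume vm: "\<forall>i. vm i < k"
  define vm' where "vm' = case_nat k vm"
  have vm1: "\<forall>i. vm' i < Suc k" unfolding vm'_def using vm by (rule case_nat_less) auto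
  obtain c D where c: "computes A t e vm k c D" using computableE [OF e vm] by blast
  obtain c' E where c': "performs A t (\<lambda>x c \<rho>. F x c (\<lambda>i. \<rho> (Suc i)) (\<rho> 0)) vm' (Suc k) c' E"
    using procedureE [OF F vm1] by blast
  let ?code = "c ;; c' ;; Loop (Dec k) skip"
  have "performs A t (\<lambda>x c \<rho>. F x c \<rho> (e x c \<rho>)) vm k ?code (D * E)"
    unfolding performs_def
  proof (intro conjI allI impI)
    show "0 < D * E" using performs_pos [OF c'] computes_pos [OF c] by simp
    fix x \<sigma> K B assume r: "ready t vm k K B x \<sigma>" and K: "K ^ (D * E) < B"
    define v where "v = e x (cat \<sigma>) (regs \<sigma> \<circ> vm)"
    define K1 where "K1 = K ^ D"
    have K2: "2 \<le> K" using r by (simp add: ready_def)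
    have KE: "K1 ^ E < B" using K by (simp add: K1_def power_mult)
    have KD: "K ^ D < B" using power_mono_bound [OF K, of D] K2 performs_pos [OF c'] by simp
    have K1: "K \<le> K1" using K2 computes_pos [OF c] self_le_power [of K D] by (simp add: K1_def)
    note b1 = computesD [OF c r KD v_def refl]
    let ?\<sigma> = "\<sigma>\<lparr>regs := (regs \<sigma>)(k := v)\<rparr>"
    have r': "ready t vm' (Suc k) K1 B x ?\<sigma>"
    proof (rule ready_weaken [OF r K1])
      show "\<forall>i. vm' i < Suc k \<and> regs ?\<sigma> (vm' i) \<le> K1"
      proof
        fix i
        show "vm' i < Suc k \<and> regs ?\<sigma> (vm' i) \<le> K1"
        proof (cases i)
          case 0
          then show ?thesis using b1(1) by (simp add: vm'_def K1_def)
        next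
          case (Suc l)
          have "vm l < k" "regs \<sigma> (vm l) \<le> K" using vm r by (auto simp: ready_def)
          then show ?thesis using Suc K1 by (simp add: vm'_def)
        qed
      qed
    qed (use r KD b1(1) in \<open>auto simp: ready_def K1_def\<close>)
    obtain c1 w1 where F1: "F x (cat \<sigma>) (regs \<sigma> \<circ> vm) v = (c1, w1)" by fastforce
    have "regs ?\<sigma> \<circ> vm = regs \<sigma> \<circ> vm" using upd_comp_vm [OF vm, of k "regs \<sigma>" v] by simp
    then have F2: "F x (cat ?\<sigma>) (\<lambda>i. (regs ?\<sigma> \<circ> vm') (Suc i)) ((regs ?\<sigma> \<circ> vm') 0) = (c1, w1)"
      unfolding vm'_def comp_case_nat using F1 by simp
    note b2 = performsD [OF c' r' KE F2 refl]
    have l: "length c1 = length (cat \<sigma>)"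
      using procedure_length [OF F, of x "cat \<sigma>" "case_nat v (regs \<sigma> \<circ> vm)"] F1 by (simp add: comp_def)
    have b3: "bigstep A x B (Loop (Dec k) skip) (put t w1 (?\<sigma>\<lparr>cat := c1\<rparr>)) (put t w1 (\<sigma>\<lparr>cat := c1\<rparr>))"
      by (rule bigstep_clear)
         (use r b1(1) KD l in \<open>auto simp: ready_def inbounds_def put_def intro!: cstate.equality\<close>)
    show "bigstep A x B ?code \<sigma> (put t (snd (F x (cat \<sigma>) (regs \<sigma> \<circ> vm) (e x (cat \<sigma>) (regs \<sigma> \<circ> vm))))
        (\<sigma>\<lparr>cat := fst (F x (cat \<sigma>) (regs \<sigma> \<circ> vm) (e x (cat \<sigma>) (regs \<sigma> \<circ> vm)))\<rparr>))"
      using bigstep.Seq [OF b1(2) bigstep.Seq [OF b2 b3]] F1 by (simp add: v_def)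
  qed
  then show "\<exists>c D. performs A t (\<lambda>x c \<rho>. F x c \<rho> (e x c \<rho>)) vm k c D" by blast
qed

fun iterate :: "(nat \<Rightarrow> bool list \<Rightarrow> bool list \<times> bool list) \<Rightarrow> nat \<Rightarrow> bool list \<Rightarrow> bool list \<times> bool list" where
  "iterate f 0 c = (c, [])"
| "iterate f (Suc j) c =
     (fst (f j (fst (iterate f j c))), snd (iterate f j c) @ snd (f j (fst (iterate f j c))))"

lemma procedure_for:
  assumes n: "computable A t n" and F: "procedure A t (\<lambda>x c \<rho>. F x c (\<lambda>i. \<rho> (Suc i)) (\<rho> 0))"
  shows "procedure A t (\<lambda>x c \<rho>. iterate (\<lambda>v c. F x c \<rho> v) (n x c \<rho>) c)"
  unfolding procedure_def
proof (intro conjI allI impI)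
  have lenF: "length (fst (F x c \<rho> v)) = length c" for x c \<rho> v
    using procedure_length [OF F, of x c "case_nat v \<rho>"] by simp
  have len: "length (fst (iterate (\<lambda>v c. F x c \<rho> v) j c)) = length c" for x c \<rho> j
    by (induction j) (simp_all add: lenF)
  show "length (fst (iterate (\<lambda>v c. F x c \<rho> v) (n x c \<rho>) c)) = length c" for x c \<rho>
    by (rule len)
  fix vm :: "nat \<Rightarrow> nat" and k assume vm: "\<forall>i. vm i < k"
  define vm' where "vm' = case_nat (Suc k) vm"
  have vm1: "\<forall>i. vm' i < k + 2" unfolding vm'_def using vm by (rule case_nat_less) auto
  obtain c D where c: "computes A t n vm k c D" using computableE [OF n vm] by blast
  obtain c' E where c': "performs A t (\<lambda>x c \<rho>. F x c (\<lambda>i. \<rho> (Suc i)) (\<rho> 0)) vm' (k + 2) c' E"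
    using procedureE [OF F vm1] by blast
  let ?loop = "Loop (Dec k) (c' ;; Do (Inc (Suc k)))"
  let ?code = "c ;; ?loop ;; Loop (Dec (Suc k)) skip"
  have "performs A t (\<lambda>x c \<rho>. iterate (\<lambda>v c. F x c \<rho> v) (n x c \<rho>) c) vm k ?code (D * E)"
    unfolding performs_def
  proof (intro conjI allI impI)
    show "0 < D * E" using performs_pos [OF c'] computes_pos [OF c] by simp
    fix x \<sigma> K B assume r: "ready t vm k K B x \<sigma>" and K: "K ^ (D * E) < B"
    define N where "N = n x (cat \<sigma>) (regs \<sigma> \<circ> vm)"
    define I where "I j = iterate (\<lambda>v c. F x c (regs \<sigma> \<circ> vm) v) j (cat \<sigma>)" for j
    define K1 where "K1 = K ^ D"
    have K2: "2 \<le> K" using r by (simp add: ready_def)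
    have KE: "K1 ^ E < B" using K by (simp add: K1_def power_mult)
    have KD: "K ^ D < B" using power_mono_bound [OF K, of D] K2 performs_pos [OF c'] by simp
    have K1: "K \<le> K1" using K2 computes_pos [OF c] self_le_power [of K D] by (simp add: K1_def)
    note b1 = computesD [OF c r KD N_def refl]
    have lenI: "length (fst (I j)) = length (cat \<sigma>)" for j unfolding I_def by (rule len)
    define S where "S i j l = put t (snd (I l)) (\<sigma>\<lparr>cat := fst (I l), regs := (regs \<sigma>)(k := i, Suc k := j)\<rparr>)" for i j l
    have r0: "regs \<sigma> q < B" "k \<le> q \<Longrightarrow> regs \<sigma> q = 0" "ipos \<sigma> = 0" "cpos \<sigma> = 0" "t \<Longrightarrow> qry \<sigma> = []" "0 < length (cat \<sigma>)" for q
      using r by (auto simp: ready_def)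
    have S0: "\<sigma>\<lparr>regs := (regs \<sigma>)(k := N)\<rparr> = S N 0 0"
      using r0(2) by (auto simp: S_def I_def intro!: cstate.equality)
    have ibS: "inbounds B (S i j l)" if "i \<le> N" "j \<le> N" for i j l
      using that b1(1) KD r0 lenI [of l] by (simp add: S_def inbounds_def)
    have ready': "ready t vm' (k + 2) K1 B x (S i j l)" if "i \<le> N" "j \<le> N" for i j l
    proof (rule ready_weaken [OF r K1])
      show "\<forall>i'. vm' i' < k + 2 \<and> regs (S i j l) (vm' i') \<le> K1"
      proof
        fix i'
        show "vm' i' < k + 2 \<and> regs (S i j l) (vm' i') \<le> K1"
        proof (cases i')
          case 0
          then show ?thesis using b1(1) that by (simp add: S_def vm'_def K1_def)
        next
          case (Suc q)
          have "vm q < k" "regs \<sigma> (vm q) \<le> K" using vm r by (auto simp: ready_def)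
          then show ?thesis using Suc K1 by (simp add: S_def vm'_def)
        qed
      qed
    qed (use that r0 KD b1(1) lenI in \<open>auto simp: S_def K1_def qry_put\<close>)
    have loop: "bigstep A x B ?loop (S N 0 0) (S 0 N N)"
    proof (rule bigstep_Loop_Dec [where S = "\<lambda>j. S (N - j) j j" and n = N])
      fix j assume j: "j < N"
      have e: "(S (N - j) j j)\<lparr>regs := (regs (S (N - j) j j))(k := N - Suc j)\<rparr> = S (N - Suc j) j j"
        by (auto simp: S_def put_def intro!: cstate.equality)
      have "regs (S (N - Suc j) j j) \<circ> vm = regs \<sigma> \<circ> vm"
      proof (rule ext)
        fix i' have "vm i' < k" using vm by blast
        then show "(regs (S (N - Suc j) j j) \<circ> vm) i' = (regs \<sigma> \<circ> vm) i'" by (simp add: S_def)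
      qed
      then have F1: "F x (cat (S (N - Suc j) j j)) (\<lambda>i. (regs (S (N - Suc j) j j) \<circ> vm') (Suc i)) ((regs (S (N - Suc j) j j) \<circ> vm') 0)
          = F x (fst (I j)) (regs \<sigma> \<circ> vm) j"
        unfolding vm'_def comp_case_nat by (simp add: S_def)
      obtain c1 w1 where F2: "F x (fst (I j)) (regs \<sigma> \<circ> vm) j = (c1, w1)" by fastforce
      have I: "fst (I (Suc j)) = c1" "snd (I (Suc j)) = snd (I j) @ w1"
        using F2 by (simp_all add: I_def)
      have rr: "ready t vm' (k + 2) K1 B x (S (N - Suc j) j j)" using ready' j by simp
      have b2: "bigstep A x B c' (S (N - Suc j) j j) (S (N - Suc j) j (Suc j))"
        by (rule performsD [OF c' rr KE F1 [unfolded F2]]) (simp add: S_def I put_def)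
      have b3: "bigstep A x B (Do (Inc (Suc k))) (S (N - Suc j) j (Suc j)) (S (N - Suc j) (Suc j) (Suc j))"
        by (rule bigstep_Inc)
           (use ibS [of "N - Suc j" j "Suc j"] j b1(1) KD in \<open>auto simp: S_def put_def intro!: cstate.equality\<close>)
      show "bigstep A x B (c' ;; Do (Inc (Suc k))) ((S (N - j) j j)\<lparr>regs := (regs (S (N - j) j j))(k := N - Suc j)\<rparr>) (S (N - Suc j) (Suc j) (Suc j))"
        unfolding e using b2 b3 by (rule bigstep.Seq)
    qed (use ibS in \<open>auto simp: S_def\<close>)
    have b4: "bigstep A x B (Loop (Dec (Suc k)) skip) (S 0 N N) (put t (snd (I N)) (\<sigma>\<lparr>cat := fst (I N)\<rparr>))"
      by (rule bigstep_clear)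
         (use r0 ibS [of 0 N N] in \<open>auto simp: S_def put_def intro!: cstate.equality\<close>)
    show "bigstep A x B ?code \<sigma> (put t (snd (iterate (\<lambda>v c. F x c (regs \<sigma> \<circ> vm) v) (n x (cat \<sigma>) (regs \<sigma> \<circ> vm)) (cat \<sigma>)))
        (\<sigma>\<lparr>cat := fst (iterate (\<lambda>v c. F x c (regs \<sigma> \<circ> vm) v) (n x (cat \<sigma>) (regs \<sigma> \<circ> vm)) (cat \<sigma>))\<rparr>))"
      using bigstep.Seq [OF b1(2) [unfolded S0] bigstep.Seq [OF loop b4]] unfolding I_def N_def .
  qed
  then show "\<exists>c D. performs A t (\<lambda>x c \<rho>. iterate (\<lambda>v c. F x c \<rho> v) (n x c \<rho>) c) vm k c D" by blast
qed

text \<open>The text of the query is generated in the mode without oracle calls. Asking empties the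
  query tape again, so the answer belongs to the mode with oracle calls.\<close>

lemma computable_ask:
  assumes G: "procedure A False (\<lambda>x c \<rho>. (c, g x c \<rho>))"
  shows "computable A True (\<lambda>x c \<rho>. of_bool (g x c \<rho> \<in> A))"
proof (rule computableI)
  fix vm :: "nat \<Rightarrow> nat" and k assume vm: "\<forall>i. vm i < k"
  obtain c D where c: "performs A False (\<lambda>x c \<rho>. (c, g x c \<rho>)) vm k c D" using procedureE [OF G vm] by blast
  have "computes A True (\<lambda>x c \<rho>. of_bool (g x c \<rho> \<in> A)) vm k (c ;; Cond Ask (Do (Inc k)) skip) D"
    unfolding computes_def
  proof (intro conjI allI impI)
    fix x \<sigma> K B assume r: "ready True vm k K B x \<sigma>" and K: "K ^ D < B"
    define w where "w = g x (cat \<sigma>) (regs \<sigma> \<circ> vm)"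
    have K2: "2 \<le> K" using r by (simp add: ready_def)
    then show "of_bool (g x (cat \<sigma>) (regs \<sigma> \<circ> vm) \<in> A) \<le> K ^ D" by (rule of_bool_le_power)
    have r': "ready False vm k K B x \<sigma>" using r by (simp add: ready_def)
    have r0: "regs \<sigma> k = 0" "1 < B" "qry \<sigma> = []" "ipos \<sigma> = 0" using r by (auto simp: ready_def)
    note ib = ready_inbounds [OF r]
    have b1: "bigstep A x B c \<sigma> (\<sigma>\<lparr>qry := w\<rparr>)"
      by (rule performsD [OF c r' K refl]) (simp add: put_def w_def r0)
    have b2: "bigstep A x B (Cond Ask (Do (Inc k)) skip) (\<sigma>\<lparr>qry := w\<rparr>) (\<sigma>\<lparr>regs := (regs \<sigma>)(k := of_bool (w \<in> A))\<rparr>)"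
    proof (rule bigstep.Cond [where b = "w \<in> A" and \<sigma>' = \<sigma>])
      show "op_sem A x Ask (\<sigma>\<lparr>qry := w\<rparr>) = (\<sigma>, w \<in> A)"
        using r0 by (auto intro!: cstate.equality)
      show "bigstep A x B (if w \<in> A then Do (Inc k) else skip) \<sigma> (\<sigma>\<lparr>regs := (regs \<sigma>)(k := of_bool (w \<in> A))\<rparr>)"
      proof (cases "w \<in> A")
        case True
        then show ?thesis using r0 ib by (auto intro!: bigstep_Inc)
      next
        case False
        then have "\<sigma>\<lparr>regs := (regs \<sigma>)(k := of_bool (w \<in> A))\<rparr> = \<sigma>" using r0 by (auto intro!: cstate_regs_idI)
        then show ?thesis using False bigstep_skip [OF ib] r0 by simp
      qed
    qed (rule ib)
    show "bigstep A x B (c ;; Cond Ask (Do (Inc k)) skip) \<sigma>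
        (\<sigma>\<lparr>regs := (regs \<sigma>)(k := of_bool (g x (cat \<sigma>) (regs \<sigma> \<circ> vm) \<in> A))\<rparr>)"
      using bigstep.Seq [OF b1 b2] by (simp add: w_def)
  qed (rule performs_pos [OF c])
  then show "\<exists>c D. computes A True (\<lambda>x c \<rho>. of_bool (g x c \<rho> \<in> A)) vm k c D" by blast
qed

subsection \<open>Machines from programs\<close>

lemma ex_register_bound:
  fixes P :: flat_code
  shows "\<exists>R. \<forall>p<length P. \<forall>r. fst (P ! p) \<in> {Inc r, Dec r} \<longrightarrow> r < R"
proof -
  define f where "f i = (case fst i of Inc r \<Rightarrow> r | Dec r \<Rightarrow> r | _ \<Rightarrow> 0)" for i :: "counter_op \<times> nat \<times> nat"
  have "r < Suc (sum_list (map f P))" if "p < length P" "fst (P ! p) \<in> {Inc r, Dec r}" for p r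
  proof -
    have "f (P ! p) = r" using that(2) by (auto simp: f_def)
    moreover have "f (P ! p) \<le> sum_list (map f P)"
      using that(1) by (intro member_le_sum_list) auto
    ultimately show ?thesis by simp
  qed
  then show ?thesis by blast
qed

text \<open>A number of binary digits such that \<open>2 ^ width D n\<close> exceeds
  \<open>(n + 2) ^ D\<close>, but by a factor of at most 4. The same power of two will bound the
  counters and be the length of the catalytic tape.\<close>

definition width :: "nat \<Rightarrow> nat \<Rightarrow> nat" where
  "width D n = nat \<lceil>real D * log 2 (real n + 2)\<rceil> + 1"

lemma width_upper: "real (width D n) \<le> real D * log 2 (real n + 2) + 2"
proof -
  have "0 \<le> real D * log 2 (real n + 2)" by simp
  then show ?thesis unfolding width_def by linarith
qed

lemma powr_log_eq_power: "2 powr (real D * log 2 (real n + 2)) = (real n + 2) ^ D"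
proof -
  have "2 powr (real D * log 2 (real n + 2)) = (2 powr log 2 (real n + 2)) powr real D"
    by (simp only: powr_powr mult.commute)
  also have "\<dots> = (real n + 2) powr real D" by simp
  finally show ?thesis by (simp add: powr_realpow)
qed

lemma width_lower: "(n + 2) ^ D < 2 ^ width D n"
proof -
  have "real ((n + 2) ^ D) = 2 powr (real D * log 2 (real n + 2))"
    unfolding powr_log_eq_power by (simp add: add.commute)
  also have "\<dots> < 2 powr (real (width D n))"
    unfolding width_def by (intro powr_less_mono) linarith+
  also have "\<dots> = real (2 ^ width D n)" by (simp add: powr_realpow)
  finally show ?thesis by linarith
qed

lemma logarithmically_bounded_width: "logarithmically_bounded (\<lambda>n. width D n + 2)"
  unfolding logarithmically_bounded_def
proof (rule landau_o.big_trans)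
  show "(\<lambda>n. real (width D n + 2)) \<in> O(\<lambda>n. real D * log 2 (real n + 2) + 4)"
  proof (rule bigoI [of _ 1], rule always_eventually, rule allI)
    fix n
    have "0 \<le> real D * log 2 (real n + 2)" by simp
    then show "norm (real (width D n + 2)) \<le> 1 * norm (real D * log 2 (real n + 2) + 4)"
      using width_upper [of D n] by simp
  qed
  show "(\<lambda>n. real D * log 2 (real n + 2) + 4) \<in> O(\<lambda>n. ln (real n))"
    by real_asymp
qed

lemma polynomially_bounded_width: "polynomially_bounded (\<lambda>n. 2 ^ width D n)"
  unfolding polynomially_bounded_def
proof (rule exI [of _ D], rule landau_o.big_trans)
  show "(\<lambda>n. real (2 ^ width D n)) \<in> O(\<lambda>n. (real n + 2) ^ D)"
  proof (rule bigoI [of _ 4], rule always_eventually, rule allI)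
    fix n
    have "real (2 ^ width D n) = 2 powr (real (width D n))" by (simp add: powr_realpow)
    also have "\<dots> \<le> 2 powr (real D * log 2 (real n + 2) + 2)"
      using width_upper by (intro powr_mono) auto
    also have "\<dots> = 4 * (real n + 2) ^ D"
      unfolding powr_add powr_log_eq_power by (simp add: powr_numeral)
    finally show "norm (real (2 ^ width D n)) \<le> 4 * norm ((real n + 2) ^ D)" by simp
  qed
  show "(\<lambda>n. (real n + 2) ^ D) \<in> O(\<lambda>n. real n ^ D)"
    by (intro landau_o.big_power) real_asymp
qed

text \<open>The machine decides \<open>P\<close>, rejects with the catalytic tape untouched if it
  fails, and runs \<open>F\<close> otherwise. Correctness is demanded only for tapes of length at
  least \<open>(length x + 2) ^ e\<close>, since the amount of catalytic space is chosen together
  with the machine.\<close>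

lemma CL_oracleI:
  assumes P: "computable A True (\<lambda>x c \<rho>. of_bool (P x c \<rho>))" and F: "procedure A True F"
    and correct: "\<And>x \<tau>. (length x + 2) ^ e \<le> length \<tau> \<Longrightarrow>
      if P x \<tau> (\<lambda>_. 0) then fst (F x \<tau> (\<lambda>_. 0)) = \<tau> \<and> Some (snd (F x \<tau> (\<lambda>_. 0))) \<in> S x
      else None \<in> S x"
  shows "S \<in> CL_oracle A"
proof -
  \<comment> \<open>A complete program has no free variables: all are placed at register 0, which is
    zero.\<close>
  let ?vm = "\<lambda>_::nat. 0::nat"
  have vm: "\<forall>i. ?vm i < 1" by simp
  obtain cP D1 where cP: "computes A True (\<lambda>x c \<rho>. of_bool (P x c \<rho>)) ?vm 1 cP D1"
    using computableE [OF P vm] by blast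
  obtain cF D2 where cF: "performs A True F ?vm 1 cF D2" using procedureE [OF F vm] by blast
  define n1 where "n1 = code_size cP"
  define N where "N = n1 + 1 + code_size cF"
  \<comment> \<open>Address N is acceptance and N + 1 rejection. The decrement of register 1 tests
    the value left by \<open>cP\<close> and clears it at the same time.\<close>
  define Q where "Q = flatten cP 0 n1 @ [(Dec 1, n1 + 1, N + 1)] @ flatten cF (n1 + 1) N"
  have lenQ: "length Q = N" by (simp add: Q_def N_def n1_def)
  obtain R where R: "\<And>p r. p < length Q \<Longrightarrow> fst (Q ! p) \<in> {Inc r, Dec r} \<Longrightarrow> r < R"
    using ex_register_bound [of Q] by blast
  define Y where "Y = symbols (length Q) R"
  have finY: "finite Y" unfolding Y_def by (rule finite_symbols)
  have zY: "(\<lambda>_. 0) \<in> Y" by (simp add: Y_def symbols_def)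
  obtain enc where enc: "inj_on enc Y" "enc (\<lambda>_. 0) = (0::nat)" "enc ` Y \<subseteq> {..<card Y}"
    using ex_encoding [OF finY zY] by blast
  \<comment> \<open>One exponent for both programs and for the required tape length; the last
    summand accounts for the bound on \<open>K\<close> itself.\<close>
  define D where "D = D1 + D2 + e + 1"
  define M where "M = machine enc Y Q"
  have targets: "fst (snd (Q ! p)) \<le> Suc (length Q) \<and> snd (snd (Q ! p)) \<le> Suc (length Q)" if "p < length Q" for p
  proof -
    have "Q ! p \<in> set Q" using that by simp
    then consider "Q ! p \<in> set (flatten cP 0 n1)" | "Q ! p = (Dec 1, n1 + 1, N + 1)" | "Q ! p \<in> set (flatten cF (n1 + 1) N)"
      unfolding Q_def by auto
    then show ?thesis
    proof cases
      case 1
      from flatten_targets [OF this, of "Suc N"] show ?thesis by (simp add: lenQ) (simp add: N_def n1_def)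
    next
      case 2
      then show ?thesis by (simp add: lenQ) (simp add: N_def)
    next
      case 3
      from flatten_targets [OF this, of "Suc N"] show ?thesis by (simp add: lenQ) (simp add: N_def n1_def)
    qed
  qed
  have "ctm_solves A M (\<lambda>n. width D n + 2) (\<lambda>n. 2 ^ width D n) S"
    unfolding ctm_solves_def Let_def
  proof (intro allI impI)
    fix x \<tau> :: "bool list"
    define d where "d = width D (length x)"
    define K where "K = length x + 2"
    assume "length \<tau> = 2 ^ width D (length x)"
    then have len: "length \<tau> = 2 ^ d" by (simp add: d_def)
    interpret simulation A x Q R "d + 2" d "2 ^ d" enc Y
      by unfold_locales (use enc R targets in \<open>auto simp: Y_def\<close>)
    have KD: "K ^ D < 2 ^ d" unfolding K_def d_def by (rule width_lower)
    have K0: "0 < K" by (simp add: K_def)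
    have K': "K ^ D1 < 2 ^ d" "K ^ D2 < 2 ^ d" "K ^ e < 2 ^ d" "K ^ 1 < 2 ^ d"
      by (rule power_mono_bound [OF KD _ K0], simp add: D_def)+
    define \<sigma> where "\<sigma> = \<lparr>regs = (\<lambda>_. 0), ipos = 0, cat = \<tau>, cpos = 0, outp = [], qry = []\<rparr>"
    have r: "ready True ?vm 1 K (2 ^ d) x \<sigma>"
      using K'(4) len by (simp add: ready_def \<sigma>_def K_def)
    have env: "regs \<sigma> \<circ> ?vm = (\<lambda>_. 0)" by (auto simp: \<sigma>_def)
    define b where "b = P x \<tau> (\<lambda>_. 0)"
    have b1: "bigstep A x (2 ^ d) cP \<sigma> (\<sigma>\<lparr>regs := (regs \<sigma>)(1 := of_bool b)\<rparr>)"
      by (rule computesD(2) [OF cP r K'(1) refl]) (unfold env, simp add: b_def \<sigma>_def)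
    have l1: "located Q 0 (flatten cP 0 n1)"
      unfolding located_def Q_def by (intro exI [of _ "[]"] exI) simp
    have l2: "located Q n1 ([(Dec 1, n1 + 1, N + 1)] @ flatten cF (n1 + 1) N)"
      unfolding located_def Q_def by (intro exI [of _ "flatten cP 0 n1"] exI [of _ "[]"]) (simp add: n1_def)
    note l2' = located_Cons [OF l2 [unfolded append_Cons append_Nil]]
    define F1 where "F1 = F x \<tau> (\<lambda>_. 0)"
    define \<sigma>' where "\<sigma>' = (if b then put True (snd F1) (\<sigma>\<lparr>cat := fst F1\<rparr>) else \<sigma>)"
    have b2: "bigstep A x (2 ^ d) cF \<sigma> (put True (snd F1) (\<sigma>\<lparr>cat := fst F1\<rparr>))"
      by (rule performsD [OF cF r K'(2), of "fst F1" "snd F1"]) (unfold env, simp_all add: F1_def \<sigma>_def)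
    have run2: "flat_run A x (2 ^ d) Q n1 (\<sigma>\<lparr>regs := (regs \<sigma>)(1 := of_bool b)\<rparr>) (if b then N else N + 1) \<sigma>'"
    proof (rule flat_run.flat_step [OF l2'(1,2)])
      show "op_sem A x (Dec 1) (\<sigma>\<lparr>regs := (regs \<sigma>)(1 := of_bool b)\<rparr>) = (\<sigma>, b)"
        by (cases b) (auto simp: \<sigma>_def)
      show "inbounds (2 ^ d) \<sigma>" by (rule ready_inbounds [OF r])
      show "flat_run A x (2 ^ d) Q (if b then n1 + 1 else N + 1) \<sigma> (if b then N else N + 1) \<sigma>'"
        using flat_run_flatten [OF b2 l2'(3)] by (cases b) (simp_all add: \<sigma>'_def flat_run.flat_refl)
    qed
    have fr: "flat_run A x (2 ^ d) Q 0 \<sigma> (if b then N else N + 1) \<sigma>'"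
      using flat_run_flatten [OF b1 l1] run2 by (rule flat_run_trans)
    have init: "represents (\<lambda>_. []) \<sigma>" "run (ctm_init M (d + 2) \<tau>) (conf 0 0 (\<lambda>_. []) 1 \<sigma>)"
      unfolding \<sigma>_def M_def by (rule sim_init [OF len], simp)+
    obtain T where T: "represents T \<sigma>'" "run (conf (4 * 0) 0 (\<lambda>_. []) 1 \<sigma>) (conf (4 * (if b then N else N + 1)) 0 T 1 \<sigma>')"
      using sim_flat_run [OF fr init(1)] by blast
    define C where "C = conf (4 * (if b then N else N + 1)) 0 T 1 \<sigma>'"
    have "run (ctm_init M (d + 2) \<tau>) C"
      unfolding C_def by (rule run_trans [OF init(2) T(2) [unfolded mult_0_right]])
    then obtain t where t: "(ctm_step A M x ^^ t) (ctm_init M (d + 2) \<tau>) = C"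
      "\<forall>u\<le>t. safe ((ctm_step A M x ^^ u) (ctm_init M (d + 2) \<tau>))"
      using run_iterate unfolding M_def by blast
    have C: "cc_state C = 4 * (if b then N else N + 1)" "cc_cat C = cat \<sigma>'" "cc_output C = outp \<sigma>'"
      unfolding C_def conf_def by simp_all
    have halt: "ctm_halted M C"
      by (simp add: ctm_halted_def C M_def machine_def lenQ)
    then have fixed: "(ctm_step A M x ^^ u) C = C" for u
      by (induction u) (simp_all add: ctm_step_def)
    \<comment> \<open>A halted configuration no longer changes, so safety up to time
      \<open>t\<close> is safety at all times.\<close>
    have safe: "safe ((ctm_step A M x ^^ u) (ctm_init M (d + 2) \<tau>))" for u
    proof (cases "u \<le> t")
      case False
      then have "(ctm_step A M x ^^ u) (ctm_init M (d + 2) \<tau>) = (ctm_step A M x ^^ (u - t)) ((ctm_step A M x ^^ t) (ctm_init M (d + 2) \<tau>))"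
        by (simp add: funpow_add [symmetric, THEN fun_cong, unfolded comp_apply])
      then show ?thesis using fixed t by (metis order_refl)
    qed (use t in blast)
    have cor: "if b then fst F1 = \<tau> \<and> Some (snd F1) \<in> S x else None \<in> S x"
      using correct [of x \<tau>] K'(3) len unfolding b_def F1_def K_def by simp
    have "cc_cat C = \<tau>" using cor by (cases b) (auto simp: C \<sigma>'_def \<sigma>_def)
    moreover have "ctm_result M C \<in> S x"
      using cor by (cases b) (auto simp: C ctm_result_def M_def machine_def lenQ \<sigma>'_def \<sigma>_def put_def)
    ultimately show "(\<forall>t. cc_work_pos ((ctm_step A M x ^^ t) (ctm_init M (width D (length x) + 2) \<tau>)) < width D (length x) + 2 \<and>
             cc_cat_pos ((ctm_step A M x ^^ t) (ctm_init M (width D (length x) + 2) \<tau>)) < 2 ^ width D (length x)) \<and>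
        (\<exists>t. ctm_halted M ((ctm_step A M x ^^ t) (ctm_init M (width D (length x) + 2) \<tau>)) \<and>
             cc_cat ((ctm_step A M x ^^ t) (ctm_init M (width D (length x) + 2) \<tau>)) = \<tau> \<and>
             ctm_result M ((ctm_step A M x ^^ t) (ctm_init M (width D (length x) + 2) \<tau>)) \<in> S x)"
      using safe halt t(1) unfolding d_def [symmetric] safe_def
      by (intro conjI allI exI [of _ t]) simp_all
  qed
  moreover have "ctm_wf M"
    unfolding M_def using finY zY by (intro machine_wf) (auto simp: card_gt_0_iff)
  ultimately show ?thesis
    using logarithmically_bounded_width polynomially_bounded_width unfolding CL_oracle_def by blast
qed

subsection \<open>Arithmetic\<close>

abbreviation decidable ::
  "bool list set \<Rightarrow> bool \<Rightarrow> (bool list \<Rightarrow> bool list \<Rightarrow> (nat \<Rightarrow> nat) \<Rightarrow> bool) \<Rightarrow> bool" where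
  "decidable A a P \<equiv> computable A a (\<lambda>x c \<rho>. of_bool (P x c \<rho>))"

lemma computable_cong: "computable A a f \<Longrightarrow> (\<And>x c \<rho>. f x c \<rho> = g x c \<rho>) \<Longrightarrow> computable A a g"
proof -
  assume f: "computable A a f" and eq: "\<And>x c \<rho>. f x c \<rho> = g x c \<rho>"
  have "f = g" using eq by (intro ext)
  with f show ?thesis by simp
qed

lemma computable_mult:
  assumes "computable A a f" "computable A a g"
  shows "computable A a (\<lambda>x c \<rho>. f x c \<rho> * g x c \<rho>)"
proof -
  have "computable A a (\<lambda>x c \<rho>. \<Sum>v<f x c \<rho>. g x c \<rho>)"
    by (rule computable_sum [OF assms(1), where F = "\<lambda>x c \<rho> v. g x c \<rho>"]) (rule computable_rename [OF assms(2)])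
  then show ?thesis by simp
qed

lemma computable_power: "computable A a f \<Longrightarrow> computable A a (\<lambda>x c \<rho>. f x c \<rho> ^ n)"
proof (induction n)
  case 0
  then show ?case using computable_const [of A a 1] by simp
next
  case (Suc n)
  then show ?case using computable_mult [of A a f] by simp
qed

lemma decidable_not:
  assumes "decidable A a P"
  shows "decidable A a (\<lambda>x c \<rho>. \<not> P x c \<rho>)"
  by (rule computable_cong [OF computable_diff [OF computable_const [of A a 1] assms]]) simp

lemma decidable_conj:
  assumes "decidable A a P" "decidable A a Q"
  shows "decidable A a (\<lambda>x c \<rho>. P x c \<rho> \<and> Q x c \<rho>)"
  by (rule computable_cong [OF computable_mult [OF assms]]) simp

text \<open>Truncated subtraction decides the order: \<open>1 - (f - g)\<close> is 1 or 0
  accordingly.\<close>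

lemma decidable_le:
  assumes "computable A a f" "computable A a g"
  shows "decidable A a (\<lambda>x c \<rho>. f x c \<rho> \<le> g x c \<rho>)"
  by (rule computable_cong [OF computable_diff [OF computable_const [of A a 1] computable_diff [OF assms]]]) auto

lemma decidable_less:
  assumes "computable A a f" "computable A a g"
  shows "decidable A a (\<lambda>x c \<rho>. f x c \<rho> < g x c \<rho>)"
  by (rule computable_cong [OF decidable_not [OF decidable_le [OF assms(2,1)]]]) (simp add: not_le)

lemma decidable_eq:
  assumes "computable A a f" "computable A a g"
  shows "decidable A a (\<lambda>x c \<rho>. f x c \<rho> = g x c \<rho>)"
  by (rule computable_cong [OF decidable_conj [OF decidable_le [OF assms] decidable_le [OF assms(2,1)]]])
     (simp add: eq_iff)

lemma decidable_ex:
  assumes "computable A a n" "decidable A a (\<lambda>x c \<rho>. P x c (\<lambda>i. \<rho> (Suc i)) (\<rho> 0))"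
  shows "decidable A a (\<lambda>x c \<rho>. \<exists>v<n x c \<rho>. P x c \<rho> v)"
proof (rule computable_cong)
  show "decidable A a (\<lambda>x c \<rho>. 0 < (\<Sum>v<n x c \<rho>. of_bool (P x c \<rho> v) :: nat))"
    by (rule decidable_less [OF computable_const])
       (rule computable_sum [OF assms(1), where F = "\<lambda>x c \<rho> v. of_bool (P x c \<rho> v)", OF assms(2)])
  fix x c \<rho>
  have "(\<Sum>v<n x c \<rho>. of_bool (P x c \<rho> v) :: nat) = card ({..<n x c \<rho>} \<inter> {v. P x c \<rho> v})"
    by simp
  then show "of_bool (0 < (\<Sum>v<n x c \<rho>. of_bool (P x c \<rho> v) :: nat)) = (of_bool (\<exists>v<n x c \<rho>. P x c \<rho> v) :: nat)"
    by (auto simp: card_gt_0_iff)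
qed

lemma decidable_all:
  assumes "computable A a n" "decidable A a (\<lambda>x c \<rho>. P x c (\<lambda>i. \<rho> (Suc i)) (\<rho> 0))"
  shows "decidable A a (\<lambda>x c \<rho>. \<forall>v<n x c \<rho>. P x c \<rho> v)"
  by (rule computable_cong [OF decidable_not [OF decidable_ex [OF assms(1), where P = "\<lambda>x c \<rho> v. \<not> P x c \<rho> v", OF decidable_not [OF assms(2)]]]])
     simp

lemma computable_if:
  assumes "decidable A a P" "computable A a f" "computable A a g"
  shows "computable A a (\<lambda>x c \<rho>. if P x c \<rho> then f x c \<rho> else g x c \<rho>)"
  by (rule computable_cong [OF computable_add [OF computable_mult [OF assms(1,2)]
        computable_mult [OF decidable_not [OF assms(1)] assms(3)]]]) simp

section \<open>Bounded search\<close>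

definition bounded_least :: "nat \<Rightarrow> (nat \<Rightarrow> bool) \<Rightarrow> nat" where
  "bounded_least n P = (LEAST v. v = n \<or> P v)"

lemma bounded_least_le: "bounded_least n P \<le> n"
  unfolding bounded_least_def by (rule Least_le) simp

lemma bounded_least_holds: "bounded_least n P < n \<Longrightarrow> P (bounded_least n P)"
  using LeastI [of "\<lambda>v. v = n \<or> P v" n] unfolding bounded_least_def by auto

lemma bounded_least_minimal: "v < bounded_least n P \<Longrightarrow> \<not> P v"
  using not_less_Least [of v "\<lambda>v. v = n \<or> P v"] unfolding bounded_least_def by auto

lemma bounded_least_le_witness: "P v \<Longrightarrow> bounded_least n P \<le> v"
  using bounded_least_minimal not_le by blast

lemma bounded_least_eq:
  assumes "v < n" "P v" "\<And>u. u < v \<Longrightarrow> \<not> P u"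
  shows "bounded_least n P = v"
proof (rule antisym [OF bounded_least_le_witness])
  show "v \<le> bounded_least n P"
    using bounded_least_holds [of n P] assms by (meson le_less_trans less_le_trans not_le order_less_imp_le)
qed (rule assms(2))

text \<open>The least solution equals the number of candidates up to which nothing is a solution;
  this turns search into summation.\<close>

lemma bounded_least_eq_sum: "bounded_least n P = (\<Sum>v<n. of_bool (\<forall>u<Suc v. \<not> P u))"
proof -
  have "(\<forall>u<Suc v. \<not> P u) \<longleftrightarrow> v < bounded_least n P" if "v < n" for v
  proof
    assume h: "\<forall>u<Suc v. \<not> P u"
    show "v < bounded_least n P"
    proof (rule ccontr)
      assume "\<not> v < bounded_least n P"
      then have "bounded_least n P < Suc v" "bounded_least n P < n" using that by auto
      then show False using h bounded_least_holds [of n P] by blast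
    qed
  next
    assume "v < bounded_least n P"
    then show "\<forall>u<Suc v. \<not> P u" using bounded_least_minimal [of _ n P] by (auto simp: less_Suc_eq_le)
  qed
  then have "(\<Sum>v<n. of_bool (\<forall>u<Suc v. \<not> P u)) = (\<Sum>v<n. of_bool (v < bounded_least n P) :: nat)"
    by (intro sum.cong) auto
  also have "\<dots> = card ({..<n} \<inter> {v. v < bounded_least n P})" by simp
  also have "{..<n} \<inter> {v. v < bounded_least n P} = {..<bounded_least n P}"
    using bounded_least_le [of n P] by auto
  finally show ?thesis by simp
qed

lemma computable_bounded_least:
  assumes "computable A a n" "decidable A a (\<lambda>x c \<rho>. P x c (\<lambda>i. \<rho> (Suc i)) (\<rho> 0))"
  shows "computable A a (\<lambda>x c \<rho>. bounded_least (n x c \<rho>) (P x c \<rho>))"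
  unfolding bounded_least_eq_sum
proof (rule computable_sum [OF assms(1)])
  \<comment> \<open>Under the second binder variable 0 is the inner candidate, so the outer index,
    now variable 1, has to be skipped.\<close>
  have "decidable A a (\<lambda>x c \<rho>. \<not> P x c (\<lambda>i. \<rho> (Suc (Suc i))) (\<rho> 0))"
    using computable_rename [OF decidable_not [OF assms(2)], of "\<lambda>i. case i of 0 \<Rightarrow> 0 | Suc j \<Rightarrow> Suc (Suc j)"] by simp
  then show "decidable A a (\<lambda>x c \<rho>. \<forall>u<Suc (\<rho> 0). \<not> P x c (\<lambda>i. \<rho> (Suc i)) u)"
    by (intro decidable_all [where P = "\<lambda>x c \<rho> u. \<not> P x c (\<lambda>i. \<rho> (Suc i)) u"] computable_Suc computable_var)
qed

lemma computable_div:
  assumes "computable A a f" "computable A a g"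
  shows "computable A a (\<lambda>x c \<rho>. f x c \<rho> div g x c \<rho>)"
proof -
  \<comment> \<open>The quotient counts the positive multiples of \<open>q\<close> up to
    \<open>p\<close>; the guard yields 0 for divisor 0, in agreement with HOL.\<close>
  have "p div q = (\<Sum>u<p. of_bool (0 < q \<and> Suc u * q \<le> p))" for p q :: nat
  proof (cases "q = 0")
    case False
    have "{..<p} \<inter> {u. 0 < q \<and> Suc u * q \<le> p} = {..<p div q}"
      using False by (auto simp: less_eq_div_iff_mult_less_eq [symmetric] Suc_le_eq simp del: mult_Suc
          intro: less_le_trans [OF _ div_le_dividend])
    then show ?thesis by simp
  qed simp
  note eq = this
  have "computable A a (\<lambda>x c \<rho>. \<Sum>u<f x c \<rho>. of_bool (0 < g x c \<rho> \<and> Suc u * g x c \<rho> \<le> f x c \<rho>))"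
    by (rule computable_sum [OF assms(1)])
       (intro decidable_conj decidable_less decidable_le computable_mult computable_Suc computable_const
         computable_var computable_rename [OF assms(1)] computable_rename [OF assms(2)])
  then show ?thesis by (rule computable_cong) (rule eq [symmetric])
qed

lemma computable_mod:
  assumes "computable A a f" "computable A a g"
  shows "computable A a (\<lambda>x c \<rho>. f x c \<rho> mod g x c \<rho>)"
  by (rule computable_cong [OF computable_diff [OF assms(1) computable_mult [OF assms(2) computable_div [OF assms]]]])
     (simp add: minus_mult_div_eq_mod)

lemma decidable_odd:
  assumes "computable A a f"
  shows "decidable A a (\<lambda>x c \<rho>. odd (f x c \<rho>))"
  by (rule computable_cong [OF computable_mod [OF assms computable_const [of A a 2]]]) (simp add: mod_2_eq_odd)

lemma decidable_dvd:
  assumes "computable A a f" "computable A a g"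
  shows "decidable A a (\<lambda>x c \<rho>. f x c \<rho> dvd g x c \<rho>)"
  by (rule computable_cong [OF decidable_eq [OF computable_mod [OF assms(2,1)] computable_const [of A a 0]]])
     (simp add: dvd_eq_mod_eq_0)

section \<open>Powers of two and binary digits\<close>

definition pow2 :: "nat \<Rightarrow> bool" where
  "pow2 y \<longleftrightarrow> (\<exists>k. y = 2 ^ k)"

text \<open>Exponentiation is not polynomially bounded, so powers of two are recognised by their
  divisors, none of which is odd except 1. All divisors lie below \<open>Suc y\<close>, which bounds
  the quantifier.\<close>

lemma pow2_iff: "pow2 y \<longleftrightarrow> 0 < y \<and> (\<forall>d<Suc y. \<not> (d dvd y \<and> odd d \<and> 1 < d))"
proof
  assume "pow2 y"
  then obtain k where k: "y = 2 ^ k" by (auto simp: pow2_def)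
  have "\<not> (odd d \<and> 1 < d)" if d: "d dvd y" for d
  proof -
    obtain j where "d = 2 ^ j" using d k divides_primepow_nat [of 2 d k] by auto
    then show ?thesis by (cases j) auto
  qed
  with k show "0 < y \<and> (\<forall>d<Suc y. \<not> (d dvd y \<and> odd d \<and> 1 < d))" by auto
next
  assume y: "0 < y \<and> (\<forall>d<Suc y. \<not> (d dvd y \<and> odd d \<and> 1 < d))"
  have y0: "0 < y" using y by blast
  have y1: "d \<le> 1" if "d dvd y" "odd d" for d
  proof -
    have "d < Suc y" using dvd_imp_le [OF that(1) y0] by simp
    then show ?thesis using y that by (metis not_le)
  qed
  from y0 y1 show "pow2 y"
  proof (induction y rule: less_induct)
    case (less y)
    show ?case
    proof (cases "odd y")
      case True
      then have "y = 2 ^ 0" using less.prems(1) less.prems(2) [of y] by simp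
      then show ?thesis unfolding pow2_def by blast
    next
      case False
      then obtain z where z: "y = 2 * z" by auto
      then have "pow2 z" using less.prems by (intro less.IH) auto
      then show ?thesis unfolding pow2_def z by (metis power_Suc)
    qed
  qed
qed

lemma decidable_pow2:
  assumes "computable A a f"
  shows "decidable A a (\<lambda>x c \<rho>. pow2 (f x c \<rho>))"
  unfolding pow2_iff
  by (intro decidable_conj decidable_all decidable_not decidable_dvd decidable_odd decidable_less computable_Suc
      computable_const computable_var assms computable_rename [OF assms])

lemma count_pow2: "(\<Sum>u<2 ^ k. of_bool (pow2 u)) = k"
proof -
  have "{..<2 ^ k} \<inter> Collect pow2 = (\<lambda>i. 2 ^ i) ` {..<k}"
    by (auto simp: pow2_def)
  moreover have "inj_on (\<lambda>i. 2 ^ i :: nat) {..<k}" by (auto simp: inj_on_def)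
  ultimately show ?thesis by (simp add: card_image)
qed

text \<open>\<open>2 ^ k\<close> is characterised as the power of two with exactly \<open>k\<close>
  smaller ones. The cap B stands in for values too large to be held by a counter.\<close>

definition clipped_pow2 :: "nat \<Rightarrow> nat \<Rightarrow> nat" where
  "clipped_pow2 B k = bounded_least B (\<lambda>y. pow2 y \<and> (\<Sum>u<y. of_bool (pow2 u)) = k)"

lemma clipped_pow2: "clipped_pow2 B k = (if 2 ^ k < B then 2 ^ k else B)"
proof -
  have iff: "pow2 y \<and> (\<Sum>u<y. of_bool (pow2 u)) = k \<longleftrightarrow> y = 2 ^ k" for y
    using count_pow2 by (auto simp: pow2_def)
  show ?thesis
  proof (cases "2 ^ k < B")
    case True
    then show ?thesis unfolding clipped_pow2_def iff by (subst bounded_least_eq) auto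
  next
    case False
    have "\<not> bounded_least B (\<lambda>y. y = 2 ^ k) < B"
      using bounded_least_holds [of B "\<lambda>y. y = 2 ^ k"] False by auto
    then show ?thesis
      using bounded_least_le [of B "\<lambda>y. y = 2 ^ k"] False unfolding clipped_pow2_def iff by simp
  qed
qed

lemma computable_clipped_pow2:
  assumes "computable A a f" "computable A a g"
  shows "computable A a (\<lambda>x c \<rho>. clipped_pow2 (f x c \<rho>) (g x c \<rho>))"
  unfolding clipped_pow2_def
  by (intro computable_bounded_least decidable_conj decidable_pow2 decidable_eq computable_sum computable_var
      assms computable_rename [OF assms(2)])

definition nat_bit :: "nat \<Rightarrow> nat \<Rightarrow> bool" where
  "nat_bit v k \<longleftrightarrow> odd (v div 2 ^ k)"

lemma decidable_nat_bit:
  assumes "computable A a f" "computable A a g"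
  shows "decidable A a (\<lambda>x c \<rho>. nat_bit (f x c \<rho>) (g x c \<rho>))"
proof -
  \<comment> \<open>If \<open>2 ^ k\<close> exceeds \<open>v\<close>, the divisor is cut to
    \<open>Suc v\<close>, and both quotients are 0.\<close>
  have "nat_bit v k \<longleftrightarrow> odd (v div clipped_pow2 (Suc v) k)" for v k
    by (auto simp: nat_bit_def clipped_pow2)
  then show ?thesis
    by (simp only:) (intro decidable_odd computable_div computable_clipped_pow2 computable_Suc assms)
qed

text \<open>Each digit position corresponds to one power of two up to \<open>v\<close>. Written as a
  bounded sum, the length becomes computable.\<close>

lemma length_binary: "length (binary v) = (\<Sum>u<Suc v. of_bool (pow2 u))"
proof -
  have "length (binary v) = k" if "v < 2 ^ k" "0 < k \<Longrightarrow> 2 ^ (k - 1) \<le> v" for k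
    using that
  proof (induction v arbitrary: k rule: binary.induct)
    case (1 v)
    show ?case
    proof (cases "v = 0")
      case True
      have "k = 0" using 1(3) True by (cases k) auto
      then show ?thesis using True by (simp add: binary.simps [of 0])
    next
      case False
      then obtain j where k: "k = Suc j" using 1(2) by (cases k) auto
      have "length (binary (v div 2)) = j"
      proof (rule 1(1) [OF False])
        show "v div 2 < 2 ^ j" using 1(2) k by (simp add: less_mult_imp_div_less mult.commute)
        assume "0 < j"
        then obtain i where "j = Suc i" by (cases j) auto
        then show "2 ^ (j - 1) \<le> v div 2" using 1(3) k by (simp add: less_eq_div_iff_mult_less_eq mult.commute)
      qed
      then show ?thesis using False k by (subst binary.simps) simp
    qed
  qed
  note len = this
  define k where "k = (LEAST k. v < 2 ^ k)"
  have k2: "v < 2 ^ k" unfolding k_def by (rule LeastI [of _ v]) (rule less_exp)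
  have k3: "2 ^ (k - 1) \<le> v" if "0 < k"
    using not_less_Least [of "k - 1" "\<lambda>k. v < 2 ^ k"] that unfolding k_def by (simp add: not_less)
  note k = len [OF k2 k3] k2 k3
  have "{..<Suc v} \<inter> Collect pow2 = {..<2 ^ k} \<inter> Collect pow2"
  proof (intro set_eqI iffI; clarsimp)
    fix u assume "u < 2 ^ k" "pow2 u"
    then obtain i where u: "u = 2 ^ i" "i < k" by (auto simp: pow2_def)
    then have "(2::nat) ^ i \<le> 2 ^ (k - 1)" by (intro power_increasing) auto
    also have "\<dots> \<le> v" using k(3) u(2) by simp
    finally show "u < Suc v" using u(1) by simp
  qed (use k(2) in auto)
  moreover have "(\<Sum>u<Suc v. of_bool (pow2 u)) = card ({..<Suc v} \<inter> Collect pow2)"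
    by (subst sum_of_bool_eq) simp_all
  ultimately show ?thesis using k(1) count_pow2 [of k] by simp
qed

lemma computable_length_binary:
  assumes "computable A a f"
  shows "computable A a (\<lambda>x c \<rho>. length (binary (f x c \<rho>)))"
  unfolding length_binary
  by (intro computable_sum decidable_pow2 computable_Suc computable_var assms)

lemma nth_binary: "k < length (binary v) \<Longrightarrow> binary v ! k = nat_bit v k"
proof (induction v arbitrary: k rule: binary.induct)
  case (1 v)
  show ?case
  proof (cases "v = 0")
    case True
    then show ?thesis using 1(2) by (simp add: binary.simps [of 0])
  next
    case False
    then have b: "binary v = odd v # binary (v div 2)" by (subst binary.simps) simp
    show ?thesis
    proof (cases k)
      case (Suc j)
      then show ?thesis using 1 False b by (simp add: nat_bit_def div_mult2_eq)
    qed (simp add: b nat_bit_def)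
  qed
qed

lemma binary_eq_bits: "binary v = map (nat_bit v) [0..<length (binary v)]"
  by (rule nth_equalityI) (simp_all add: nth_binary)

subsection \<open>Isolation of minimum-weight witnesses\<close>

locale min_weight =
  fixes Y :: "bool list set" and base :: "bool list \<Rightarrow> nat" and m :: nat
  assumes nonempty: "Y \<noteq> {}" and len: "\<And>y. y \<in> Y \<Longrightarrow> length y = m"
begin

definition wt :: "(nat \<Rightarrow> nat) \<Rightarrow> bool list \<Rightarrow> nat" where
  "wt v y = base y + (\<Sum>i<m. of_bool (y ! i) * v i)"

text \<open>Phrased through thresholds because these are what the decision problem can be asked
  about.\<close>

definition mn :: "(nat \<Rightarrow> nat) \<Rightarrow> nat" where
  "mn v = (LEAST V. \<exists>y\<in>Y. wt v y \<le> V)"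

definition minimizer :: "(nat \<Rightarrow> nat) \<Rightarrow> bool list \<Rightarrow> bool" where
  "minimizer v y \<longleftrightarrow> y \<in> Y \<and> wt v y = mn v"

definition ambiguous :: "(nat \<Rightarrow> nat) \<Rightarrow> nat \<Rightarrow> bool" where
  "ambiguous v i \<longleftrightarrow> (\<exists>y. minimizer v y \<and> y ! i) \<and> (\<exists>y. minimizer v y \<and> \<not> y ! i)"

lemma mn_le: "y \<in> Y \<Longrightarrow> mn v \<le> wt v y"
  unfolding mn_def by (rule Least_le) blast

lemma ex_minimizer: "\<exists>y. minimizer v y"
proof -
  obtain y0 where "y0 \<in> Y" using nonempty by blast
  then have "\<exists>y\<in>Y. wt v y \<le> wt v y0" by blast
  then have "\<exists>y\<in>Y. wt v y \<le> mn v" unfolding mn_def by (rule LeastI)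
  then show ?thesis using mn_le by (auto simp: minimizer_def intro: antisym)
qed

lemma wt_cong: "(\<And>i. i < m \<Longrightarrow> v i = v' i) \<Longrightarrow> wt v y = wt v' y"
  unfolding wt_def by simp

lemma mn_cong: "(\<And>i. i < m \<Longrightarrow> v i = v' i) \<Longrightarrow> mn v = mn v'"
  unfolding mn_def by (simp add: wt_cong [of v v'])

lemma wt_update: "i < m \<Longrightarrow> wt (v(i := a)) y + of_bool (y ! i) * v i = wt v y + of_bool (y ! i) * a"
proof -
  assume i: "i < m"
  have "(\<Sum>j<m. of_bool (y ! j) * (v(i := a)) j) = of_bool (y ! i) * a + (\<Sum>j\<in>{..<m} - {i}. of_bool (y ! j) * v j)"
    using i by (subst sum.remove [of _ i]) (auto intro!: sum.cong)
  moreover have "(\<Sum>j<m. of_bool (y ! j) * v j) = of_bool (y ! i) * v i + (\<Sum>j\<in>{..<m} - {i}. of_bool (y ! j) * v j)"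
    using i by (subst sum.remove [of _ i]) auto
  ultimately show ?thesis by (simp add: wt_def)
qed

lemma wt_Suc: "i < m \<Longrightarrow> wt (v(i := Suc (v i))) y = wt v y + of_bool (y ! i)"
  using wt_update [of i v "Suc (v i)" y] by (cases "y ! i") auto

lemma mn_Suc_le: "i < m \<Longrightarrow> mn v \<le> mn (v(i := Suc (v i)))"
proof -
  assume i: "i < m"
  obtain y where y: "minimizer (v(i := Suc (v i))) y" using ex_minimizer by blast
  then have "mn v \<le> wt v y" using mn_le by (simp add: minimizer_def)
  also have "\<dots> \<le> mn (v(i := Suc (v i)))" using y wt_Suc [OF i, of v y] by (simp add: minimizer_def)
  finally show ?thesis .
qed

text \<open>The change makes exactly the witnesses containing \<open>i\<close> heavier, each by one.
  The minimum survives iff one of the old minimizers escapes.\<close>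

lemma mn_Suc_eq_iff: "i < m \<Longrightarrow> mn (v(i := Suc (v i))) = mn v \<longleftrightarrow> (\<exists>y. minimizer v y \<and> \<not> y ! i)"
proof
  assume i: "i < m" and eq: "mn (v(i := Suc (v i))) = mn v"
  obtain y where y: "minimizer (v(i := Suc (v i))) y" using ex_minimizer by blast
  then have "wt v y + of_bool (y ! i) = mn v" "y \<in> Y"
    using eq wt_Suc [OF i, of v y] by (simp_all add: minimizer_def)
  moreover have "mn v \<le> wt v y" using mn_le calculation by blast
  ultimately have "wt v y = mn v \<and> \<not> y ! i" by (cases "y ! i") auto
  then show "\<exists>y. minimizer v y \<and> \<not> y ! i" using y by (auto simp: minimizer_def)
next
  assume i: "i < m" and "\<exists>y. minimizer v y \<and> \<not> y ! i"
  then obtain y where y: "minimizer v y" "\<not> y ! i" by blast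
  have "mn (v(i := Suc (v i))) \<le> wt (v(i := Suc (v i))) y" using y mn_le by (simp add: minimizer_def)
  also have "\<dots> = mn v" using y wt_Suc [OF i, of v y] by (simp add: minimizer_def)
  finally show "mn (v(i := Suc (v i))) = mn v" using mn_Suc_le [OF i, of v] by simp
qed

text \<open>If the minimum rises, an old minimizer must contain \<open>i\<close>, and as its weight
  rises only by one it remains minimal. Conversely, a new minimizer containing \<open>i\<close> was
  strictly cheaper before the change.\<close>

lemma mn_Suc_neq_iff:
  assumes i: "i < m"
  shows "mn (v(i := Suc (v i))) \<noteq> mn v \<longleftrightarrow> (\<exists>y. minimizer (v(i := Suc (v i))) y \<and> y ! i)"
proof
  let ?v = "v(i := Suc (v i))"
  assume neq: "mn ?v \<noteq> mn v"
  obtain y where y: "minimizer v y" using ex_minimizer by blast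
  have lt: "wt v y < mn ?v" using y neq mn_Suc_le [OF i, of v] by (simp add: minimizer_def)
  have le: "mn ?v \<le> wt ?v y" using y mn_le by (simp add: minimizer_def)
  have eq: "wt ?v y = wt v y + of_bool (y ! i)" by (rule wt_Suc [OF i])
  have "y ! i" "wt ?v y = mn ?v" using lt le eq by (cases "y ! i"; simp)+
  then show "\<exists>y. minimizer ?v y \<and> y ! i" using y by (auto simp: minimizer_def)
next
  let ?v = "v(i := Suc (v i))"
  assume "\<exists>y. minimizer ?v y \<and> y ! i"
  then obtain y where y: "y \<in> Y" "wt ?v y = mn ?v" "y ! i" by (auto simp: minimizer_def)
  then have "wt v y < mn ?v" using wt_Suc [OF i, of v y] by simp
  then show "mn ?v \<noteq> mn v" using mn_le [OF y(1), of v] by simp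
qed

text \<open>Raising the value tests whether some minimizer avoids \<open>i\<close>; comparison with
  the lowered value tests whether some minimizer contains \<open>i\<close>. So three minima decide
  ambiguity, and \<open>Suc r\<close> ensures that lowering is possible.\<close>

lemma ambiguous_iff:
  assumes i: "i < m"
  shows "ambiguous (v(i := Suc r)) i \<longleftrightarrow>
    mn (v(i := Suc (Suc r))) = mn (v(i := Suc r)) \<and> mn (v(i := Suc r)) \<noteq> mn (v(i := r))"
  using mn_Suc_eq_iff [OF i, of "v(i := Suc r)"] mn_Suc_neq_iff [OF i, of "v(i := r)"]
  by (simp add: ambiguous_def conj_commute)

text \<open>The least weight without \<open>i\<close> does not depend on the value at
  \<open>i\<close>, and the least weight with \<open>i\<close> grows by the same amount as that
  value. Ambiguity means that the two coincide.\<close>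

lemma ambiguous_unique:
  assumes i: "i < m" and "ambiguous (v(i := a)) i" "ambiguous (v(i := b)) i"
  shows "a = b"
proof -
  have *: "b \<le> a" if amb: "ambiguous (v(i := a)) i" "ambiguous (v(i := b)) i" for a b
  proof -
    obtain y0 where y0: "minimizer (v(i := a)) y0" "\<not> y0 ! i" using amb by (auto simp: ambiguous_def)
    obtain z0 where z0: "minimizer (v(i := b)) z0" "\<not> z0 ! i" using amb by (auto simp: ambiguous_def)
    obtain z1 where z1: "minimizer (v(i := b)) z1" "z1 ! i" using amb by (auto simp: ambiguous_def)
    have eq: "wt (v(i := a)) z = wt (v(i := b)) z" if "\<not> z ! i" for z
      using wt_update [OF i, of v a z] wt_update [OF i, of v b z] that by simp
    have "mn (v(i := a)) \<le> mn (v(i := b))" "mn (v(i := b)) \<le> mn (v(i := a))"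
      using mn_le [of z0 "v(i := a)"] mn_le [of y0 "v(i := b)"] y0 z0 eq by (simp_all add: minimizer_def)
    then have "wt (v(i := b)) z1 \<le> wt (v(i := a)) z1"
      using z1 mn_le [of z1 "v(i := a)"] by (simp add: minimizer_def)
    then show "b \<le> a"
      using wt_update [OF i, of v a z1] wt_update [OF i, of v b z1] z1(2) by simp
  qed
  show ?thesis using * [OF assms(2,3)] * [OF assms(3,2)] by simp
qed

text \<open>Without ambiguity all minimizers agree on each coordinate, so testing whether one of
  them avoids \<open>i\<close> reads off a bit of the only minimizer.\<close>

lemma minimizer_unique:
  assumes "\<And>i. i < m \<Longrightarrow> \<not> ambiguous v i"
  shows "minimizer v (map (\<lambda>i. mn (v(i := Suc (v i))) \<noteq> mn v) [0..<m])"
proof -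
  obtain y where y: "minimizer v y" using ex_minimizer by blast
  have "y = map (\<lambda>i. mn (v(i := Suc (v i))) \<noteq> mn v) [0..<m]"
  proof (rule nth_equalityI)
    show "length y = length (map (\<lambda>i. mn (v(i := Suc (v i))) \<noteq> mn v) [0..<m])"
      using y len by (simp add: minimizer_def)
    fix i assume "i < length y"
    then have i: "i < m" using y len by (simp add: minimizer_def)
    have "y ! i \<longleftrightarrow> mn (v(i := Suc (v i))) \<noteq> mn v"
      using mn_Suc_eq_iff [OF i, of v] assms [OF i] y unfolding ambiguous_def by blast
    then show "y ! i = map (\<lambda>i. mn (v(i := Suc (v i))) \<noteq> mn v) [0..<m] ! i" using i by simp
  qed
  with y show ?thesis by simp
qed

text \<open>
  Penalising coordinate \<open>i\<close> whenever some minimizer avoids it keeps the minimum and forces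
  all minimizers to avoid \<open>i\<close>.
\<close>

definition greedy :: "(nat \<Rightarrow> bool) \<Rightarrow> nat \<Rightarrow> nat \<Rightarrow> nat" where
  "greedy b k j = Suc (of_bool (j < k \<and> b j))"

text \<open>Invariant: every minimizer for \<open>greedy b k\<close> carries the complement of
  \<open>b\<close> on the first \<open>k\<close> coordinates. If penalising \<open>k\<close> does
  not raise the minimum, the new minimizers are old ones that avoid \<open>k\<close>; otherwise all
  of them contain \<open>k\<close> already.\<close>

lemma greedy_minimizer:
  assumes b: "\<And>k. k < m \<Longrightarrow> b k \<longleftrightarrow> mn ((greedy b k)(k := 2)) = mn (greedy b k)"
  shows "minimizer (greedy b m) (map (\<lambda>i. \<not> b i) [0..<m])"
proof -
  have "\<forall>y. minimizer (greedy b k) y \<longrightarrow> (\<forall>j<k. y ! j \<longleftrightarrow> \<not> b j)" if "k \<le> m" for k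
    using that
  proof (induction k)
    case (Suc k)
    then have k: "k < m" by simp
    \<comment> \<open>Coordinates from \<open>k\<close> on still have weight 1, so the value 2 is a
      raise by one.\<close>
    have two: "(greedy b k)(k := 2) = (greedy b k)(k := Suc (greedy b k k))"
      by (simp add: greedy_def numeral_2_eq_2)
    note iff = b [OF k, unfolded two mn_Suc_eq_iff [OF k]]
    show ?case
    proof (cases "b k")
      case True
      then have g: "greedy b (Suc k) = (greedy b k)(k := Suc (greedy b k k))"
        by (auto simp: greedy_def fun_eq_iff less_Suc_eq)
      have mn: "mn (greedy b (Suc k)) = mn (greedy b k)" using True b [OF k] unfolding two g by simp
      show ?thesis
      proof (intro allI impI)
        fix y j assume y: "minimizer (greedy b (Suc k)) y" and j: "j < Suc k"
        have Y: "y \<in> Y" using y by (simp add: minimizer_def)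
        have "wt (greedy b k) y + of_bool (y ! k) = mn (greedy b k)"
          using y mn wt_Suc [OF k, of "greedy b k" y] by (simp add: minimizer_def g)
        then have "\<not> y ! k" "minimizer (greedy b k) y"
          using mn_le [OF Y, of "greedy b k"] Y by (cases "y ! k"; simp add: minimizer_def)+
        then show "y ! j \<longleftrightarrow> \<not> b j" using Suc True j by (cases "j = k") auto
      qed
    next
      case False
      then have "greedy b (Suc k) = greedy b k"
        by (auto simp: greedy_def fun_eq_iff less_Suc_eq)
      then show ?thesis using Suc False iff by (auto simp: less_Suc_eq)
    qed
  qed simp
  from this [of m] have all: "\<forall>y. minimizer (greedy b m) y \<longrightarrow> (\<forall>j<m. y ! j \<longleftrightarrow> \<not> b j)" by simp
  obtain y where y: "minimizer (greedy b m) y" using ex_minimizer by blast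
  have "y = map (\<lambda>i. \<not> b i) [0..<m]"
    by (rule nth_equalityI) (use y all len in \<open>auto simp: minimizer_def\<close>)
  with y show ?thesis by simp
qed

end

subsection \<open>Query strings\<close>

lemma upt_Suc_Cons: "[0..<Suc n] = 0 # map Suc [0..<n]"
  by (simp add: upt_conv_Cons map_Suc_upt del: upt_Suc)

lemma binary_0 [simp]: "binary 0 = []"
  by (simp add: binary.simps [of 0])

lemma encode_append: "encode (ss @ ts) = encode ss @ encode ts"
  by (simp add: encode_def)

text \<open>A code is a sequence of bit pairs among which 10 does not occur and the last of which is
  a separator. Unlike decoding, these conditions can be checked locally.\<close>

lemma ex_encode:
  assumes "length x = 2 * h" "0 < h \<longrightarrow> x ! (2 * h - 2)" "\<forall>t<h. x ! (2 * t) \<longrightarrow> x ! (2 * t + 1)"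
  shows "\<exists>ss. x = encode ss"
  using assms
proof (induction h arbitrary: x)
  case 0
  then show ?case using encode_Nil by (metis length_0_conv mult_0_right)
next
  case (Suc h)
  obtain a b y where x: "x = a # b # y" using Suc.prems(1) by (cases x; cases "tl x") auto
  have "\<exists>ss. y = encode ss"
  proof (rule Suc.IH)
    show "length y = 2 * h" using Suc.prems(1) x by simp
    show "0 < h \<longrightarrow> y ! (2 * h - 2)" using Suc.prems(2) x by (cases h) auto
    show "\<forall>t<h. y ! (2 * t) \<longrightarrow> y ! (2 * t + 1)"
    proof (intro allI impI)
      fix t assume "t < h" "y ! (2 * t)"
      then show "y ! (2 * t + 1)" using Suc.prems(3) [rule_format, of "Suc t"] x by simp
    qed
  qed
  then obtain ss where ss: "y = encode ss" by blast
  show ?case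
  proof (cases a)
    case True
    then have b using Suc.prems(3) [rule_format, of 0] x by simp
    then have "x = encode ([] # ss)" using True x ss encode_Cons_Nil [of ss] by simp
    then show ?thesis by blast
  next
    case False
    have "y \<noteq> []" using Suc.prems(1,2) x False by (cases h) auto
    then obtain s ts where "ss = s # ts" using ss by (cases ss) auto
    then show ?thesis using x ss False encode_Cons_Cons [of b s ts] by metis
  qed
qed

definition pairs :: "bool list \<Rightarrow> nat" where
  "pairs x = length x div 2"

text \<open>The number of separators in front of pair \<open>t\<close>, hence the index of the
  component to which this pair belongs.\<close>

definition seps :: "bool list \<Rightarrow> nat \<Rightarrow> nat" where
  "seps x t = (\<Sum>u<t. of_bool (input_bit x (2 * u)))"

definition data :: "nat \<Rightarrow> nat \<Rightarrow> bool list" where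
  "data v n = concat (map (\<lambda>k. [False, nat_bit v k]) [0..<n])"

definition low_part :: "nat \<Rightarrow> (nat \<Rightarrow> nat) \<Rightarrow> nat \<Rightarrow> bool list \<Rightarrow> nat \<Rightarrow> bool list" where
  "low_part p v j x t =
     (if input_bit x (2 * t) \<and> Suc t < pairs x
      then data (v (j + seps x t)) (if input_bit x (2 * t + 2) then length (binary (v (j + seps x t))) else p)
      else [])"

text \<open>
  The weights of the query are \<open>W\<^sub>j * 2 ^ p + v\<^sub>j\<close>. As numbers are written with the least
  significant bit first, it suffices to insert the low-order bits behind the separators of
  the input.
\<close>

definition query_prefix :: "nat \<Rightarrow> (nat \<Rightarrow> nat) \<Rightarrow> nat \<Rightarrow> bool list \<Rightarrow> bool list" where
  "query_prefix p v j x =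
     concat (map (\<lambda>t. [input_bit x (2 * t), input_bit x (2 * t + 1)] @ low_part p v j x t) [0..<pairs x])"

fun extend :: "nat \<Rightarrow> (nat \<Rightarrow> nat) \<Rightarrow> nat \<Rightarrow> bool list list \<Rightarrow> bool list list" where
  "extend p v j [] = []"
| "extend p v j (w # ws) =
     (map (nat_bit (v j)) [0..<if w = [] then length (binary (v j)) else p] @ w) # extend p v (Suc j) ws"

lemma input_bit_Cons [simp]:
  "input_bit (a # x) 0 = a" "input_bit (a # x) (Suc p) = input_bit x p"
  by (auto simp: input_bit_def)

lemma pairs_Cons [simp]: "pairs (a # b # x) = Suc (pairs x)"
  by (simp add: pairs_def)

lemma seps_Cons: "seps (a # b # x) (Suc t) = of_bool a + seps x t"
  unfolding seps_def by (subst sum.lessThan_Suc_shift) simp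

lemma query_prefix_Cons:
  "query_prefix p v j (a # b # x) =
     [a, b] @ (if a \<and> 0 < pairs x then data (v j) (if input_bit x 0 then length (binary (v j)) else p) else []) @
     query_prefix p v (j + of_bool a) x"
proof -
  have low: "low_part p v j (a # b # x) (Suc t) = low_part p v (j + of_bool a) x t" for t
    by (simp add: low_part_def seps_Cons)
  have "low_part p v j (a # b # x) 0 = (if a \<and> 0 < pairs x then data (v j) (if input_bit x 0 then length (binary (v j)) else p) else [])"
    by (simp add: low_part_def seps_def numeral_2_eq_2)
  then show ?thesis
    unfolding query_prefix_def pairs_Cons upt_Suc_Cons by (simp add: low comp_def)
qed

lemma query_prefix_Nil [simp]: "query_prefix p v j [] = []"
  by (simp add: query_prefix_def pairs_def)

lemma encode_Cons: "encode (s # ss) = concat (map (\<lambda>b. [False, b]) s) @ [True, True] @ encode ss"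
  by (simp add: encode_def)

lemma pairs_encode_pos: "0 < pairs (encode ss) \<longleftrightarrow> ss \<noteq> []"
proof (cases ss)
  case (Cons s ts)
  then show ?thesis by (cases s) (simp_all add: encode_Cons_Nil encode_Cons_Cons)
qed (simp add: pairs_def)

lemma data_eq: "data v n = concat (map (\<lambda>b. [False, b]) (map (nat_bit v) [0..<n]))"
  by (simp add: data_def comp_def)

text \<open>Outer induction over the weights and inner induction over the bits of the current
  component; when these are used up, the separator triggers the insertion in front of the next
  weight.\<close>

lemma query_prefix_encode: "query_prefix p v j (encode (s # ws)) = encode (s # extend p v j ws)"
proof (induction ws arbitrary: s j)
  case Nil
  show ?case
    by (induction s) (simp_all add: encode_Cons_Nil encode_Cons_Cons query_prefix_Cons pairs_def)
next
  case (Cons w ws)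
  have base: "query_prefix p v j (encode ([] # w # ws)) = encode ([] # extend p v j (w # ws))"
  proof -
    have "input_bit (encode (w # ws)) 0 \<longleftrightarrow> w = []"
      by (cases w) (simp_all add: encode_Cons_Nil encode_Cons_Cons)
    then have "query_prefix p v j (encode ([] # w # ws)) =
        [True, True] @ data (v j) (if w = [] then length (binary (v j)) else p) @ encode (w # extend p v (Suc j) ws)"
      using Cons.IH [of "Suc j" w] by (simp add: encode_Cons_Nil query_prefix_Cons pairs_encode_pos)
    then show ?thesis by (simp add: encode_Cons_Nil encode_Cons data_eq)
  qed
  show ?case
  proof (induction s)
    case Nil
    show ?case by (rule base)
  next
    case (Cons b s)
    then show ?case by (simp add: encode_Cons_Cons query_prefix_Cons del: extend.simps)
  qed
qed

lemma seps_encode: "seps (encode ss) (pairs (encode ss)) = length ss"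
proof (induction ss)
  case Nil
  show ?case by (simp add: seps_def pairs_def)
next
  case (Cons s ss)
  show ?case
    by (induction s) (simp_all add: encode_Cons_Nil encode_Cons_Cons seps_Cons Cons)
qed

lemma even_length_encode: "even (length (encode ss))"
proof (induction ss)
  case (Cons s ss)
  then show ?case by (induction s) (simp_all add: encode_Cons_Nil encode_Cons_Cons)
qed simp

lemma binary_shift:
  assumes "v < 2 ^ p" "0 < w"
  shows "binary (w * 2 ^ p + v) = map (nat_bit v) [0..<p] @ binary w"
  using assms
proof (induction p arbitrary: v)
  case (Suc p)
  let ?n = "w * 2 ^ Suc p + v"
  have n: "?n \<noteq> 0" using Suc.prems by simp
  have d: "?n div 2 = w * 2 ^ p + v div 2" "odd ?n = odd v" by simp_all
  have v: "v div 2 < 2 ^ p" using Suc.prems by (simp add: less_mult_imp_div_less mult.commute)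
  have "binary ?n = odd v # binary (w * 2 ^ p + v div 2)"
    using n d by (subst binary.simps) simp
  also have "\<dots> = odd v # map (nat_bit (v div 2)) [0..<p] @ binary w"
    using Suc.IH [OF v Suc.prems(2)] by simp
  also have "map (nat_bit (v div 2)) [0..<p] = map (nat_bit v) (map Suc [0..<p])"
    by (simp add: nat_bit_def div_mult2_eq)
  finally show ?case unfolding upt_Suc_Cons by (simp add: nat_bit_def)
qed simp

lemma extend_binary:
  assumes "\<And>j. v j < 2 ^ p"
  shows "extend p v j (map binary W) = map binary (map (\<lambda>i. W ! i * 2 ^ p + v (j + i)) [0..<length W])"
proof (induction W arbitrary: j)
  case (Cons w W)
  have "map (nat_bit (v j)) [0..<if binary w = [] then length (binary (v j)) else p] @ binary w = binary (w * 2 ^ p + v j)"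
  proof (cases "w = 0")
    case True
    then show ?thesis using binary_eq_bits [of "v j"] by simp
  next
    case False
    then have "binary w \<noteq> []" by (subst binary.simps) simp
    then show ?thesis using binary_shift [OF assms, of w j] False by simp
  qed
  then show ?case using Cons [of "Suc j"] unfolding list.size add_0_right add_Suc_right upt_Suc_Cons
    by (simp add: comp_def)
qed simp

lemma last_binary: "binary n \<noteq> [] \<Longrightarrow> last (binary n)"
proof (induction n rule: binary.induct)
  case (1 n)
  have n: "n \<noteq> 0" using 1(2) by (cases "n = 0") auto
  then have b: "binary n = odd n # binary (n div 2)" by (subst binary.simps) simp
  show ?case
  proof (cases "binary (n div 2) = []")
    case True
    then have "n div 2 = 0" by (subst (asm) binary.simps) (simp split: if_splits)
    then have "n = 1" using n by simp
    then show ?thesis using b True by simp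
  qed (use 1(1) n b in simp)
qed

lemma ex_binary: "w = [] \<or> last w \<Longrightarrow> \<exists>n. w = binary n"
proof (induction w)
  case Nil
  then show ?case using binary_0 by metis
next
  case (Cons b w)
  then obtain n where n: "w = binary n" by (cases w) auto
  have pos: "0 < n \<or> b" using Cons.prems n by (cases "n = 0") auto
  have "(2 * n + of_bool b) div 2 = n" "odd (2 * n + of_bool b) = b" "2 * n + of_bool b \<noteq> 0"
    using pos by (cases b; simp)+
  then have "binary (2 * n + of_bool b) = b # binary n"
    by (subst binary.simps) simp
  then show ?case using n by metis
qed

text \<open>A numeral is either empty or ends with a one. Prepending low-order bits leaves the last
  digit of a nonempty component alone, so a query that consists of numerals vouches for the
  input.\<close>

lemma extend_binary_only_if:
  assumes "extend p v j ws = map binary W"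
  shows "\<exists>W'. ws = map binary W'"
  using assms
proof (induction ws arbitrary: j W)
  case (Cons w ws)
  then obtain n W1 where W: "W = n # W1" by (cases W) auto
  obtain W' where W': "ws = map binary W'" using Cons W by auto
  have "w = [] \<or> last w"
  proof (cases "w = []")
    case False
    have "map (nat_bit (v j)) [0..<p] @ w = binary n" using Cons.prems W False by simp
    then have "last (binary n)" using last_binary False by (metis append_is_Nil_conv)
    then show ?thesis using \<open>_ @ w = binary n\<close> False by (metis last_appendR)
  qed simp
  then obtain n' where "w = binary n'" using ex_binary by blast
  with W' have "w # ws = map binary (n' # W')" by simp
  then show ?case by (rule exI)
qed simp

subsection \<open>The reduction\<close>

text \<open>The number of weights: the first component is the string and does not count.\<close>

definition num :: "bool list \<Rightarrow> nat" where
  "num x = seps x (pairs x) - 1"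

text \<open>The bits of a slot: enough for the index of a coordinate, and one more for the free
  bit.\<close>

definition wid :: "bool list \<Rightarrow> nat" where
  "wid x = Suc (length (binary (length x)))"

text \<open>A strict bound on the perturbed weight of every witness of an instance. The base
  dominates \<open>2 ^ wid x\<close> and the number of weights. Of the exponent, C comes from the
  weights of the instance, 2 from the shift by \<open>2 * wid x\<close> bits, 1 from the summation
  and 1 from a constant factor 3.\<close>

definition vmax :: "nat \<Rightarrow> bool list \<Rightarrow> nat" where
  "vmax C x = (4 * length x + 8) ^ (C + 4)"

definition query :: "bool list \<Rightarrow> (nat \<Rightarrow> nat) \<Rightarrow> nat \<Rightarrow> bool list" where
  "query x v V = query_prefix (2 * wid x) v 0 x @ data V (length (binary V)) @ [True, True]"

definition least_weight :: "bool list set \<Rightarrow> nat \<Rightarrow> bool list \<Rightarrow> (nat \<Rightarrow> nat) \<Rightarrow> nat" where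
  "least_weight A C x v = bounded_least (vmax C x) (\<lambda>V. query x v V \<in> A)"

text \<open>Mixed-radix position of bit \<open>k\<close> of slot \<open>j\<close> in block
  \<open>b\<close>.\<close>

definition addr :: "bool list \<Rightarrow> nat \<Rightarrow> nat \<Rightarrow> nat \<Rightarrow> nat" where
  "addr x b j k = (b * num x + j) * wid x + k"

definition slot :: "bool list \<Rightarrow> bool list \<Rightarrow> nat \<Rightarrow> nat \<Rightarrow> nat" where
  "slot x c b j = (\<Sum>k<wid x. of_bool (c ! addr x b j k) * 2 ^ k)"

definition block_weight :: "bool list \<Rightarrow> bool list \<Rightarrow> nat \<Rightarrow> nat \<Rightarrow> nat \<Rightarrow> nat \<Rightarrow> nat" where
  "block_weight x c b i a j = (if j = i then a else Suc (slot x c b j))"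

text \<open>The three-value test for ambiguity of \<open>i\<close>, posed for slot value
  \<open>r\<close>, whose perturbation is \<open>r + 1\<close>. It does not look at the actual
  content of slot \<open>i\<close>, so it can still be asked when that content is lost.\<close>

definition collision :: "bool list set \<Rightarrow> nat \<Rightarrow> bool list \<Rightarrow> bool list \<Rightarrow> nat \<Rightarrow> nat \<Rightarrow> nat \<Rightarrow> bool" where
  "collision A C x c b i r \<longleftrightarrow>
     least_weight A C x (block_weight x c b i (r + 2)) = least_weight A C x (block_weight x c b i (r + 1)) \<and>
     \<not> least_weight A C x (block_weight x c b i (r + 1)) = least_weight A C x (block_weight x c b i (r + 0))"

definition isolating :: "bool list set \<Rightarrow> nat \<Rightarrow> bool list \<Rightarrow> bool list \<Rightarrow> nat \<Rightarrow> bool" where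
  "isolating A C x c b \<longleftrightarrow> (\<forall>i<num x. \<not> collision A C x c b i (slot x c b i))"

fun repeat :: "(nat \<Rightarrow> bool list \<Rightarrow> bool list) \<Rightarrow> nat \<Rightarrow> bool list \<Rightarrow> bool list" where
  "repeat f 0 c = c"
| "repeat f (Suc n) c = f n (repeat f n c)"

definition copy_slot :: "bool list \<Rightarrow> nat \<Rightarrow> nat \<Rightarrow> nat \<Rightarrow> bool list \<Rightarrow> bool list" where
  "copy_slot x b i j = repeat (\<lambda>k c. c[addr x b i k := c ! addr x b j k]) (wid x)"

definition put_slot :: "bool list \<Rightarrow> nat \<Rightarrow> nat \<Rightarrow> nat \<Rightarrow> bool list \<Rightarrow> bool list" where
  "put_slot x b i v = repeat (\<lambda>k c. c[addr x b i k := nat_bit v k]) (wid x)"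

text \<open>
  The value of the colliding slot \<open>i\<close> can be recomputed, so slot \<open>0\<close> moves there and makes
  room for \<open>i\<close> and a free bit.
\<close>

definition compress :: "bool list set \<Rightarrow> nat \<Rightarrow> bool list \<Rightarrow> nat \<Rightarrow> bool list \<Rightarrow> bool list" where
  "compress A C x b c =
     (let i = bounded_least (num x) (\<lambda>i. collision A C x c b i (slot x c b i))
      in put_slot x b 0 (2 * i) (copy_slot x b i 0 c))"

text \<open>Division by 2 drops the free bit. Slot 0 has to be restored before the search, because
  the test for slot \<open>i\<close> reads all other slots. In the case \<open>i = 0\<close> the
  copy changes nothing and the search restores slot 0 itself.\<close>

definition decompress :: "bool list set \<Rightarrow> nat \<Rightarrow> bool list \<Rightarrow> nat \<Rightarrow> bool list \<Rightarrow> bool list" where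
  "decompress A C x b c =
     (let i = slot x c b 0 div 2; c' = copy_slot x b 0 i c;
          r = bounded_least (clipped_pow2 (4 * length x + 9) (wid x)) (collision A C x c' b i)
      in put_slot x b i r c')"

text \<open>The decision about coordinate \<open>j\<close> sits in bit 0 of slot 0 of block
  \<open>j\<close>, the place left open by storing an index doubled.\<close>

definition free_weight :: "bool list \<Rightarrow> bool list \<Rightarrow> nat \<Rightarrow> nat \<Rightarrow> nat" where
  "free_weight x c i j = Suc (of_bool (j < i \<and> c ! addr x j 0 0))"

definition penalise :: "bool list set \<Rightarrow> nat \<Rightarrow> bool list \<Rightarrow> nat \<Rightarrow> bool list \<Rightarrow> bool list" where
  "penalise A C x i c =
     c[addr x i 0 0 := least_weight A C x (\<lambda>j. if j = i then 2 else free_weight x c i j) =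
                       least_weight A C x (free_weight x c i)]"

definition well_formed :: "bool list \<Rightarrow> bool" where
  "well_formed x \<longleftrightarrow>
     length x = 2 * pairs x \<and> 0 < pairs x \<and> input_bit x (2 * pairs x - 2) \<and>
     (\<forall>t<pairs x. \<not> (input_bit x (2 * t) \<and> \<not> input_bit x (2 * t + 1)))"

text \<open>All perturbations and the threshold take their greatest values: acceptance guarantees
  that every later threshold search succeeds below \<open>vmax\<close>, whatever the blocks contain.
  It also certifies that the components after the first are numerals and that their number is
  right.\<close>

definition accepts :: "bool list set \<Rightarrow> nat \<Rightarrow> bool list \<Rightarrow> bool" where
  "accepts A C x \<longleftrightarrow>
     well_formed x \<and> query x (\<lambda>_. clipped_pow2 (4 * length x + 9) (wid x) + 1) (vmax C x - 1) \<in> A"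

definition main :: "bool list set \<Rightarrow> nat \<Rightarrow> bool list \<Rightarrow> bool list \<Rightarrow> bool list \<times> bool list" where
  "main A C x c =
     (if \<exists>b<num x. isolating A C x c b then
        let b = bounded_least (num x) (isolating A C x c)
        in (c, map (\<lambda>i. \<not> least_weight A C x (block_weight x c b i (slot x c b i + 2)) =
                         least_weight A C x (block_weight x c b i (slot x c b i + 1))) [0..<num x])
      else
        let c' = repeat (penalise A C x) (num x) (repeat (compress A C x) (num x) c)
        in (repeat (decompress A C x) (num x) c', map (\<lambda>i. \<not> c' ! addr x i 0 0) [0..<num x]))"

subsection \<open>Computability of the reduction\<close>

text \<open>Substitutes a computed argument for a variable by a sum in which only the term with the
  right index survives. It supplies the perturbation belonging to a computed index.\<close>

lemma computable_app:
  assumes v: "computable A a (\<lambda>x c \<rho>. v x c (\<lambda>i. \<rho> (Suc i)) (\<rho> 0))" and e: "computable A a e"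
  shows "computable A a (\<lambda>x c \<rho>. v x c (\<lambda>i. \<rho> (h i)) (e x c \<rho>))"
proof (rule computable_cong)
  have "computable A a (\<lambda>x c \<rho>. v x c (\<lambda>i. \<rho> (Suc (h i))) (\<rho> 0))"
    using computable_rename [OF v, of "case_nat 0 (\<lambda>i. Suc (h i))"] by simp
  then show "computable A a (\<lambda>x c \<rho>. \<Sum>u<Suc (e x c \<rho>). of_bool (u = e x c \<rho>) * v x c (\<lambda>i. \<rho> (h i)) u)"
    by (intro computable_sum computable_mult decidable_eq computable_Suc computable_var e computable_rename [OF e])
  show "(\<Sum>u<Suc (e x c \<rho>). of_bool (u = e x c \<rho>) * v x c (\<lambda>i. \<rho> (h i)) u) = v x c (\<lambda>i. \<rho> (h i)) (e x c \<rho>)" for x c \<rho>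
    by (simp add: of_bool_def if_distrib [of "\<lambda>z. z * _"] sum.delta cong: if_cong)
qed

lemma decidable_const: "decidable A a (\<lambda>x c \<rho>. P)"
  by (rule computable_const)

abbreviation generator ::
  "bool list set \<Rightarrow> bool \<Rightarrow> (bool list \<Rightarrow> bool list \<Rightarrow> (nat \<Rightarrow> nat) \<Rightarrow> bool list) \<Rightarrow> bool" where
  "generator A t g \<equiv> procedure A t (\<lambda>x c \<rho>. (c, g x c \<rho>))"

lemma procedure_cong: "procedure A t F \<Longrightarrow> (\<And>x c \<rho>. F x c \<rho> = G x c \<rho>) \<Longrightarrow> procedure A t G"
proof -
  assume F: "procedure A t F" and eq: "\<And>x c \<rho>. F x c \<rho> = G x c \<rho>"
  have "F = G" using eq by (intro ext)
  with F show ?thesis by simp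
qed

lemma generator_append:
  assumes "generator A t g" "generator A t h"
  shows "generator A t (\<lambda>x c \<rho>. g x c \<rho> @ h x c \<rho>)"
  by (rule procedure_cong [OF procedure_seq [OF assms]]) (simp add: seq_proc_def)

lemma iterate_generator: "iterate (\<lambda>v c. (c, g v c)) n c = (c, concat (map (\<lambda>v. g v c) [0..<n]))"
  by (induction n) simp_all

lemma generator_concat:
  assumes "computable A t n" "generator A t (\<lambda>x c \<rho>. g x c (\<lambda>i. \<rho> (Suc i)) (\<rho> 0))"
  shows "generator A t (\<lambda>x c \<rho>. concat (map (\<lambda>v. g x c \<rho> v) [0..<n x c \<rho>]))"
  by (rule procedure_cong [OF procedure_for [OF assms(1), where F = "\<lambda>x c \<rho> v. (c, g x c \<rho> v)", OF assms(2)]])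
     (simp add: iterate_generator)

lemma generator_Nil: "generator A t (\<lambda>x c \<rho>. [])"
  by (rule procedure_cong [OF generator_concat [OF computable_const [of A t 0], where g = "\<lambda>x c \<rho> v. [True]"]])
     (simp_all add: procedure_emit [OF decidable_const])

lemma generator_Cons:
  assumes "decidable A t P" "generator A t g"
  shows "generator A t (\<lambda>x c \<rho>. P x c \<rho> # g x c \<rho>)"
  by (rule procedure_cong [OF generator_append [OF procedure_emit [OF assms(1)] assms(2)]]) simp

lemma generator_if:
  assumes "decidable A t P" "generator A t g" "generator A t h"
  shows "generator A t (\<lambda>x c \<rho>. if P x c \<rho> then g x c \<rho> else h x c \<rho>)"
  by (rule procedure_cong [OF procedure_if [OF assms]]) simp

lemma generator_data:
  assumes "computable A t f" "computable A t n"
  shows "generator A t (\<lambda>x c \<rho>. data (f x c \<rho>) (n x c \<rho>))"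
  unfolding data_def
  by (intro generator_concat generator_Cons generator_Nil decidable_const decidable_nat_bit computable_var
      assms computable_rename [OF assms(1)])

lemma computable_pairs: "computable A a (\<lambda>x c \<rho>. pairs x)"
  unfolding pairs_def by (intro computable_div computable_length computable_const)

lemma computable_seps: "computable A a f \<Longrightarrow> computable A a (\<lambda>x c \<rho>. seps x (f x c \<rho>))"
  unfolding seps_def by (intro computable_sum computable_input_bit computable_mult computable_const computable_var)

lemma computable_num: "computable A a (\<lambda>x c \<rho>. num x)"
  unfolding num_def by (intro computable_diff computable_seps computable_pairs computable_const)

lemma computable_wid: "computable A a (\<lambda>x c \<rho>. wid x)"
  unfolding wid_def by (intro computable_Suc computable_length_binary computable_length)

lemma computable_vmax: "computable A a (\<lambda>x c \<rho>. vmax C x)"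
  unfolding vmax_def by (intro computable_power computable_add computable_mult computable_const computable_length)

lemma computable_clipped_width: "computable A a (\<lambda>x c \<rho>. clipped_pow2 (4 * length x + 9) (wid x))"
  by (intro computable_clipped_pow2 computable_add computable_mult computable_const computable_length computable_wid)

lemma computable_addr:
  assumes "computable A a f" "computable A a g" "computable A a h"
  shows "computable A a (\<lambda>x c \<rho>. addr x (f x c \<rho>) (g x c \<rho>) (h x c \<rho>))"
  unfolding addr_def by (intro computable_add computable_mult computable_num computable_wid assms)

text \<open>Two demands on the slot width: an index must fit, and \<open>2 ^ wid x\<close> must
  remain linear in the length of the input so that counters can enumerate slot values.\<close>

lemma two_power_wid: "2 ^ wid x < 4 * length x + 9" "length x < 2 ^ (wid x - 1)"
proof -
  have *: "2 ^ length (binary n) \<le> max 1 (2 * n)" "n < 2 ^ length (binary n)" for n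
  proof (induction n rule: binary.induct)
    case (1 n)
    {
      case 1
      show ?case
      proof (cases "n = 0")
        case False
        then have "binary n = odd n # binary (n div 2)" by (subst binary.simps) simp
        moreover have "2 * max 1 (2 * (n div 2)) \<le> max 1 (2 * n)" using False by presburger
        ultimately show ?thesis using "1.IH"(1) [OF False] by simp
      qed simp
    next
      case 2
      show ?case
      proof (cases "n = 0")
        case False
        then have "binary n = odd n # binary (n div 2)" by (subst binary.simps) simp
        then show ?thesis using "1.IH"(2) [OF False] by simp
      qed simp
    }
  qed
  show "2 ^ wid x < 4 * length x + 9" using *(1) [of "length x"] by (simp add: wid_def)
  show "length x < 2 ^ (wid x - 1)" using *(2) [of "length x"] by (simp add: wid_def)
qed

lemma clipped_width: "clipped_pow2 (4 * length x + 9) (wid x) = 2 ^ wid x"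
  using two_power_wid(1) by (simp add: clipped_pow2)

lemma computable_slot:
  assumes "computable A a f" "computable A a g"
  shows "computable A a (\<lambda>x c \<rho>. slot x c (f x c \<rho>) (g x c \<rho>))"
proof (rule computable_cong)
  show "computable A a (\<lambda>x c \<rho>. \<Sum>k<wid x. of_bool (c ! addr x (f x c \<rho>) (g x c \<rho>) k) * clipped_pow2 (4 * length x + 9) k)"
    by (intro computable_sum computable_mult computable_wid computable_cat computable_addr computable_clipped_pow2
        computable_add computable_const computable_length computable_var computable_rename [OF assms(1)]
        computable_rename [OF assms(2)])
  fix x c \<rho>
  have "clipped_pow2 (4 * length x + 9) k = 2 ^ k" if "k < wid x" for k
  proof -
    have "(2::nat) ^ k < 2 ^ wid x" using that by (rule power_strict_increasing) simp
    then have "(2::nat) ^ k < 4 * length x + 9" using two_power_wid(1) [of x] by (rule less_trans)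
    then show ?thesis by (simp add: clipped_pow2)
  qed
  then show "(\<Sum>k<wid x. of_bool (c ! addr x (f x c \<rho>) (g x c \<rho>) k) * clipped_pow2 (4 * length x + 9) k) =
      slot x c (f x c \<rho>) (g x c \<rho>)"
    unfolding slot_def by (intro sum.cong) auto
qed

lemma generator_query:
  assumes v: "computable A t (\<lambda>x c \<rho>. v x c (\<lambda>i. \<rho> (Suc i)) (\<rho> 0))" and V: "computable A t V"
  shows "generator A t (\<lambda>x c \<rho>. query x (v x c \<rho>) (V x c \<rho>))"
  unfolding query_def query_prefix_def low_part_def
  by (intro generator_append generator_concat generator_Cons generator_Nil generator_if generator_data
      decidable_const decidable_conj decidable_less computable_if computable_input_bit computable_app [OF v]
      computable_length_binary computable_pairs computable_seps computable_wid computable_add computable_mult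
      computable_Suc computable_const computable_var V)

text \<open>The weights are recomputed while a query is being written, so they must be computable
  without the oracle; the minimum itself is found by asking.\<close>

lemma computable_least_weight:
  assumes v: "computable A False (\<lambda>x c \<rho>. v x c (\<lambda>i. \<rho> (Suc i)) (\<rho> 0))"
  shows "computable A True (\<lambda>x c \<rho>. least_weight A C x (v x c \<rho>))"
proof -
  have "computable A False (\<lambda>x c \<rho>. v x c (\<lambda>i. \<rho> (Suc (Suc i))) (\<rho> 0))"
    by (intro computable_app [OF v] computable_var)
  then show ?thesis
    unfolding least_weight_def
    by (intro computable_bounded_least computable_vmax computable_ask generator_query computable_var)
qed

lemma computable_block_weight:
  assumes "computable A a f" "computable A a g" "computable A a h" "computable A a e"
  shows "computable A a (\<lambda>x c \<rho>. block_weight x c (f x c \<rho>) (g x c \<rho>) (h x c \<rho>) (e x c \<rho>))"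
  unfolding block_weight_def
  by (intro computable_if decidable_eq computable_Suc computable_slot assms)

lemma computable_least_block_weight:
  assumes "computable A False f" "computable A False g" "computable A False h"
  shows "computable A True (\<lambda>x c \<rho>. least_weight A C x (block_weight x c (f x c \<rho>) (g x c \<rho>) (h x c \<rho>)))"
  by (intro computable_least_weight computable_block_weight computable_var assms [THEN computable_rename])

lemma decidable_collision:
  assumes "computable A False f" "computable A False g" "computable A False h"
  shows "decidable A True (\<lambda>x c \<rho>. collision A C x c (f x c \<rho>) (g x c \<rho>) (h x c \<rho>))"
  unfolding collision_def
  by (intro decidable_conj decidable_not decidable_eq computable_least_block_weight computable_add computable_const assms)

lemma decidable_isolating:
  assumes "computable A False f"
  shows "decidable A True (\<lambda>x c \<rho>. isolating A C x c (f x c \<rho>))"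
  unfolding isolating_def
  by (intro decidable_all decidable_not decidable_collision computable_num computable_slot computable_var
      computable_rename [OF assms])

section \<open>Procedures that rewrite the catalytic tape\<close>

abbreviation transformer ::
  "bool list set \<Rightarrow> (bool list \<Rightarrow> bool list \<Rightarrow> (nat \<Rightarrow> nat) \<Rightarrow> bool list) \<Rightarrow> bool" where
  "transformer A G \<equiv> procedure A True (\<lambda>x c \<rho>. (G x c \<rho>, []))"

lemma transformer_seq:
  assumes "transformer A G" "transformer A H"
  shows "transformer A (\<lambda>x c \<rho>. H x (G x c \<rho>) \<rho>)"
  by (rule procedure_cong [OF procedure_seq [OF assms]]) (simp add: seq_proc_def)

lemma iterate_transformer: "iterate (\<lambda>v c. (G v c, [])) n c = (repeat G n c, [])"
  by (induction n) simp_all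

lemma transformer_repeat:
  assumes "computable A True n" "transformer A (\<lambda>x c \<rho>. G x c (\<lambda>i. \<rho> (Suc i)) (\<rho> 0))"
  shows "transformer A (\<lambda>x c \<rho>. repeat (\<lambda>v c. G x c \<rho> v) (n x c \<rho>) c)"
  by (rule procedure_cong [OF procedure_for [OF assms(1), where F = "\<lambda>x c \<rho> v. (G x c \<rho> v, [])", OF assms(2)]])
     (simp add: iterate_transformer)

lemma transformer_copy_slot:
  assumes "computable A True (\<lambda>x c \<rho>. f \<rho>)" "computable A True (\<lambda>x c \<rho>. g \<rho>)" "computable A True (\<lambda>x c \<rho>. h \<rho>)"
  shows "transformer A (\<lambda>x c \<rho>. copy_slot x (f \<rho>) (g \<rho>) (h \<rho>) c)"
  unfolding copy_slot_def
  by (intro transformer_repeat procedure_write computable_wid computable_addr computable_cat computable_var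
      assms [THEN computable_rename])

lemma transformer_put_slot:
  assumes "computable A True (\<lambda>x c \<rho>. f \<rho>)" "computable A True (\<lambda>x c \<rho>. g \<rho>)" "computable A True (\<lambda>x c \<rho>. h \<rho>)"
  shows "transformer A (\<lambda>x c \<rho>. put_slot x (f \<rho>) (g \<rho>) (h \<rho>) c)"
  unfolding put_slot_def
  by (intro transformer_repeat procedure_write computable_wid computable_addr decidable_nat_bit computable_var
      assms [THEN computable_rename])

lemma transformer_compress: "transformer A (\<lambda>x c \<rho>. compress A C x (\<rho> 0) c)"
proof -
  have i: "computable A True (\<lambda>x c \<rho>. bounded_least (num x) (\<lambda>i. collision A C x c (\<rho> 0) i (slot x c (\<rho> 0) i)))"
    by (intro computable_bounded_least computable_num decidable_collision computable_slot computable_var)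
  have F: "transformer A (\<lambda>x c \<rho>. put_slot x (\<rho> (Suc 0)) 0 (2 * \<rho> 0) (copy_slot x (\<rho> (Suc 0)) (\<rho> 0) 0 c))"
    by (rule transformer_seq [where G = "\<lambda>x c \<rho>. copy_slot x (\<rho> (Suc 0)) (\<rho> 0) 0 c"
          and H = "\<lambda>x c \<rho>. put_slot x (\<rho> (Suc 0)) 0 (2 * \<rho> 0) c"])
       (intro transformer_copy_slot transformer_put_slot computable_mult computable_const computable_var)+
  show ?thesis
    unfolding compress_def Let_def
    by (rule procedure_let [OF i, where F = "\<lambda>x c \<rho> i. (put_slot x (\<rho> 0) 0 (2 * i) (copy_slot x (\<rho> 0) i 0 c), [])"])
       (rule F)
qed

lemma transformer_decompress: "transformer A (\<lambda>x c \<rho>. decompress A C x (\<rho> 0) c)"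
proof -
  have i: "computable A True (\<lambda>x c \<rho>. slot x c (\<rho> 0) 0 div 2)"
    by (intro computable_div computable_slot computable_var computable_const)
  have r: "computable A True (\<lambda>x c \<rho>. bounded_least (clipped_pow2 (4 * length x + 9) (wid x)) (collision A C x c (\<rho> (Suc 0)) (\<rho> 0)))"
    by (intro computable_bounded_least computable_clipped_width decidable_collision computable_var)
  have put: "transformer A (\<lambda>x c \<rho>. put_slot x (\<rho> (Suc 0)) (\<rho> 0)
      (bounded_least (clipped_pow2 (4 * length x + 9) (wid x)) (collision A C x c (\<rho> (Suc 0)) (\<rho> 0))) c)"
    by (rule procedure_let [OF r, where F = "\<lambda>x c \<rho> r. (put_slot x (\<rho> (Suc 0)) (\<rho> 0) r c, [])"])
       (intro transformer_put_slot computable_var)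
  have copy: "transformer A (\<lambda>x c \<rho>. copy_slot x (\<rho> (Suc 0)) 0 (\<rho> 0) c)"
    by (intro transformer_copy_slot computable_var computable_const)
  show ?thesis
    unfolding decompress_def Let_def
    by (rule procedure_let [OF i, where F = "\<lambda>x c \<rho> i. (put_slot x (\<rho> 0) i
          (bounded_least (clipped_pow2 (4 * length x + 9) (wid x)) (collision A C x (copy_slot x (\<rho> 0) 0 i c) (\<rho> 0) i))
          (copy_slot x (\<rho> 0) 0 i c), [])"])
       (rule transformer_seq [OF copy put])
qed

lemma computable_free_weight:
  assumes "computable A a f" "computable A a g"
  shows "computable A a (\<lambda>x c \<rho>. free_weight x c (f x c \<rho>) (g x c \<rho>))"
  unfolding free_weight_def
  by (intro computable_Suc decidable_conj decidable_less computable_cat computable_addr computable_const assms)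

lemma transformer_penalise: "transformer A (\<lambda>x c \<rho>. penalise A C x (\<rho> 0) c)"
  unfolding penalise_def
  by (intro procedure_write decidable_eq computable_least_weight computable_if computable_free_weight computable_addr
      computable_const computable_var)

lemma procedure_main: "procedure A True (\<lambda>x c \<rho>. main A C x c)"
proof -
  have ex: "decidable A True (\<lambda>x c \<rho>. \<exists>b<num x. isolating A C x c b)"
    by (intro decidable_ex computable_num decidable_isolating computable_var)
  have b: "computable A True (\<lambda>x c \<rho>. bounded_least (num x) (isolating A C x c))"
    by (intro computable_bounded_least computable_num decidable_isolating computable_var)
  have "generator A True (\<lambda>x c \<rho>. concat (map (\<lambda>i. [\<not> least_weight A C x (block_weight x c (\<rho> 0) i (slot x c (\<rho> 0) i + 2)) =
       least_weight A C x (block_weight x c (\<rho> 0) i (slot x c (\<rho> 0) i + 1))]) [0..<num x]))"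
    by (intro generator_concat generator_Cons generator_Nil decidable_not decidable_eq computable_least_block_weight
        computable_add computable_slot computable_num computable_const computable_var)
  then have 1: "procedure A True (\<lambda>x c \<rho>. (c, map (\<lambda>i. \<not> least_weight A C x (block_weight x c (bounded_least (num x) (isolating A C x c)) i (slot x c (bounded_least (num x) (isolating A C x c)) i + 2)) =
       least_weight A C x (block_weight x c (bounded_least (num x) (isolating A C x c)) i (slot x c (bounded_least (num x) (isolating A C x c)) i + 1))) [0..<num x]))"
    unfolding concat_map_singleton
    by (rule procedure_let [OF b, where F = "\<lambda>x c \<rho> b. (c, map (\<lambda>i. \<not> least_weight A C x (block_weight x c b i (slot x c b i + 2)) =
       least_weight A C x (block_weight x c b i (slot x c b i + 1))) [0..<num x])"])
  have t1: "transformer A (\<lambda>x c \<rho>. repeat (\<lambda>v c. compress A C x v c) (num x) c)"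
    by (intro transformer_repeat computable_num transformer_compress)
  have t2: "transformer A (\<lambda>x c \<rho>. repeat (\<lambda>v c. penalise A C x v c) (num x) c)"
    by (intro transformer_repeat computable_num transformer_penalise)
  have t3: "transformer A (\<lambda>x c \<rho>. repeat (\<lambda>v c. decompress A C x v c) (num x) c)"
    by (intro transformer_repeat computable_num transformer_decompress)
  have "generator A True (\<lambda>x c \<rho>. concat (map (\<lambda>i. [\<not> c ! addr x i 0 0]) [0..<num x]))"
    by (intro generator_concat generator_Cons generator_Nil decidable_not computable_cat computable_addr computable_num
        computable_const computable_var)
  then have g: "generator A True (\<lambda>x c \<rho>. map (\<lambda>i. \<not> c ! addr x i 0 0) [0..<num x])"
    unfolding concat_map_singleton .
  \<comment> \<open>The answer is written before decompression, which destroys the free bits that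
    hold it.\<close>
  show ?thesis
    by (rule procedure_cong [OF procedure_if [OF ex 1 procedure_seq [OF procedure_seq [OF t1 t2] procedure_seq [OF g t3]]]])
       (auto simp: main_def seq_proc_def Let_def)
qed

lemma decidable_accepts: "decidable A True (\<lambda>x c \<rho>. accepts A C x)"
  unfolding accepts_def well_formed_def
  by (intro decidable_conj decidable_eq decidable_less decidable_all decidable_not computable_input_bit computable_ask
      generator_query computable_clipped_width computable_vmax computable_length computable_pairs computable_mult
      computable_add computable_diff computable_const computable_var)

subsection \<open>Correctness of the reduction\<close>

lemma query_encode:
  assumes "x = encode (s # ws)"
  shows "query x v V = encode (s # extend (2 * wid x) v 0 ws @ [binary V])"
proof -
  have "data V (length (binary V)) @ [True, True] = encode [binary V]"
    by (simp add: encode_Cons data_eq binary_eq_bits [symmetric])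
  moreover have "query_prefix (2 * wid x) v 0 x = encode (s # extend (2 * wid x) v 0 ws)"
    unfolding assms by (rule query_prefix_encode)
  ultimately show ?thesis by (simp add: query_def encode_append [symmetric])
qed

lemma query_in_iff:
  assumes "x = encode (s # ws)"
  shows "query x v V \<in> weighted_decision m R \<longleftrightarrow>
    (\<exists>W. extend (2 * wid x) v 0 ws = map binary W \<and> length W = m (length s) \<and>
         (\<exists>y. is_witness m R s y \<and> weight W y \<le> V))"
  unfolding query_encode [OF assms] weighted_decision_def
  by (auto simp: encode_inject dest!: injD [OF inj_binary])

lemma num_encode: "num (encode (s # ws)) = length ws"
  by (simp add: num_def seps_encode)

lemma well_formed_encode: "well_formed (encode (s # ws))"
proof -
  \<comment> \<open>Only the local conditions, with nonemptiness left aside, so that the empty code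
    can start the induction.\<close>
  define wf where "wf x \<longleftrightarrow> (0 < pairs x \<longrightarrow> input_bit x (2 * pairs x - 2)) \<and>
    (\<forall>t<pairs x. \<not> (input_bit x (2 * t) \<and> \<not> input_bit x (2 * t + 1)))" for x
  have step: "wf (a # b # y)" if "wf y" "a \<Longrightarrow> b" "pairs y = 0 \<Longrightarrow> a" for a b y
    unfolding wf_def
  proof (intro conjI impI allI)
    show "input_bit (a # b # y) (2 * pairs (a # b # y) - 2)"
      using that(1,3) by (cases "pairs y") (auto simp: wf_def)
    fix t assume "t < pairs (a # b # y)"
    then show "\<not> (input_bit (a # b # y) (2 * t) \<and> \<not> input_bit (a # b # y) (2 * t + 1))"
      using that(1,2) by (cases t) (auto simp: wf_def)
  qed
  have "wf (encode ss)" for ss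
  proof (induction ss)
    case (Cons s ss)
    show ?case
    proof (induction s)
      case Nil
      show ?case unfolding encode_Cons_Nil by (rule step [OF Cons.IH]) auto
    next
      case (Cons b s)
      have "0 < pairs (encode (s # ss))" by (simp add: pairs_encode_pos)
      then show ?case unfolding encode_Cons_Cons by (intro step [OF Cons.IH]) auto
    qed
  qed (simp add: wf_def pairs_def)
  moreover have "0 < pairs (encode (s # ws))" by (simp add: pairs_encode_pos)
  moreover have "length (encode (s # ws)) = 2 * pairs (encode (s # ws))"
    using even_length_encode [of "s # ws"] by (simp add: pairs_def)
  ultimately show ?thesis unfolding well_formed_def wf_def by blast
qed

lemma well_formed_imp_encode:
  assumes "well_formed x"
  shows "\<exists>s ws. x = encode (s # ws)"
proof -
  let ?h = "pairs x"
  have h: "length x = 2 * ?h" "0 < ?h" "input_bit x (2 * ?h - 2)"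
    "\<And>t. t < ?h \<Longrightarrow> input_bit x (2 * t) \<Longrightarrow> input_bit x (2 * t + 1)"
    using assms unfolding well_formed_def by blast+
  have "\<exists>ss. x = encode ss"
  proof (rule ex_encode [of _ ?h])
    show "\<forall>t<?h. x ! (2 * t) \<longrightarrow> x ! (2 * t + 1)"
      using h(1,4) by (auto simp: input_bit_def)
  qed (use h in \<open>auto simp: input_bit_def\<close>)
  then obtain ss where ss: "x = encode ss" by blast
  then have "ss \<noteq> []" using h(2) by (simp add: pairs_encode_pos)
  then show ?thesis using ss by (cases ss) auto
qed

section \<open>Reading and rewriting slots\<close>

lemma slot_less: "slot x c b j < 2 ^ wid x"
proof -
  have "(\<Sum>k<n. of_bool (f k) * 2 ^ k) < (2::nat) ^ n" for f n
  proof (induction n)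
    case (Suc n)
    then show ?case by (cases "f n") auto
  qed simp
  then show ?thesis by (simp add: slot_def)
qed

lemma slot_eq_horner: "slot x c b j = horner_sum of_bool 2 (map (\<lambda>k. c ! addr x b j k) [0..<wid x])"
  by (simp add: slot_def horner_sum_eq_sum atLeast0LessThan)

lemma nat_bit_eq_bit: "nat_bit v k = bit v k"
  by (simp add: nat_bit_def bit_iff_odd)

lemma bit_slot: "bit (slot x c b j) k \<longleftrightarrow> k < wid x \<and> c ! addr x b j k"
  unfolding slot_eq_horner by (auto simp: bit_horner_sum_bit_iff)

lemma slot_cong: "(\<And>k. k < wid x \<Longrightarrow> c ! addr x b j k = c' ! addr x b j k) \<Longrightarrow> slot x c b j = slot x c' b j"
  unfolding slot_def by (intro sum.cong) auto

text \<open>The written value may depend on the current tape as long as it is insensitive to the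
  cells written before. Distinct targets ensure that later writes do not destroy earlier
  ones.\<close>

lemma repeat_write:
  assumes "inj_on g {..<n}" "\<forall>k<n. g k < length c"
    and "\<And>k c'. k < n \<Longrightarrow> (\<And>q. q \<notin> g ` {..<k} \<Longrightarrow> c' ! q = c ! q) \<Longrightarrow> f k c' = h k"
  shows "length (repeat (\<lambda>k c. c[g k := f k c]) n c) = length c \<and>
    (\<forall>k<n. repeat (\<lambda>k c. c[g k := f k c]) n c ! g k = h k) \<and>
    (\<forall>q. q \<notin> g ` {..<n} \<longrightarrow> repeat (\<lambda>k c. c[g k := f k c]) n c ! q = c ! q)"
  using assms
proof (induction n)
  case (Suc n)
  let ?c = "repeat (\<lambda>k c. c[g k := f k c]) n c"
  have IH: "length ?c = length c" "\<forall>k<n. ?c ! g k = h k" "\<forall>q. q \<notin> g ` {..<n} \<longrightarrow> ?c ! q = c ! q"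
    using Suc.IH Suc.prems by (auto simp: inj_on_def)
  have f: "f n ?c = h n" by (rule Suc.prems(3)) (use IH(3) in auto)
  have ne: "g k \<noteq> g n" if "k < n" for k using Suc.prems(1) that by (auto simp: inj_on_def)
  have gn: "g n < length ?c" using IH(1) Suc.prems(2) by simp
  have "?c[g n := h n] ! g k = h k" if "k < Suc n" for k
  proof (cases "k = n")
    case False
    then have "k < n" "g n \<noteq> g k" using that ne [of k] by auto
    then show ?thesis using IH(2) by simp
  qed (use gn in simp)
  moreover have "?c[g n := h n] ! q = c ! q" if "q \<notin> g ` {..<Suc n}" for q
  proof -
    have "q \<noteq> g n" "q \<notin> g ` {..<n}" using that by auto
    then show ?thesis using IH(3) by simp
  qed
  ultimately show ?case using IH(1) f by simp
qed simp

lemma mult_add_inject: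
  fixes p q r p' r' :: nat
  assumes "p * q + r = p' * q + r'" "r < q" "r' < q"
  shows "p = p'" "r = r'"
proof -
  have "(p * q + r) div q = p" "(p * q + r) mod q = r" using assms(2) by simp_all
  moreover have "(p' * q + r') div q = p'" "(p' * q + r') mod q = r'" using assms(3) by simp_all
  ultimately show "p = p'" "r = r'" unfolding assms(1) by blast+
qed

lemma addr_inject:
  assumes "addr x b j k = addr x b' j' k'" "j < num x" "j' < num x" "k < wid x" "k' < wid x"
  shows "b = b' \<and> j = j' \<and> k = k'"
proof -
  note 1 = mult_add_inject [OF assms(1) [unfolded addr_def] assms(4,5)]
  note 2 = mult_add_inject [OF 1(1) assms(2,3)]
  show ?thesis using 1(2) 2 by blast
qed

lemma addr_less:
  assumes "b < num x" "j < num x" "k < wid x"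
  shows "addr x b j k < num x * num x * wid x"
proof -
  have "b * num x + j < Suc b * num x" using assms(2) by simp
  also have "\<dots> \<le> num x * num x" using assms(1) by (intro mult_right_mono) auto
  finally have "Suc (b * num x + j) \<le> num x * num x" by simp
  have "addr x b j k < Suc (b * num x + j) * wid x" using assms(3) by (simp add: addr_def)
  also have "\<dots> \<le> num x * num x * wid x" using \<open>Suc _ \<le> _\<close> by (intro mult_right_mono) auto
  finally show ?thesis .
qed

definition block :: "bool list \<Rightarrow> nat \<Rightarrow> nat set" where
  "block x b = {addr x b j k |j k. j < num x \<and> k < wid x}"

lemma block_disjoint: "q \<in> block x b \<Longrightarrow> q \<in> block x b' \<Longrightarrow> b = b'"
  unfolding block_def using addr_inject by blast

lemma in_blockI: "j < num x \<Longrightarrow> k < wid x \<Longrightarrow> addr x b j k \<in> block x b"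
  by (auto simp: block_def)

lemma inj_addr: "j < num x \<Longrightarrow> inj_on (addr x b j) {..<wid x}"
  by (rule inj_onI) (use addr_inject in blast)

text \<open>Source and target may be the same slot: bit \<open>k\<close> is read before it is
  written.\<close>

lemma copy_slot:
  assumes "b < num x" "i < num x" "j < num x" "num x * num x * wid x \<le> length c"
  shows "length (copy_slot x b i j c) = length c"
    and "k < wid x \<Longrightarrow> copy_slot x b i j c ! addr x b i k = c ! addr x b j k"
    and "q \<notin> addr x b i ` {..<wid x} \<Longrightarrow> copy_slot x b i j c ! q = c ! q"
proof -
  have "length (copy_slot x b i j c) = length c \<and>
    (\<forall>k<wid x. copy_slot x b i j c ! addr x b i k = c ! addr x b j k) \<and>
    (\<forall>q. q \<notin> addr x b i ` {..<wid x} \<longrightarrow> copy_slot x b i j c ! q = c ! q)"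
    unfolding copy_slot_def
  proof (rule repeat_write [OF inj_addr [OF assms(2)]])
    show "\<forall>k<wid x. addr x b i k < length c" using addr_less assms by (meson less_le_trans)
    fix k c' assume k: "k < wid x" and c': "\<And>q. q \<notin> addr x b i ` {..<k} \<Longrightarrow> c' ! q = c ! q"
    have "addr x b j k \<notin> addr x b i ` {..<k}"
    proof
      assume "addr x b j k \<in> addr x b i ` {..<k}"
      then obtain k' where "k' < k" "addr x b j k = addr x b i k'" by auto
      then show False using addr_inject [of x b j k b i k'] assms k by auto
    qed
    then show "c' ! addr x b j k = c ! addr x b j k" by (rule c')
  qed
  then show "length (copy_slot x b i j c) = length c"
    "k < wid x \<Longrightarrow> copy_slot x b i j c ! addr x b i k = c ! addr x b j k"
    "q \<notin> addr x b i ` {..<wid x} \<Longrightarrow> copy_slot x b i j c ! q = c ! q" by auto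
qed

lemma put_slot:
  assumes "b < num x" "i < num x" "num x * num x * wid x \<le> length c"
  shows "length (put_slot x b i v c) = length c"
    and "k < wid x \<Longrightarrow> put_slot x b i v c ! addr x b i k = nat_bit v k"
    and "q \<notin> addr x b i ` {..<wid x} \<Longrightarrow> put_slot x b i v c ! q = c ! q"
proof -
  have "length (put_slot x b i v c) = length c \<and>
    (\<forall>k<wid x. put_slot x b i v c ! addr x b i k = nat_bit v k) \<and>
    (\<forall>q. q \<notin> addr x b i ` {..<wid x} \<longrightarrow> put_slot x b i v c ! q = c ! q)"
    unfolding put_slot_def
  proof (rule repeat_write [OF inj_addr [OF assms(2)]])
    show "\<forall>k<wid x. addr x b i k < length c" using addr_less assms by (meson less_le_trans)
  qed simp
  then show "length (put_slot x b i v c) = length c"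
    "k < wid x \<Longrightarrow> put_slot x b i v c ! addr x b i k = nat_bit v k"
    "q \<notin> addr x b i ` {..<wid x} \<Longrightarrow> put_slot x b i v c ! q = c ! q" by auto
qed

lemma addr_notin_slot:
  assumes "j < num x" "i < num x" "k < wid x" "j \<noteq> i"
  shows "addr x b j k \<notin> addr x b i ` {..<wid x}"
proof
  assume "addr x b j k \<in> addr x b i ` {..<wid x}"
  then obtain k' where "k' < wid x" "addr x b j k = addr x b i k'" by auto
  then show False using addr_inject [of x b j k b i k'] assms by auto
qed

lemma notin_block_slot: "q \<notin> block x b \<Longrightarrow> i < num x \<Longrightarrow> q \<notin> addr x b i ` {..<wid x}"
  by (auto simp: block_def)

section \<open>Perturbed weights of an accepted input\<close>

lemma weight_eq_sum: "weight (map (\<lambda>i. W ! i * q + v i) [0..<length W]) y = q * weight W y + (\<Sum>i<length W. of_bool (y ! i) * v i)"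
proof -
  have *: "(\<Sum>i | i < n \<and> y ! i. f i) = (\<Sum>i<n. of_bool (y ! i) * f i)" for f :: "nat \<Rightarrow> nat" and n
  proof -
    have "{i. i < n \<and> y ! i} = {..<n} \<inter> {i. y ! i}" by auto
    then have "(\<Sum>i | i < n \<and> y ! i. f i) = (\<Sum>i<n. if i \<in> {i. y ! i} then f i else 0)"
      using sum.inter_restrict [of "{..<n}" f "{i. y ! i}"] by simp
    also have "\<dots> = (\<Sum>i<n. of_bool (y ! i) * f i)" by (intro sum.cong) auto
    finally show ?thesis .
  qed
  have "weight (map (\<lambda>i. W ! i * q + v i) [0..<length W]) y = (\<Sum>i<length W. of_bool (y ! i) * (W ! i * q + v i))"
    unfolding weight_def * by simp
  also have "\<dots> = q * (\<Sum>i<length W. of_bool (y ! i) * W ! i) + (\<Sum>i<length W. of_bool (y ! i) * v i)"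
    unfolding sum_distrib_left sum.distrib [symmetric] by (intro sum.cong) (auto simp: algebra_simps)
  finally show ?thesis unfolding weight_def * .
qed

lemma cap_less: "2 ^ wid x + 1 < (2::nat) ^ (2 * wid x)"
proof -
  have two: "(2::nat) \<le> 2 ^ wid x" by (simp add: wid_def)
  have "2 ^ wid x + 1 < 2 ^ wid x * (2::nat)" using two by simp
  also have "\<dots> \<le> 2 ^ wid x * (2 ^ wid x :: nat)" using two by (rule mult_left_mono) simp
  also have "\<dots> = 2 ^ (2 * wid x)" by (simp add: mult_2 power_add)
  finally show ?thesis .
qed

text \<open>\<open>light\<close> is what acceptance provides. It speaks of the largest perturbation
  only; smaller ones follow by monotonicity.\<close>

locale search_instance =
  fixes A :: "bool list set" and m :: "nat \<Rightarrow> nat" and R :: witness_relation and C :: nat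
    and x s :: "bool list" and W :: "nat list"
  assumes A: "A = weighted_decision m R"
    and x: "x = encode (s # map binary W)" and W: "length W = m (length s)"
    and light: "\<exists>y. is_witness m R s y \<and>
      weight (map (\<lambda>i. W ! i * 2 ^ (2 * wid x) + (2 ^ wid x + 1)) [0..<length W]) y < vmax C x"
begin

lemma num: "num x = length W"
  by (simp add: x num_encode)

lemma num_less: "num x < 2 ^ (wid x - 1)"
proof -
  have "length ss \<le> length (encode ss)" for ss
    by (induction ss) (simp_all add: encode_Cons)
  from this [of "s # map binary W"] have "length W < length x" by (simp add: x)
  then show ?thesis using two_power_wid(2) [of x] by (simp add: num)
qed

text \<open>Slots are below \<open>2 ^ wid x\<close>, perturbations are larger by one, and the
  collision test raises one of them once more.\<close>

abbreviation cap :: nat where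
  "cap \<equiv> 2 ^ wid x + 1"

sublocale min_weight "{y. is_witness m R s y}" "\<lambda>y. 2 ^ (2 * wid x) * weight W y" "num x"
  by unfold_locales (use light W in \<open>auto simp: is_witness_def num\<close>)

lemma weight_eq_wt: "weight (map (\<lambda>i. W ! i * 2 ^ (2 * wid x) + v i) [0..<length W]) y = wt v y"
  unfolding weight_eq_sum wt_def by (simp only: num)

lemma query_iff:
  assumes "\<And>j. v j \<le> cap"
  shows "query x v V \<in> A \<longleftrightarrow> (\<exists>y\<in>{y. is_witness m R s y}. wt v y \<le> V)"
proof -
  let ?W = "map (\<lambda>i. W ! i * 2 ^ (2 * wid x) + v (0 + i)) [0..<length W]"
  have ext: "extend (2 * wid x) v 0 (map binary W) = map binary ?W"
    by (rule extend_binary) (use assms cap_less le_less_trans in blast)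
  have inj: "map binary ?W = map binary W' \<longleftrightarrow> W' = ?W" for W'
    using inj_map_eq_map [OF inj_binary, of ?W W'] by blast
  have len: "length ?W = m (length s)" by (simp add: W)
  have wt: "weight ?W y = wt v y" for y unfolding add_0 by (rule weight_eq_wt)
  have "query x v V \<in> A \<longleftrightarrow> (\<exists>W'. W' = ?W \<and> length W' = m (length s) \<and> (\<exists>y. is_witness m R s y \<and> weight W' y \<le> V))"
    unfolding A query_in_iff [OF x] ext inj by (rule refl)
  also have "\<dots> \<longleftrightarrow> (\<exists>y. is_witness m R s y \<and> weight ?W y \<le> V)" using len by blast
  finally show ?thesis unfolding wt by blast
qed

text \<open>The witness from \<open>light\<close> costs no more under \<open>v\<close> than under
  the constant \<open>cap\<close>, so the minimum is below \<open>vmax\<close> and the search does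
  not end in its default value.\<close>

lemma least_weight_eq:
  assumes "\<And>j. v j \<le> cap"
  shows "least_weight A C x v = mn v"
  unfolding least_weight_def query_iff [OF assms]
proof (rule bounded_least_eq)
  obtain y where y: "is_witness m R s y" "wt (\<lambda>_. cap) y < vmax C x"
    using light weight_eq_wt [of "\<lambda>_. cap"] by auto
  have "mn v \<le> wt v y" using y mn_le by simp
  also have "\<dots> \<le> wt (\<lambda>_. cap) y"
    unfolding wt_def by (intro add_mono sum_mono mult_left_mono assms) auto
  finally show "mn v < vmax C x" using y(2) by simp
  show "\<exists>y\<in>{y. is_witness m R s y}. wt v y \<le> mn v"
    using ex_minimizer [of v] by (auto simp: minimizer_def)
  fix u assume "u < mn v"
  then show "\<not> (\<exists>y\<in>{y. is_witness m R s y}. wt v y \<le> u)"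
  proof (intro notI, elim bexE)
    fix y assume "u < mn v" "y \<in> {y. is_witness m R s y}" "wt v y \<le> u"
    then show False using mn_le [of y v] by simp
  qed
qed

text \<open>The perturbations of a witness sum up to less than \<open>2 ^ (2 * wid x)\<close>, the
  factor of the original weight, so they cannot make up for a difference of one in it.\<close>

lemma minimizer_arg_min:
  assumes "\<And>j. v j \<le> cap" "minimizer v y"
  shows "is_arg_min (weight W) (is_witness m R s) y"
proof -
  have low: "(\<Sum>i<num x. of_bool (z ! i) * v i) < 2 ^ (2 * wid x)" for z
  proof -
    have "(\<Sum>i<num x. of_bool (z ! i) * v i) \<le> (\<Sum>i<num x. cap)"
      using assms(1) by (intro sum_mono) (auto simp: of_bool_def)
    also have "\<dots> = num x * cap" by simp
    \<comment> \<open>There are fewer than \<open>2 ^ (wid x - 1)\<close> coordinates, so this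
      rounding makes the exponents add up to exactly \<open>2 * wid x\<close>.\<close>
    also have "\<dots> \<le> num x * 2 ^ (wid x + 1)" using one_le_power [of "2::nat" "wid x"] by (intro mult_left_mono) simp_all
    also have "\<dots> < 2 ^ (wid x - 1) * 2 ^ (wid x + 1)"
      using num_less by (intro mult_strict_right_mono) simp_all
    also have "\<dots> = 2 ^ (2 * wid x)"
      unfolding power_add [symmetric] by (rule arg_cong [of _ _ "\<lambda>e. 2 ^ e"]) (simp add: wid_def)
    finally show ?thesis .
  qed
  have y: "is_witness m R s y" "wt v y = mn v" using assms(2) by (auto simp: minimizer_def)
  have "weight W y \<le> weight W z" if z: "is_witness m R s z" for z
  proof (rule ccontr)
    assume "\<not> weight W y \<le> weight W z"
    then have "Suc (weight W z) \<le> weight W y" by simp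
    then have "2 ^ (2 * wid x) * Suc (weight W z) \<le> 2 ^ (2 * wid x) * weight W y" by (rule mult_left_mono) simp
    then have "wt v z < wt v y" using low [of z] by (simp add: wt_def)
    then show False using mn_le [of z v] z y by simp
  qed
  then show ?thesis using y by (auto simp: is_arg_min_def not_less)
qed

definition slots :: "bool list \<Rightarrow> nat \<Rightarrow> nat \<Rightarrow> nat" where
  "slots c b j = Suc (slot x c b j)"

lemma block_weight_eq: "block_weight x c b i a = (slots c b)(i := a)"
  by (auto simp: block_weight_def slots_def)

lemma slots_le: "a \<le> cap \<Longrightarrow> ((slots c b)(i := a)) j \<le> cap"
  using slot_less [of x c b j] by (simp add: slots_def)

lemma slots_le': "slots c b j \<le> cap"
  using slot_less [of x c b j] by (simp add: slots_def)

text \<open>The bound on \<open>r\<close> keeps the raised perturbation \<open>r + 2\<close> within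
  \<open>cap\<close>, where the oracle search returns true minima.\<close>

lemma collision_iff:
  assumes "i < num x" "r < 2 ^ wid x"
  shows "collision A C x c b i r \<longleftrightarrow> ambiguous ((slots c b)(i := Suc r)) i"
proof -
  have "least_weight A C x ((slots c b)(i := a)) = mn ((slots c b)(i := a))" if "a \<le> r + 2" for a
    by (rule least_weight_eq, rule slots_le) (use that assms(2) in simp)
  then show ?thesis
    unfolding collision_def block_weight_eq ambiguous_iff [OF assms(1)] by simp
qed

lemma slots_triv: "(slots c b)(i := Suc (slot x c b i)) = slots c b"
  by (simp add: slots_def fun_eq_iff)

lemma collision_slot_iff:
  assumes "i < num x"
  shows "collision A C x c b i (slot x c b i) \<longleftrightarrow> ambiguous (slots c b) i"
  unfolding collision_iff [OF assms slot_less] slots_triv by (rule refl)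

lemma isolating_output:
  assumes "isolating A C x c b"
  shows "minimizer (slots c b) (map (\<lambda>i. \<not> least_weight A C x (block_weight x c b i (slot x c b i + 2)) =
    least_weight A C x (block_weight x c b i (slot x c b i + 1))) [0..<num x])"
proof -
  have "\<not> ambiguous (slots c b) i" if "i < num x" for i
    using assms that collision_slot_iff unfolding isolating_def by blast
  note min = minimizer_unique [OF this]
  have "least_weight A C x (block_weight x c b i (slot x c b i + 2)) = mn ((slots c b)(i := Suc (slots c b i)))"
    "least_weight A C x (block_weight x c b i (slot x c b i + 1)) = mn (slots c b)" for i
  proof -
    have s: "slot x c b i + 2 = Suc (slots c b i)" "slot x c b i + 1 = slots c b i" by (simp_all add: slots_def)
    show "least_weight A C x (block_weight x c b i (slot x c b i + 2)) = mn ((slots c b)(i := Suc (slots c b i)))"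
      unfolding block_weight_eq s by (rule least_weight_eq, rule slots_le) (use slot_less [of x c b i] in \<open>simp add: slots_def\<close>)
    show "least_weight A C x (block_weight x c b i (slot x c b i + 1)) = mn (slots c b)"
      unfolding block_weight_eq s fun_upd_triv by (rule least_weight_eq, rule slots_le')
  qed
  with min show ?thesis by simp
qed

text \<open>
  The content of block \<open>b\<close> of \<open>c\<^sub>0\<close>, compressed in \<open>c\<close>; nothing is said about the free bit.
\<close>

definition compressed :: "bool list \<Rightarrow> bool list \<Rightarrow> nat \<Rightarrow> bool" where
  "compressed c\<^sub>0 c b \<longleftrightarrow> (\<exists>i<num x. ambiguous (slots c\<^sub>0 b) i \<and>
     (\<forall>k<wid x. 0 < k \<longrightarrow> c ! addr x b 0 k = nat_bit (2 * i) k) \<and>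
     (\<forall>j<num x. \<forall>k<wid x. j \<noteq> 0 \<longrightarrow> j \<noteq> i \<longrightarrow> c ! addr x b j k = c\<^sub>0 ! addr x b j k) \<and>
     (\<forall>k<wid x. i \<noteq> 0 \<longrightarrow> c ! addr x b i k = c\<^sub>0 ! addr x b 0 k))"

text \<open>The excepted cell is the free bit. Hence neither the greedy search nor work on other
  blocks spoils a compressed block.\<close>

lemma compressed_cong:
  assumes "compressed c\<^sub>0 c b" "\<And>q. q \<in> block x b \<Longrightarrow> q \<noteq> addr x b 0 0 \<Longrightarrow> c' ! q = c ! q"
  shows "compressed c\<^sub>0 c' b"
proof -
  obtain i where i: "i < num x" "ambiguous (slots c\<^sub>0 b) i"
     "\<forall>k<wid x. 0 < k \<longrightarrow> c ! addr x b 0 k = nat_bit (2 * i) k"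
     "\<forall>j<num x. \<forall>k<wid x. j \<noteq> 0 \<longrightarrow> j \<noteq> i \<longrightarrow> c ! addr x b j k = c\<^sub>0 ! addr x b j k"
     "\<forall>k<wid x. i \<noteq> 0 \<longrightarrow> c ! addr x b i k = c\<^sub>0 ! addr x b 0 k"
    using assms(1) unfolding compressed_def by blast
  have eq: "c' ! addr x b j k = c ! addr x b j k" if "j < num x" "k < wid x" "(j, k) \<noteq> (0, 0)" for j k
  proof (rule assms(2) [OF in_blockI [OF that(1,2)]])
    show "addr x b j k \<noteq> addr x b 0 0"
      using addr_inject [of x b j k b 0 0] that by (auto simp: wid_def)
  qed
  show ?thesis
    unfolding compressed_def
  proof (intro exI [of _ i] conjI)
    show "\<forall>k<wid x. 0 < k \<longrightarrow> c' ! addr x b 0 k = nat_bit (2 * i) k" using i(1,3) eq [of 0] by auto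
    show "\<forall>j<num x. \<forall>k<wid x. j \<noteq> 0 \<longrightarrow> j \<noteq> i \<longrightarrow> c' ! addr x b j k = c\<^sub>0 ! addr x b j k"
      using i(4) eq by auto
    show "\<forall>k<wid x. i \<noteq> 0 \<longrightarrow> c' ! addr x b i k = c\<^sub>0 ! addr x b 0 k" using i(1,5) eq [of i] by auto
  qed (use i in auto)
qed

lemma slots_cong:
  "(\<And>j k. j < num x \<Longrightarrow> j \<noteq> i \<Longrightarrow> k < wid x \<Longrightarrow> c ! addr x b j k = c' ! addr x b j k) \<Longrightarrow>
     j < num x \<Longrightarrow> ((slots c b)(i := a)) j = ((slots c' b)(i := a)) j"
  by (simp add: slots_def slot_cong [of x c b j c'])

lemma ambiguous_cong:
  assumes "\<And>j. j < num x \<Longrightarrow> v j = v' j"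
  shows "ambiguous v i = ambiguous v' i"
  unfolding ambiguous_def minimizer_def by (simp add: mn_cong [of v v', OF assms] wt_cong [of v v', OF assms])

text \<open>The tape agrees with \<open>c\<^sub>0\<close> on this block, so a collision exists and
  is one of the original content. Once slot 0 is copied over slot \<open>i\<close> and replaced by
  \<open>2 * i\<close>, only the old value of slot \<open>i\<close> is missing.\<close>

lemma compress_block:
  assumes b: "b < num x" and len: "num x * num x * wid x \<le> length c" and ni: "\<not> isolating A C x c\<^sub>0 b"
    and eq: "\<And>q. q \<in> block x b \<Longrightarrow> c ! q = c\<^sub>0 ! q"
  shows "compressed c\<^sub>0 (compress A C x b c) b" "length (compress A C x b c) = length c"
    "q \<notin> block x b \<Longrightarrow> compress A C x b c ! q = c ! q"
proof -
  define i where "i = bounded_least (num x) (\<lambda>i. collision A C x c b i (slot x c b i))"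
  have slot: "slot x c b j = slot x c\<^sub>0 b j" if "j < num x" for j
    by (rule slot_cong) (use eq in_blockI that in blast)
  have amb: "collision A C x c b i (slot x c b i) \<longleftrightarrow> ambiguous (slots c\<^sub>0 b) i" if "i < num x" for i
    unfolding collision_slot_iff [OF that]
    by (rule ambiguous_cong) (simp add: slots_def slot)
  obtain i' where "i' < num x" "ambiguous (slots c\<^sub>0 b) i'"
    using ni collision_slot_iff unfolding isolating_def by blast
  then have i: "i < num x"
    using bounded_least_le_witness [of "\<lambda>i. collision A C x c b i (slot x c b i)" i' "num x"] amb unfolding i_def by simp
  have ai: "ambiguous (slots c\<^sub>0 b) i"
    using bounded_least_holds [of "num x" "\<lambda>i. collision A C x c b i (slot x c b i)"] i amb unfolding i_def by simp
  have M: "0 < num x" using b by simp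
  define c1 where "c1 = copy_slot x b i 0 c"
  define c2 where "c2 = put_slot x b 0 (2 * i) c1"
  have c2: "compress A C x b c = c2" by (simp add: compress_def c2_def c1_def i_def Let_def)
  note cp = copy_slot [OF b i M len, folded c1_def]
  have len1: "num x * num x * wid x \<le> length c1" using len cp(1) by simp
  note pt = put_slot [OF b M len1, where v = "2 * i", folded c2_def]
  show "length (compress A C x b c) = length c" unfolding c2 using pt(1) cp(1) by simp
  show "q \<notin> block x b \<Longrightarrow> compress A C x b c ! q = c ! q"
    unfolding c2 using pt(3) [of q] cp(3) [of q] notin_block_slot [of q x b] i M by simp
  show "compressed c\<^sub>0 (compress A C x b c) b"
    unfolding c2 compressed_def
  proof (intro exI [of _ i] conjI allI impI)
    show "i < num x" by (rule i)
    show "ambiguous (slots c\<^sub>0 b) i" by (rule ai)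
    fix k assume k: "k < wid x"
    show "c2 ! addr x b 0 k = nat_bit (2 * i) k" by (rule pt(2) [OF k])
    show "c2 ! addr x b i k = c\<^sub>0 ! addr x b 0 k" if "i \<noteq> 0"
      using pt(3) [OF addr_notin_slot [OF i M k]] that cp(2) [OF k] eq [OF in_blockI [OF M k]] by simp
    show "c2 ! addr x b j k = c\<^sub>0 ! addr x b j k" if "j < num x" "j \<noteq> 0" "j \<noteq> i" for j
      using pt(3) [OF addr_notin_slot [OF that(1) M k]] cp(3) [OF addr_notin_slot [OF that(1) i k]] that
        eq [OF in_blockI [OF that(1) k]] by simp
  qed
qed

text \<open>The index \<open>i\<close> and all slots except \<open>i\<close> can be read off, and
  the collision test does not read slot \<open>i\<close>. So it has the same outcome as on
  \<open>c\<^sub>0\<close>, and by \<open>ambiguous_unique\<close> it succeeds for the lost value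
  only.\<close>

lemma decompress_block:
  assumes b: "b < num x" and len: "num x * num x * wid x \<le> length c" and cm: "compressed c\<^sub>0 c b"
  shows "q \<in> block x b \<Longrightarrow> decompress A C x b c ! q = c\<^sub>0 ! q" "length (decompress A C x b c) = length c"
    "q \<notin> block x b \<Longrightarrow> decompress A C x b c ! q = c ! q"
proof -
  obtain i where i: "i < num x" "ambiguous (slots c\<^sub>0 b) i"
     "\<forall>k<wid x. 0 < k \<longrightarrow> c ! addr x b 0 k = nat_bit (2 * i) k"
     "\<forall>j<num x. \<forall>k<wid x. j \<noteq> 0 \<longrightarrow> j \<noteq> i \<longrightarrow> c ! addr x b j k = c\<^sub>0 ! addr x b j k"
     "\<forall>k<wid x. i \<noteq> 0 \<longrightarrow> c ! addr x b i k = c\<^sub>0 ! addr x b 0 k"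
    using cm unfolding compressed_def by blast
  have M: "0 < num x" using b by simp
  have idx: "slot x c b 0 div 2 = i"
  proof (rule bit_eqI)
    fix n
    have "bit (slot x c b 0 div 2) n \<longleftrightarrow> Suc n < wid x \<and> c ! addr x b 0 (Suc n)"
      by (simp only: bit_Suc [symmetric] bit_slot)
    also have "\<dots> \<longleftrightarrow> Suc n < wid x \<and> bit i n"
      using i(3) by (auto simp: nat_bit_eq_bit bit_double_iff)
    \<comment> \<open>No bit of \<open>i\<close> is lost: it lies below
      \<open>2 ^ (wid x - 1)\<close>, so its double fits into the slot.\<close>
    also have "\<dots> \<longleftrightarrow> bit i n"
    proof -
      have "\<not> bit i n" if "wid x \<le> Suc n"
      proof -
        have "i < 2 ^ (wid x - 1)" using i(1) num_less by simp
        also have "(2::nat) ^ (wid x - 1) \<le> 2 ^ n" using that by (intro power_increasing) auto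
        finally show ?thesis by (simp add: bit_iff_odd)
      qed
      then show ?thesis by (meson not_le)
    qed
    finally show "bit (slot x c b 0 div 2) n \<longleftrightarrow> bit i n" .
  qed
  define c1 where "c1 = copy_slot x b 0 i c"
  define r where "r = bounded_least (clipped_pow2 (4 * length x + 9) (wid x)) (collision A C x c1 b i)"
  define c2 where "c2 = put_slot x b i r c1"
  have c2: "decompress A C x b c = c2" by (simp add: decompress_def c2_def r_def c1_def idx Let_def)
  note cp = copy_slot [OF b M i(1) len, folded c1_def]
  have len1: "num x * num x * wid x \<le> length c1" using len cp(1) by simp
  note pt = put_slot [OF b i(1) len1, where v = r, folded c2_def]
  have c1: "c1 ! addr x b j k = c\<^sub>0 ! addr x b j k" if j: "j < num x" "j \<noteq> i" and k: "k < wid x" for j k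
  proof (cases "j = 0")
    case True
    then show ?thesis using cp(2) [OF k] i(5) j k by simp
  next
    case False
    then show ?thesis using cp(3) [OF addr_notin_slot [OF j(1) M k]] i(4) j k by simp
  qed
  \<comment> \<open>The test overrides the perturbation of \<open>i\<close>, and all other slots are
    those of \<open>c\<^sub>0\<close> again.\<close>
  have col: "collision A C x c1 b i r' \<longleftrightarrow> ambiguous ((slots c\<^sub>0 b)(i := Suc r')) i" if "r' < 2 ^ wid x" for r'
    unfolding collision_iff [OF i(1) that] by (rule ambiguous_cong, rule slots_cong [OF c1])
  have amb: "ambiguous ((slots c\<^sub>0 b)(i := Suc (slot x c\<^sub>0 b i))) i"
    unfolding slots_triv by (rule i(2))
  have r: "r = slot x c\<^sub>0 b i"
    unfolding r_def clipped_width
  proof (rule bounded_least_eq [OF slot_less])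
    show "collision A C x c1 b i (slot x c\<^sub>0 b i)" using col [OF slot_less] amb by blast
    fix u assume u: "u < slot x c\<^sub>0 b i"
    show "\<not> collision A C x c1 b i u"
    proof
      assume "collision A C x c1 b i u"
      then have "ambiguous ((slots c\<^sub>0 b)(i := Suc u)) i"
        using col [of u] less_trans [OF u slot_less] by blast
      from ambiguous_unique [OF i(1) this amb] u show False by simp
    qed
  qed
  show "length (decompress A C x b c) = length c" unfolding c2 using pt(1) cp(1) by simp
  show "q \<notin> block x b \<Longrightarrow> decompress A C x b c ! q = c ! q"
    unfolding c2 using pt(3) [of q] cp(3) [of q] notin_block_slot [of q x b] i(1) M by simp
  assume "q \<in> block x b"
  then obtain j k where q: "q = addr x b j k" "j < num x" "k < wid x" by (auto simp: block_def)
  show "decompress A C x b c ! q = c\<^sub>0 ! q"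
  proof (cases "j = i")
    case True
    then show ?thesis unfolding c2 q(1) using pt(2) [OF q(3)] q(3) by (simp add: r nat_bit_eq_bit bit_slot)
  next
    case False
    then show ?thesis unfolding c2 q(1) using pt(3) [OF addr_notin_slot [OF q(2) i(1) q(3)]] c1 q by simp
  qed
qed

text \<open>Round \<open>i\<close> writes only the free bit of block \<open>i\<close> and takes its
  penalties from the bits of earlier rounds. The final bits therefore satisfy the fixed-point
  condition of \<open>greedy_minimizer\<close>.\<close>

lemma penalise_all:
  assumes len: "num x * num x * wid x \<le> length c"
  defines "c' \<equiv> repeat (penalise A C x) (num x) c"
  shows "length c' = length c" "q \<notin> (\<lambda>j. addr x j 0 0) ` {..<num x} \<Longrightarrow> c' ! q = c ! q"
    "minimizer (greedy (\<lambda>i. c' ! addr x i 0 0) (num x)) (map (\<lambda>i. \<not> c' ! addr x i 0 0) [0..<num x])"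
proof -
  let ?c = "\<lambda>n. repeat (penalise A C x) n c"
  have W0: "0 < wid x" by (simp add: wid_def)
  have l: "length (?c n) = length c" for n by (induction n) (simp_all add: penalise_def)
  then show "length c' = length c" by (simp add: c'_def)
  have step: "?c (Suc n) ! q = ?c n ! q" if "q \<noteq> addr x n 0 0" for n q
    using that by (simp add: penalise_def)
  have "?c n ! q = c ! q" if "q \<notin> (\<lambda>j. addr x j 0 0) ` {..<n}" for n q
    using that
  proof (induction n)
    case (Suc n)
    then have "q \<noteq> addr x n 0 0" "q \<notin> (\<lambda>j. addr x j 0 0) ` {..<n}" by auto
    then show ?case using step Suc.IH by metis
  qed simp
  then show "q \<notin> (\<lambda>j. addr x j 0 0) ` {..<num x} \<Longrightarrow> c' ! q = c ! q" by (simp add: c'_def)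
  define b where "b i = c' ! addr x i 0 0" for i
  have ne: "addr x i 0 0 \<noteq> addr x n 0 0" if "i \<noteq> n" "0 < num x" for i n
    using addr_inject [of x i 0 0 n 0 0] that W0 by auto
  have later: "?c n ! addr x i 0 0 = ?c (Suc i) ! addr x i 0 0" if "i < n" "0 < num x" for n i
    using that
  proof (induction n)
    case (Suc n)
    show ?case
    proof (cases "i = n")
      case False
      then have "i < n" using Suc.prems by simp
      then have "?c n ! addr x i 0 0 = ?c (Suc i) ! addr x i 0 0" using Suc.IH Suc.prems by blast
      then show ?thesis using step [OF ne [OF False Suc.prems(2)]] by metis
    qed simp
  qed simp
  have "b k \<longleftrightarrow> mn ((greedy b k)(k := 2)) = mn (greedy b k)" if k: "k < num x" for k
  proof -
    have M: "0 < num x" using k by simp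
    have le: "free_weight x (?c k) k j \<le> cap" for j
    proof -
      have "free_weight x (?c k) k j \<le> 2" by (simp add: free_weight_def of_bool_def)
      also have "2 \<le> cap" by (simp add: wid_def)
      finally show ?thesis .
    qed
    have le': "(if j = k then 2 else free_weight x (?c k) k j) \<le> cap" for j
      using le [of j] by (simp add: wid_def)
    have fw: "free_weight x (?c k) k j = greedy b k j" if "j < num x" for j
    proof (cases "j < k")
      case True
      then have "?c k ! addr x j 0 0 = b j"
        using later [OF True M] later [OF that M] unfolding b_def c'_def by simp
      then show ?thesis by (simp add: free_weight_def greedy_def)
    qed (simp add: free_weight_def greedy_def)
    have 1: "least_weight A C x (free_weight x (?c k) k) = mn (greedy b k)"
      unfolding least_weight_eq [OF le] by (rule mn_cong) (rule fw)
    have 2: "least_weight A C x (\<lambda>j. if j = k then 2 else free_weight x (?c k) k j) = mn ((greedy b k)(k := 2))"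
      unfolding least_weight_eq [OF le'] by (rule mn_cong) (simp add: fw)
    have "addr x k 0 0 < length (?c k)" using addr_less [OF k M W0] len l by simp
    then have "?c (Suc k) ! addr x k 0 0 \<longleftrightarrow> mn ((greedy b k)(k := 2)) = mn (greedy b k)"
      by (simp add: penalise_def 1 2)
    then show ?thesis using later [OF k M] unfolding b_def c'_def by simp
  qed
  then have min: "minimizer (greedy b (num x)) (map (\<lambda>i. \<not> b i) [0..<num x])"
    by (rule greedy_minimizer)
  have "b = (\<lambda>i. c' ! addr x i 0 0)" by (rule ext) (simp only: b_def)
  with min show "minimizer (greedy (\<lambda>i. c' ! addr x i 0 0) (num x)) (map (\<lambda>i. \<not> c' ! addr x i 0 0) [0..<num x])"
    by (simp only:)
qed

text \<open>Blocks are disjoint, so a block still has its original content when its turn comes, and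
  the failure to isolate on the original tape applies to it.\<close>

lemma compress_all:
  assumes len: "num x * num x * wid x \<le> length c" and ni: "\<And>b. b < num x \<Longrightarrow> \<not> isolating A C x c b"
    and n: "n \<le> num x"
  defines "c' \<equiv> repeat (compress A C x) n c"
  shows "length c' = length c \<and> (\<forall>b<n. compressed c c' b) \<and> (\<forall>q. (\<forall>b<n. q \<notin> block x b) \<longrightarrow> c' ! q = c ! q)"
  using n unfolding c'_def
proof (induction n)
  case (Suc n)
  let ?c = "repeat (compress A C x) n c"
  have IH: "length ?c = length c" "\<forall>b<n. compressed c ?c b" "\<forall>q. (\<forall>b<n. q \<notin> block x b) \<longrightarrow> ?c ! q = c ! q"
    using Suc by auto
  have n: "n < num x" using Suc.prems by simp
  have eq: "?c ! q = c ! q" if "q \<in> block x n" for q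
  proof -
    have "\<forall>b<n. q \<notin> block x b" using block_disjoint [OF that] by auto
    then show ?thesis using IH(3) by blast
  qed
  have len': "num x * num x * wid x \<le> length ?c" using len IH(1) by simp
  have cb: "compressed c (compress A C x n ?c) n" "length (compress A C x n ?c) = length ?c"
    "q \<notin> block x n \<Longrightarrow> compress A C x n ?c ! q = ?c ! q" for q
    by (rule compress_block [OF n len' ni [OF n]], erule eq, assumption?)+
  have "compressed c (compress A C x n ?c) b" if "b < n" for b
  proof (rule compressed_cong)
    show "compressed c ?c b" using IH(2) that by simp
    fix q assume "q \<in> block x b"
    then have "q \<notin> block x n" using block_disjoint that by blast
    then show "compress A C x n ?c ! q = ?c ! q" by (rule cb(3))
  qed
  note old = this
  show ?case
    unfolding repeat.simps
  proof (intro conjI allI impI)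
    show "length (compress A C x n ?c) = length c" using cb(2) IH(1) by simp
    show "compressed c (compress A C x n ?c) b" if "b < Suc n" for b
      using that old cb(1) by (cases "b = n") auto
    show "compress A C x n ?c ! q = c ! q" if "\<forall>b<Suc n. q \<notin> block x b" for q
      using that cb(3) [of q] IH(3) by auto
  qed
qed simp

lemma decompress_all:
  assumes len: "num x * num x * wid x \<le> length c" and n: "n \<le> num x"
    and cm: "\<And>b. b < num x \<Longrightarrow> compressed c\<^sub>0 c b"
  defines "c' \<equiv> repeat (decompress A C x) n c"
  shows "length c' = length c \<and> (\<forall>b<n. \<forall>q\<in>block x b. c' ! q = c\<^sub>0 ! q) \<and>
    (\<forall>q. (\<forall>b<n. q \<notin> block x b) \<longrightarrow> c' ! q = c ! q)"
  using n unfolding c'_def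
proof (induction n)
  case (Suc n)
  let ?c = "repeat (decompress A C x) n c"
  have IH: "length ?c = length c" "\<forall>b<n. \<forall>q\<in>block x b. ?c ! q = c\<^sub>0 ! q"
    "\<forall>q. (\<forall>b<n. q \<notin> block x b) \<longrightarrow> ?c ! q = c ! q"
    using Suc by auto
  have n: "n < num x" using Suc.prems by simp
  have len': "num x * num x * wid x \<le> length ?c" using len IH(1) by simp
  have "compressed c\<^sub>0 ?c n"
  proof (rule compressed_cong [OF cm [OF n]])
    fix q assume q: "q \<in> block x n"
    have "\<forall>b<n. q \<notin> block x b" using block_disjoint [OF q] by auto
    then show "?c ! q = c ! q" using IH(3) by blast
  qed
  note db = decompress_block [OF n len' this]
  have "decompress A C x n ?c ! q = c\<^sub>0 ! q" if "b < n" "q \<in> block x b" for b q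
  proof -
    have "q \<notin> block x n" using block_disjoint that by blast
    then show ?thesis using db(3) [of q] IH(2) that by simp
  qed
  note old = this
  show ?case
    unfolding repeat.simps
  proof (intro conjI allI impI ballI)
    show "length (decompress A C x n ?c) = length c" using db(2) IH(1) by simp
    show "decompress A C x n ?c ! q = c\<^sub>0 ! q" if "b < Suc n" "q \<in> block x b" for b q
      using that old [of b q] db(1) [of q] by (cases "b = n") (simp_all add: less_Suc_eq)
    show "decompress A C x n ?c ! q = c ! q" if "\<forall>b<Suc n. q \<notin> block x b" for q
      using that db(3) [of q] IH(3) by auto
  qed
qed simp

theorem main_correct:
  assumes len: "num x * num x * wid x \<le> length c"
  shows "fst (main A C x c) = c" "is_arg_min (weight W) (is_witness m R s) (snd (main A C x c))"
proof -
  have "fst (main A C x c) = c \<and> is_arg_min (weight W) (is_witness m R s) (snd (main A C x c))"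
  proof (cases "\<exists>b<num x. isolating A C x c b")
    case True
    let ?b = "bounded_least (num x) (isolating A C x c)"
    obtain b where b: "b < num x" "isolating A C x c b" using True by blast
    then have "?b < num x" using bounded_least_le_witness [of "isolating A C x c" b] by (meson le_less_trans)
    then have "isolating A C x c ?b" by (rule bounded_least_holds)
    from minimizer_arg_min [OF slots_le' isolating_output [OF this]] show ?thesis
      using True by (simp add: main_def Let_def)
  next
    case False
    define c1 where "c1 = repeat (compress A C x) (num x) c"
    define c2 where "c2 = repeat (penalise A C x) (num x) c1"
    define c3 where "c3 = repeat (decompress A C x) (num x) c2"
    have m: "main A C x c = (c3, map (\<lambda>i. \<not> c2 ! addr x i 0 0) [0..<num x])"
      unfolding main_def Let_def if_not_P [OF False] c1_def c2_def c3_def by (rule refl)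
    have ni: "\<not> isolating A C x c b" if "b < num x" for b using False that by blast
    have C1: "length c1 = length c" "\<And>b. b < num x \<Longrightarrow> compressed c c1 b"
      "\<And>q. (\<forall>b<num x. q \<notin> block x b) \<Longrightarrow> c1 ! q = c ! q"
      using compress_all [OF len ni order_refl, folded c1_def] by blast+
    have len1: "num x * num x * wid x \<le> length c1" using len C1(1) by simp
    note C2 = penalise_all [OF len1, folded c2_def]
    have len2: "num x * num x * wid x \<le> length c2" using len1 C2(1) by simp
    have cm2: "compressed c c2 b" if b: "b < num x" for b
    proof (rule compressed_cong [OF C1(2) [OF b]])
      fix q assume q: "q \<in> block x b" "q \<noteq> addr x b 0 0"
      \<comment> \<open>A cell of block \<open>b\<close> is never the free bit of another block, so
        the greedy search changes at most the excepted cell.\<close>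
      have "q \<noteq> addr x j 0 0" if "j < num x" for j
        using q block_disjoint [of q x b j] in_blockI [of 0 x 0 j] that by (auto simp: wid_def)
      then show "c2 ! q = c1 ! q" by (intro C2(2)) auto
    qed
    note C3 = decompress_all [OF len2 order_refl cm2, folded c3_def]
    have "c3 = c"
    proof (rule nth_equalityI)
      show "length c3 = length c" using C3 C2(1) C1(1) by simp
      fix q
      show "c3 ! q = c ! q"
      proof (cases "\<exists>b<num x. q \<in> block x b")
        case False
        have "q \<noteq> addr x j 0 0" if "j < num x" for j
          using False in_blockI [of 0 x 0 j] that by (auto simp: wid_def)
        then have "c2 ! q = c1 ! q" by (intro C2(2)) auto
        then show ?thesis using False C3 C1(3) by simp
      qed (use C3 in blast)
    qed
    moreover have "greedy (\<lambda>i. c2 ! addr x i 0 0) (num x) j \<le> cap" for j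
      by (simp add: greedy_def wid_def of_bool_def)
    ultimately show ?thesis using minimizer_arg_min [OF _ C2(3)] m by simp
  qed
  then show "fst (main A C x c) = c" "is_arg_min (weight W) (is_witness m R s) (snd (main A C x c))" by auto
qed

end

section \<open>Polynomial bounds and conclusion\<close>

lemma length_binary_le: "length (binary n) \<le> n"
proof (induction n rule: binary.induct)
  case (1 n)
  show ?case
  proof (cases "n = 0")
    case False
    then have "binary n = odd n # binary (n div 2)" by (subst binary.simps) simp
    moreover have "Suc (n div 2) \<le> n" using False by presburger
    ultimately show ?thesis using 1 [OF False] by simp
  qed simp
qed

lemma num_le: "num x \<le> length x"
proof -
  have "seps x t \<le> t" for t
    unfolding seps_def by (rule order_trans [OF sum_mono [of _ _ "\<lambda>_. 1"]]) (auto simp: of_bool_def)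
  from this [of "pairs x"] show ?thesis by (simp add: num_def pairs_def)
qed

text \<open>The total size of all slots of all blocks; the exponent 3 is the one required of the
  catalytic tape.\<close>

lemma space_bound: "num x * num x * wid x \<le> (length x + 2) ^ 3"
proof -
  have "num x \<le> length x + 2" "wid x \<le> length x + 2"
    using num_le [of x] length_binary_le [of "length x"] by (simp_all add: wid_def)
  then have "num x * num x * wid x \<le> (length x + 2) * (length x + 2) * (length x + 2)"
    by (intro mult_le_mono)
  then show ?thesis by (simp add: power3_eq_cube)
qed

lemma weight_less_vmax:
  assumes "length W \<le> length x" "\<And>w. w \<in> set W \<Longrightarrow> w \<le> length W ^ C"
  shows "weight (map (\<lambda>i. W ! i * 2 ^ (2 * wid x) + (2 ^ wid x + 1)) [0..<length W]) y < vmax C x"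
proof -
  define N where "N = 4 * length x + 8"
  have N: "8 \<le> N" "length W \<le> N" "2 ^ wid x \<le> N"
    using assms(1) two_power_wid(1) [of x] by (simp_all add: N_def)
  have sq: "2 ^ (2 * wid x) \<le> N ^ 2"
    using power_mono [OF N(3), of 2] by (simp add: power_mult [symmetric] mult.commute)
  let ?W = "map (\<lambda>i. W ! i * 2 ^ (2 * wid x) + (2 ^ wid x + 1)) [0..<length W]"
  \<comment> \<open>The shifted weight is at most \<open>N ^ (C + 2)\<close>, and the perturbation
    adds at most two more terms of this size.\<close>
  have each: "?W ! i \<le> 3 * N ^ (C + 2)" if i: "i < length W" for i
  proof -
    have "W ! i \<le> N ^ C"
      using assms(2) [of "W ! i"] i power_mono [OF N(2), of C] by (meson le0 le_trans nth_mem)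
    then have "W ! i * 2 ^ (2 * wid x) \<le> N ^ C * N ^ 2" using sq by (rule mult_le_mono)
    moreover have "N \<le> N ^ (C + 2)" using N(1) by (intro self_le_power) auto
    ultimately have "W ! i * 2 ^ (2 * wid x) + (2 ^ wid x + 1) \<le> N ^ (C + 2) + (N ^ (C + 2) + N ^ (C + 2))"
      using N(1,3) unfolding power_add by linarith
    then show ?thesis using i by simp
  qed
  have "weight ?W y \<le> (\<Sum>i | i < length ?W \<and> y ! i. 3 * N ^ (C + 2))"
    unfolding weight_def by (intro sum_mono) (use each in auto)
  also have "\<dots> = card {i. i < length W \<and> y ! i} * (3 * N ^ (C + 2))" by simp
  also have "card {i. i < length W \<and> y ! i} \<le> card {..<length W}" by (intro card_mono) auto
  also have "card {..<length W} * (3 * N ^ (C + 2)) \<le> N * (3 * N ^ (C + 2))" using N(2) by (intro mult_le_mono) simp_all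
  also have "\<dots> = 3 * N ^ (C + 3)" by (simp add: power_add power3_eq_cube power2_eq_square)
  also have "\<dots> < N * N ^ (C + 3)" using N(1) by (intro mult_strict_right_mono) auto
  also have "\<dots> = vmax C x" by (simp add: vmax_def N_def numeral_eq_Suc)
  finally show ?thesis by simp
qed

theorem mainTheorem1:
  fixes L :: "bool list set"
    and R :: "bool list \<Rightarrow> bool list \<Rightarrow> bool"
    and m :: "nat \<Rightarrow> nat"
    and c :: nat
  assumes "is_polynomial m"
    and "poly_space_computable R"
    and "\<And>x. x \<in> L \<longleftrightarrow> (\<exists>y. length y = m (length x) \<and> R x y)"
    and "c > 0"
  shows "min_weight_search L m R c \<in> CL_oracle (weighted_decision m R)"
proof (rule CL_oracleI [OF decidable_accepts procedure_main])
  define A where "A = weighted_decision m R"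
  have L: "x \<in> L \<longleftrightarrow> (\<exists>y. is_witness m R x y)" for x
    using assms(3) by (simp add: is_witness_def)
  have ext: "extend (2 * wid x) (\<lambda>_. clipped_pow2 (4 * length x + 9) (wid x) + 1) 0 (map binary W) =
      map binary (map (\<lambda>i. W ! i * 2 ^ (2 * wid x) + (2 ^ wid x + 1)) [0..<length W])" for x W
    unfolding clipped_width by (rule extend_binary) (rule cap_less)
  fix x \<tau> :: "bool list"
  assume space: "(length x + 2) ^ 3 \<le> length \<tau>"
  show "if accepts (weighted_decision m R) c x
    then fst (main (weighted_decision m R) c x \<tau>) = \<tau> \<and> Some (snd (main (weighted_decision m R) c x \<tau>)) \<in> min_weight_search L m R c x
    else None \<in> min_weight_search L m R c x"
  proof (cases "accepts A c x")
    case True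
    obtain s ws where x: "x = encode (s # ws)"
      using True well_formed_imp_encode unfolding accepts_def by blast
    obtain W1 y where W1: "extend (2 * wid x) (\<lambda>_. clipped_pow2 (4 * length x + 9) (wid x) + 1) 0 ws = map binary W1"
      "length W1 = m (length s)" and y: "is_witness m R s y" "weight W1 y \<le> vmax c x - 1"
      using True unfolding accepts_def A_def query_in_iff [OF x] by blast
    \<comment> \<open>The oracle contains codes of numerals only, and the inserted bits cannot hide
      a malformed weight of the input.\<close>
    obtain W where W: "ws = map binary W" using extend_binary_only_if [OF W1(1)] by blast
    have "W1 = map (\<lambda>i. W ! i * 2 ^ (2 * wid x) + (2 ^ wid x + 1)) [0..<length W]"
      using W1(1) [unfolded W ext] inj_map_eq_map [OF inj_binary] by metis
    moreover have "0 < vmax c x" by (simp add: vmax_def)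
    \<comment> \<open>The validating query is exactly the assumption \<open>light\<close>: its
      threshold is the largest number below \<open>vmax\<close>.\<close>
    ultimately interpret search_instance A m R c x s W
      using W1(2) y x W by unfold_locales (auto simp: A_def intro!: exI [of _ y])
    have "num x * num x * wid x \<le> length \<tau>" using space_bound space by (rule order_trans)
    note cor = main_correct [OF this]
    have "Some (snd (main A c x \<tau>)) \<in> min_weight_search L m R c x"
      unfolding min_weight_search_def
    proof (intro CollectI allI impI)
      fix x' W' assume "x = encode (x' # map binary W') \<and> length W' = m (length x') \<and> (\<forall>w\<in>set W'. w \<le> m (length x') ^ c)"
      \<comment> \<open>Codes are unique, so the instance of the specification is the one that was
        decoded.\<close>
      then have "s # map binary W = x' # map binary W'" using x W by (simp add: encode_inject)
      then have "x' = s" "W' = W" using inj_map_eq_map [OF inj_binary, of W W'] by auto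
      moreover have "s \<in> L" using y(1) L by blast
      ultimately show "if x' \<in> L then \<exists>y. Some (snd (main A c x \<tau>)) = Some y \<and> is_arg_min (weight W') (is_witness m R x') y
          else Some (snd (main A c x \<tau>)) = None"
        using cor(2) by simp
    qed
    then show ?thesis using True cor(1) unfolding A_def by simp
  next
    case False
    have "None \<in> min_weight_search L m R c x"
      unfolding min_weight_search_def
    proof (intro CollectI allI impI)
      fix s W assume a: "x = encode (s # map binary W) \<and> length W = m (length s) \<and> (\<forall>w\<in>set W. w \<le> m (length s) ^ c)"
      then have x: "x = encode (s # map binary W)" by blast
      \<comment> \<open>The weight bound of an instance makes every witness light enough for the
        validating query, so its rejection shows that there is no witness.\<close>
      have "s \<notin> L"
      proof
        assume "s \<in> L"
        then obtain y where y: "is_witness m R s y" using L by blast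
        have "length W \<le> length x" using num_le [of x] num_encode [of s "map binary W"] x by simp
        then have "weight (map (\<lambda>i. W ! i * 2 ^ (2 * wid x) + (2 ^ wid x + 1)) [0..<length W]) y \<le> vmax c x - 1"
          using weight_less_vmax [of W x c y] a by fastforce
        then have "query x (\<lambda>_. clipped_pow2 (4 * length x + 9) (wid x) + 1) (vmax c x - 1) \<in> A"
          unfolding A_def query_in_iff [OF x] ext using a y
          by (intro exI [of _ "map (\<lambda>i. W ! i * 2 ^ (2 * wid x) + (2 ^ wid x + 1)) [0..<length W]"]) auto
        moreover have "well_formed x" unfolding x by (rule well_formed_encode)
        ultimately show False using False unfolding accepts_def by blast
      qed
      then show "if s \<in> L then \<exists>y. None = Some y \<and> is_arg_min (weight W) (is_witness m R s) y else None = None"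
        by simp
    qed
    then show ?thesis using False unfolding A_def by simp
  qed
qed

end
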